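(* Let $N\ge1$, $\rho\in[0,1)$, $\alpha\in[0,1]$, $q\in(0,1)$, and let $(r_n)_{n\ge0}$ satisfy $0\le r_n<1$ and $\lim_{n\to\infty}n^\gamma r_n=c>0$ for some $\gamma\in(\tfrac12,1]$. Let $Z_n(i)\in[0,1]$ ($i=1,\dots,N$, $n\ge0$) evolve by $Z_{n+1}(i)=(1-r_n)Z_n(i)+r_n(\rho I_{n+1}(i)+(1-\rho)q)$, where, with $\mathcal F_n=\sigma(Z_k(i):\,1\le i\le N,\ 0\le k\le n)$ and $Z_n=\frac1N\sum_{i=1}^N Z_n(i)$, the $I_{n+1}(1),\dots,I_{n+1}(N)\in\{0,1\}$ are conditionally independent given $\mathcal F_n$ with $P(I_{n+1}(i)=1\mid\mathcal F_n)=(1-\alpha)Z_n(i)+\alpha Z_n$. Assume the law of $(Z_0(1),\dots,Z_0(N))$ is permutation invariant, $E[Z_0(i)]=\tfrac12$ and $E[Z_0(1-Z_0)]>0$. Fix $i\in\{1,\dots,N\}$ and set $\beta=1-\rho(1-\alpha)$. (i) If $\tfrac12<\gamma<1$, then \[\Big(n^{\gamma/2}e^{c\beta t}\big(Z_{\lfloor n+n^\gamma t\rfloor}(i)-Z_{\lfloor n+n^\gamma t\rfloor}\big)\Big)_{t\ge0}\xrightarrow{d}(W_{V_t})_{t\ge0},\quad V_t=\Big(1-\frac1N\Big)\frac{c\rho^2q(1-q)}{2\beta}e^{2c\beta t}.\] (ii) If $\gamma=1$ and $2c\beta>1$, then \[\Big(n^{1/2}(1+t)^{c\beta}\big(Z_{\lfloor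 n+nt\rfloor}(i)-Z_{\lfloor n+nt\rfloor}\big)\Big)_{t\ge0}\xrightarrow{d}(W_{V_t})_{t\ge0},\quad V_t=\Big(1-\frac1N\Big)\frac{c^2\rho^2q(1-q)}{2c\beta-1}(1+t)^{2c\beta-1}.\] Here $W$ is a standard Brownian motion and convergence in distribution is with respect to the Skorohod topology on $D[0,+\infty)$. *)

theory Defs
  imports "HOL-Probability.Probability" "HOL-Combinatorics.Permutations"
begin

definition Zbar :: "nat \<Rightarrow> (nat \<Rightarrow> nat \<Rightarrow> 'a \<Rightarrow> real) \<Rightarrow> nat \<Rightarrow> 'a \<Rightarrow> real" where
  "Zbar N Z n \<omega> = (\<Sum>j = 1..N. Z n j \<omega>) / real N"

definition Filt :: "'a measure \<Rightarrow> nat \<Rightarrow> (nat \<Rightarrow> nat \<Rightarrow> 'a \<Rightarrow> real) \<Rightarrow> nat \<Rightarrow> 'a measure" where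
  "Filt M N Z n = sigma (space M)
     {Z k j -` B \<inter> space M | k j B. k \<le> n \<and> j \<in> {1..N} \<and> B \<in> sets borel}"

text \<open>Skorohod space D[0,\<infinity>): cadlag paths on [0,\<infinity>) (values at t<0 are ignored).\<close>
definition cadlag :: "(real \<Rightarrow> real) \<Rightarrow> bool" where
  "cadlag x \<longleftrightarrow> (\<forall>t\<ge>0. (x \<longlongrightarrow> x t) (at_right t)) \<and> (\<forall>t>0. \<exists>l. (x \<longlongrightarrow> l) (at_left t))"

definition time_change :: "(real \<Rightarrow> real) \<Rightarrow> bool" where
  "time_change l \<longleftrightarrow> continuous_on {0..} l \<and> strict_mono_on {0..} l \<and> l ` {0..} = {0..}"

text \<open>Convergence in the Skorohod J1 topology of D[0,\<infinity>)
  (Billingsley, Convergence of Probability Measures, 2nd ed., Thm 16.2).\<close>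
definition sk_converges :: "(nat \<Rightarrow> real \<Rightarrow> real) \<Rightarrow> (real \<Rightarrow> real) \<Rightarrow> bool" where
  "sk_converges xs x \<longleftrightarrow> (\<exists>ls. (\<forall>n. time_change (ls n)) \<and>
      (\<forall>e>0. eventually (\<lambda>n. \<forall>t\<ge>0. \<bar>ls n t - t\<bar> \<le> e) sequentially) \<and>
      (\<forall>m::real. \<forall>e>0. eventually (\<lambda>n. \<forall>t\<in>{0..m}. \<bar>xs n (ls n t) - x t\<bar> \<le> e) sequentially))"

text \<open>Bounded functionals on D[0,\<infinity>) continuous for the Skorohod topology
  (the topology is metrizable, so sequential continuity is continuity).\<close>
definition sk_test :: "((real \<Rightarrow> real) \<Rightarrow> real) \<Rightarrow> bool" where
  "sk_test f \<longleftrightarrow> (\<exists>B. \<forall>x. cadlag x \<longrightarrow> \<bar>f x\<bar> \<le> B) \<and>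
     (\<forall>xs x. cadlag x \<and> (\<forall>n. cadlag (xs n)) \<and> sk_converges xs x \<longrightarrow> (\<lambda>n. f (xs n)) \<longlonglongrightarrow> f x)"

definition sk_conv_dist :: "'a measure \<Rightarrow> (nat \<Rightarrow> 'a \<Rightarrow> real \<Rightarrow> real) \<Rightarrow> 'b measure \<Rightarrow> ('b \<Rightarrow> real \<Rightarrow> real) \<Rightarrow> bool" where
  "sk_conv_dist M X P Y \<longleftrightarrow>
     (\<forall>f. sk_test f \<longrightarrow> (\<lambda>n. \<integral>\<omega>. f (X n \<omega>) \<partial>M) \<longlonglongrightarrow> (\<integral>\<omega>. f (Y \<omega>) \<partial>P))"

definition brownian_motion :: "'b measure \<Rightarrow> (real \<Rightarrow> 'b \<Rightarrow> real) \<Rightarrow> bool" where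
  "brownian_motion P W \<longleftrightarrow> prob_space P \<and>
     (\<forall>t\<ge>0. W t \<in> borel_measurable P) \<and>
     (\<forall>\<omega>\<in>space P. W 0 \<omega> = 0 \<and> continuous_on {0..} (\<lambda>t. W t \<omega>)) \<and>
     (\<forall>s t. 0 \<le> s \<and> s < t \<longrightarrow>
        distributed P lborel (\<lambda>\<omega>. W t \<omega> - W s \<omega>) (normal_density 0 (sqrt (t - s)))) \<and>
     (\<forall>ts::nat \<Rightarrow> real. \<forall>k. 0 \<le> ts 0 \<and> (\<forall>j. ts j \<le> ts (Suc j)) \<longrightarrow>
        prob_space.indep_vars P (\<lambda>_. borel) (\<lambda>j \<omega>. W (ts (Suc j)) \<omega> - W (ts j) \<omega>) {..<k})"

end

theory Submission
  imports Defs "HOL-Real_Asymp.Real_Asymp"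
begin

text \<open>
  Put \<beta> = 1 - \<rho>(1 - \<alpha>) and D(n) = Z(n, i) - Z(n). Then D(n+1) = (1 - \<beta> r(n)) D(n) + \<rho> r(n) \<zeta>(n) with bounded
  martingale differences \<zeta>(n), so D(n) / A(n) is a martingale, where A(n) is the product of 1 - \<beta> r(j) over j < n. All
  Z(n, j) converge to q in mean square, hence the conditional variance of \<zeta>(n) converges in mean to
  (1 - 1/N) q (1 - q). After rescaling, the martingale is compared with a Brownian motion run at the accumulated
  deterministic variance by Lindeberg replacement of its increments one at a time; a fourth moment maximal
  inequality controls the oscillation between grid points. Weak convergence in the Skorohod topology then needs no
  tightness theorem: a bounded continuous functional is the increasing limit of its inf-convolutions with the
  locally uniform metric, which are Lipschitz and therefore depend, up to a small error, only on finitely many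
  coordinates of the path.
\<close>

section \<open>Bounded Lipschitz functions of finitely many coordinates\<close>

abbreviation l1_dist :: "nat \<Rightarrow> (nat \<Rightarrow> real) \<Rightarrow> (nat \<Rightarrow> real) \<Rightarrow> real" where
  "l1_dist J x y \<equiv> \<Sum>j\<le>J. \<bar>x j - y j\<bar>"

definition bounded_Lipschitz :: "nat \<Rightarrow> ((nat \<Rightarrow> real) \<Rightarrow> real) \<Rightarrow> bool" where
  "bounded_Lipschitz J h \<longleftrightarrow> (\<exists>B. \<forall>x. \<bar>h x\<bar> \<le> B) \<and> (\<exists>L. \<forall>x y. \<bar>h x - h y\<bar> \<le> L * l1_dist J x y)"

lemma bounded_LipschitzI:
  assumes "\<And>x. \<bar>h x\<bar> \<le> B" "\<And>x y. \<bar>h x - h y\<bar> \<le> L * l1_dist J x y"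
  shows "bounded_Lipschitz J h"
  using assms unfolding bounded_Lipschitz_def by blast

lemma bounded_Lipschitz_bounded:
  assumes "bounded_Lipschitz J h" shows "\<exists>B\<ge>0. \<forall>x. \<bar>h x\<bar> \<le> B"
proof -
  obtain B where B: "\<And>x. \<bar>h x\<bar> \<le> B" using assms unfolding bounded_Lipschitz_def by blast
  have "B \<ge> 0" using B[of undefined] by linarith
  with B show ?thesis by blast
qed

lemma bounded_Lipschitz_Lipschitz:
  assumes "bounded_Lipschitz J h" shows "\<exists>L\<ge>0. \<forall>x y. \<bar>h x - h y\<bar> \<le> L * l1_dist J x y"
proof -
  obtain L where L: "\<And>x y. \<bar>h x - h y\<bar> \<le> L * l1_dist J x y"
    using assms unfolding bounded_Lipschitz_def by blast
  have "\<bar>h x - h y\<bar> \<le> \<bar>L\<bar> * l1_dist J x y" for x y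
  proof -
    have "L * l1_dist J x y \<le> \<bar>L\<bar> * l1_dist J x y" by (intro mult_right_mono sum_nonneg) auto
    with L[of x y] show ?thesis by linarith
  qed
  thus ?thesis using abs_ge_zero by blast
qed

lemma bounded_Lipschitz_truncate:
  assumes "bounded_Lipschitz J h"
  shows "h x = h (\<lambda>j. x (min j J))"
proof -
  obtain L where "\<bar>h x - h (\<lambda>j. x (min j J))\<bar> \<le> L * l1_dist J x (\<lambda>j. x (min j J))"
    using bounded_Lipschitz_Lipschitz[OF assms] by blast
  thus ?thesis by simp
qed

lemma bounded_Lipschitz_tendsto:
  assumes h: "bounded_Lipschitz J h" and X: "\<And>j. ((\<lambda>n. X n j) \<longlongrightarrow> x j) F"
  shows "((\<lambda>n. h (X n)) \<longlongrightarrow> h x) F"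
proof -
  obtain L where L: "\<And>x y. \<bar>h x - h y\<bar> \<le> L * l1_dist J x y"
    using bounded_Lipschitz_Lipschitz[OF h] by blast
  have "((\<lambda>n. L * l1_dist J (X n) x) \<longlongrightarrow> L * l1_dist J x x) F"
    by (intro tendsto_intros X)
  hence "((\<lambda>n. L * l1_dist J (X n) x) \<longlongrightarrow> 0) F" by simp
  hence "((\<lambda>n. h (X n) - h x) \<longlongrightarrow> 0) F"
    by (rule Lim_null_comparison[rotated]) (use L in simp)
  thus ?thesis by (rule LIM_zero_cancel)
qed

lemma tendsto_coordinate:
  fixes X :: "'b \<Rightarrow> 'i \<Rightarrow> 'c :: topological_space"
  assumes "(X \<longlongrightarrow> x) F" shows "((\<lambda>n. X n j) \<longlongrightarrow> x j) F"
  using continuous_on_tendsto_compose[OF continuous_on_product_coordinates assms] by simp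

lemma bounded_Lipschitz_continuous:
  assumes "bounded_Lipschitz J h" shows "continuous_on UNIV h"
  unfolding continuous_on_def
  by (intro ballI bounded_Lipschitz_tendsto[OF assms]) (rule tendsto_coordinate[OF tendsto_ident_at])

lemma bounded_Lipschitz_measurable:
  assumes "bounded_Lipschitz J h" "\<And>j. (\<lambda>\<omega>. X \<omega> j) \<in> borel_measurable M"
  shows "(\<lambda>\<omega>. h (X \<omega>)) \<in> borel_measurable M"
proof -
  have "X \<in> borel_measurable M" using assms(2) by (rule measurable_coordinatewise_then_product)
  moreover have "h \<in> borel_measurable borel"
    using bounded_Lipschitz_continuous[OF assms(1)] by (rule borel_measurable_continuous_onI)
  ultimately show ?thesis by measurable
qed

lemma bounded_Lipschitz_translate:
  assumes "bounded_Lipschitz J h" shows "bounded_Lipschitz J (\<lambda>x. h (\<lambda>j. x j + d j))"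
proof -
  obtain B where B: "\<And>x. \<bar>h x\<bar> \<le> B"
    using bounded_Lipschitz_bounded[OF assms] by blast
  obtain L where L: "\<And>x y. \<bar>h x - h y\<bar> \<le> L * l1_dist J x y"
    using bounded_Lipschitz_Lipschitz[OF assms] by blast
  show ?thesis
  proof (rule bounded_LipschitzI[OF B])
    show "\<bar>h (\<lambda>j. x j + d j) - h (\<lambda>j. y j + d j)\<bar> \<le> L * l1_dist J x y" for x y
      using L[of "\<lambda>j. x j + d j" "\<lambda>j. y j + d j"] by simp
  qed
qed

lemma bounded_Lipschitz_cmult:
  assumes "bounded_Lipschitz J h" shows "bounded_Lipschitz J (\<lambda>x. c * h x)"
proof -
  obtain B where B: "\<And>x. \<bar>h x\<bar> \<le> B"
    using bounded_Lipschitz_bounded[OF assms] by blast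
  obtain L where L: "\<And>x y. \<bar>h x - h y\<bar> \<le> L * l1_dist J x y"
    using bounded_Lipschitz_Lipschitz[OF assms] by blast
  show ?thesis
  proof (rule bounded_LipschitzI)
    show "\<bar>c * h x\<bar> \<le> \<bar>c\<bar> * B" for x by (simp add: abs_mult B mult_left_mono)
    show "\<bar>c * h x - c * h y\<bar> \<le> (\<bar>c\<bar> * L) * l1_dist J x y" for x y
      using mult_left_mono[OF L[of x y], of "\<bar>c\<bar>"] by (simp add: abs_mult[symmetric] algebra_simps)
  qed
qed

lemma bounded_Lipschitz_diff:
  assumes "bounded_Lipschitz J h" "bounded_Lipschitz J k"
  shows "bounded_Lipschitz J (\<lambda>x. h x - k x)"
proof -
  obtain B where B: "\<And>x. \<bar>h x\<bar> \<le> B"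
    using bounded_Lipschitz_bounded[OF assms(1)] by blast
  obtain L where L: "\<And>x y. \<bar>h x - h y\<bar> \<le> L * l1_dist J x y"
    using bounded_Lipschitz_Lipschitz[OF assms(1)] by blast
  obtain B' where B': "\<And>x. \<bar>k x\<bar> \<le> B'"
    using bounded_Lipschitz_bounded[OF assms(2)] by blast
  obtain L' where L': "\<And>x y. \<bar>k x - k y\<bar> \<le> L' * l1_dist J x y"
    using bounded_Lipschitz_Lipschitz[OF assms(2)] by blast
  show ?thesis
  proof (rule bounded_LipschitzI)
    show "\<bar>h x - k x\<bar> \<le> B + B'" for x using B[of x] B'[of x] by linarith
    show "\<bar>h x - k x - (h y - k y)\<bar> \<le> (L + L') * l1_dist J x y" for x y
      using L[of x y] L'[of x y] by (simp add: algebra_simps)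
  qed
qed

context prob_space
begin

lemma abs_expectation_le:
  fixes f :: "'a \<Rightarrow> real"
  assumes "\<And>\<omega>. \<omega> \<in> space M \<Longrightarrow> \<bar>f \<omega>\<bar> \<le> B"
  shows "\<bar>expectation f\<bar> \<le> B"
proof (cases "integrable M f")
  case True
  have "\<bar>expectation f\<bar> \<le> expectation (\<lambda>\<omega>. \<bar>f \<omega>\<bar>)" by (rule integral_abs_bound)
  also have "\<dots> \<le> B"
    by (rule integral_le_const) (use True assms in auto)
  finally show ?thesis .
next
  case False
  obtain \<omega> where "\<omega> \<in> space M" using not_empty by blast
  from assms[OF this] False show ?thesis by (simp add: not_integrable_integral_eq)
qed

lemma abs_expectation_diff_le:
  fixes f g :: "'a \<Rightarrow> real"
  assumes "integrable M f" "integrable M g" "\<And>\<omega>. \<omega> \<in> space M \<Longrightarrow> \<bar>f \<omega> - g \<omega>\<bar> \<le> B"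
  shows "\<bar>expectation f - expectation g\<bar> \<le> B"
  using abs_expectation_le[of "\<lambda>\<omega>. f \<omega> - g \<omega>" B] assms by simp

lemma bounded_Lipschitz_integrable:
  assumes h: "bounded_Lipschitz J h" and X: "\<And>j. (\<lambda>\<omega>. X \<omega> j) \<in> borel_measurable M"
  shows "integrable M (\<lambda>\<omega>. h (X \<omega>))"
proof -
  obtain B where "\<And>x. \<bar>h x\<bar> \<le> B" using bounded_Lipschitz_bounded[OF h] by blast
  thus ?thesis
    by (intro integrable_const_bound[where B=B] AE_I2 bounded_Lipschitz_measurable[OF h X]) auto
qed

lemma bounded_Lipschitz_mult_integrable:
  fixes f :: "'a \<Rightarrow> real"
  assumes g: "bounded_Lipschitz J g" and X: "\<And>j. (\<lambda>\<omega>. X \<omega> j) \<in> borel_measurable M"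
    and f: "integrable M f"
  shows "integrable M (\<lambda>\<omega>. g (X \<omega>) * f \<omega>)"
proof -
  obtain B where B: "\<And>x. \<bar>g x\<bar> \<le> B" using bounded_Lipschitz_bounded[OF g] by blast
  have [measurable]: "(\<lambda>\<omega>. g (X \<omega>)) \<in> borel_measurable M"
    by (rule bounded_Lipschitz_measurable[OF g X])
  show ?thesis
  proof (rule Bochner_Integration.integrable_bound)
    show "integrable M (\<lambda>\<omega>. B * f \<omega>)" using f by simp
    show "(\<lambda>\<omega>. g (X \<omega>) * f \<omega>) \<in> borel_measurable M" using f by measurable
    have "\<bar>g x\<bar> * \<bar>f \<omega>\<bar> \<le> \<bar>B\<bar> * \<bar>f \<omega>\<bar>" for x \<omega>
      using B[of x] by (intro mult_right_mono) auto
    thus "AE \<omega> in M. norm (g (X \<omega>) * f \<omega>) \<le> norm (B * f \<omega>)" by (simp add: abs_mult)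
  qed
qed

end

section \<open>Smoothing by averages\<close>

definition random_shift :: "'a measure \<Rightarrow> ('a \<Rightarrow> nat \<Rightarrow> real) \<Rightarrow> ((nat \<Rightarrow> real) \<Rightarrow> real) \<Rightarrow> (nat \<Rightarrow> real) \<Rightarrow> real" where
  "random_shift M Y h x = (\<integral>\<omega>. h (\<lambda>j. x j + Y \<omega> j) \<partial>M)"

abbreviation line :: "(nat \<Rightarrow> real) \<Rightarrow> (nat \<Rightarrow> real) \<Rightarrow> real \<Rightarrow> nat \<Rightarrow> real" where
  "line x e s \<equiv> \<lambda>j. x j + s * e j"

text \<open>Stating the Taylor expansion as an inequality, without mentioning derivatives of h, lets it survive averaging
  without differentiation under the integral sign.\<close>

definition smooth_along :: "nat \<Rightarrow> real \<Rightarrow> (nat \<Rightarrow> real) \<Rightarrow> ((nat \<Rightarrow> real) \<Rightarrow> real) \<Rightarrow>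
    ((nat \<Rightarrow> real) \<Rightarrow> real) \<Rightarrow> ((nat \<Rightarrow> real) \<Rightarrow> real) \<Rightarrow> bool" where
  "smooth_along J C e h h1 h2 \<longleftrightarrow>
     bounded_Lipschitz J h \<and> bounded_Lipschitz J h1 \<and> bounded_Lipschitz J h2 \<and> (\<forall>x. \<bar>h2 x\<bar> \<le> C) \<and>
     (\<forall>x s. \<bar>h (line x e s) - h x - s * h1 x - s\<^sup>2 / 2 * h2 x\<bar> \<le> C * \<bar>s\<bar> ^ 3)"

lemma smooth_alongD:
  assumes "smooth_along J C e h h1 h2"
  shows "bounded_Lipschitz J h" "bounded_Lipschitz J h1" "bounded_Lipschitz J h2" "\<bar>h2 x\<bar> \<le> C"
    "\<bar>h (line x e s) - h x - s * h1 x - s\<^sup>2 / 2 * h2 x\<bar> \<le> C * \<bar>s\<bar> ^ 3" "C \<ge> 0"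
proof -
  show C: "\<bar>h2 x\<bar> \<le> C" for x using assms unfolding smooth_along_def by blast
  show "C \<ge> 0" using C[of undefined] by linarith
qed (use assms in \<open>auto simp: smooth_along_def\<close>)

lemma smooth_along_mono:
  assumes "smooth_along J C e h h1 h2" "C \<le> C'" shows "smooth_along J C' e h h1 h2"
proof -
  have "C * \<bar>s\<bar> ^ 3 \<le> C' * \<bar>s\<bar> ^ 3" for s :: real by (intro mult_right_mono assms) simp
  thus ?thesis using assms unfolding smooth_along_def by (meson order_trans)
qed

context prob_space
begin

lemma random_shift_Lipschitz:
  assumes h: "bounded_Lipschitz J h" and Y: "\<And>j. (\<lambda>\<omega>. Y \<omega> j) \<in> borel_measurable M"
    and L: "\<And>x y. \<bar>h x - h y\<bar> \<le> L * l1_dist J x y"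
  shows "\<bar>random_shift M Y h x - random_shift M Y h y\<bar> \<le> L * l1_dist J x y"
proof -
  have "integrable M (\<lambda>\<omega>. h (\<lambda>j. z j + Y \<omega> j))" for z
    by (rule bounded_Lipschitz_integrable[OF h]) (use Y in simp)
  moreover have "\<bar>h (\<lambda>j. x j + Y \<omega> j) - h (\<lambda>j. y j + Y \<omega> j)\<bar> \<le> L * l1_dist J x y" for \<omega>
    using L[of "\<lambda>j. x j + Y \<omega> j" "\<lambda>j. y j + Y \<omega> j"] by simp
  ultimately show ?thesis unfolding random_shift_def by (intro abs_expectation_diff_le)
qed

lemma abs_random_shift_le: "(\<And>x. \<bar>h x\<bar> \<le> B) \<Longrightarrow> \<bar>random_shift M Y h x\<bar> \<le> B"
  unfolding random_shift_def by (rule abs_expectation_le)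

lemma bounded_Lipschitz_random_shift:
  assumes h: "bounded_Lipschitz J h" and Y: "\<And>j. (\<lambda>\<omega>. Y \<omega> j) \<in> borel_measurable M"
  shows "bounded_Lipschitz J (random_shift M Y h)"
proof -
  obtain B where B: "\<And>x. \<bar>h x\<bar> \<le> B"
    using bounded_Lipschitz_bounded[OF h] by blast
  obtain L where L: "\<And>x y. \<bar>h x - h y\<bar> \<le> L * l1_dist J x y"
    using bounded_Lipschitz_Lipschitz[OF h] by blast
  show ?thesis
    by (rule bounded_LipschitzI[OF abs_random_shift_le random_shift_Lipschitz[OF h Y L]]) (rule B)
qed

lemma smooth_along_random_shift:
  assumes h: "smooth_along J C e h h1 h2" and Y: "\<And>j. (\<lambda>\<omega>. Y \<omega> j) \<in> borel_measurable M"
  shows "smooth_along J C e (random_shift M Y h) (random_shift M Y h1) (random_shift M Y h2)"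
proof -
  note bL = smooth_alongD(1-3)[OF h]
  have int: "integrable M (\<lambda>\<omega>. g (\<lambda>j. x j + Y \<omega> j))" if "bounded_Lipschitz J g" for g x
    by (rule bounded_Lipschitz_integrable[OF that]) (use Y in simp)
  have "\<bar>random_shift M Y h (line x e s) - random_shift M Y h x - s * random_shift M Y h1 x
      - s\<^sup>2 / 2 * random_shift M Y h2 x\<bar> \<le> C * \<bar>s\<bar> ^ 3" for x s
  proof -
    define R where "R = (\<lambda>\<omega>. h (\<lambda>j. line x e s j + Y \<omega> j) - h (\<lambda>j. x j + Y \<omega> j)
      - s * h1 (\<lambda>j. x j + Y \<omega> j) - s\<^sup>2 / 2 * h2 (\<lambda>j. x j + Y \<omega> j))"
    have "\<bar>R \<omega>\<bar> \<le> C * \<bar>s\<bar> ^ 3" for \<omega>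
      using smooth_alongD(5)[OF h, of "\<lambda>j. x j + Y \<omega> j" s] unfolding R_def by (simp add: algebra_simps)
    hence "\<bar>expectation R\<bar> \<le> C * \<bar>s\<bar> ^ 3" by (rule abs_expectation_le)
    thus ?thesis
      unfolding R_def random_shift_def using int[OF bL(1)] int[OF bL(2)] int[OF bL(3)] by simp
  qed
  moreover have "\<bar>random_shift M Y h2 x\<bar> \<le> C" for x
    by (rule abs_random_shift_le) (rule smooth_alongD(4)[OF h])
  ultimately show ?thesis unfolding smooth_along_def
    by (auto intro!: bounded_Lipschitz_random_shift bL Y)
qed

end

lemma Taylor2_Lipschitz:
  fixes G G1 G2 :: "real \<Rightarrow> real"
  assumes G: "\<And>s. (G has_real_derivative G1 s) (at s)" "\<And>s. (G1 has_real_derivative G2 s) (at s)"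
    and K: "\<And>s t. \<bar>G2 s - G2 t\<bar> \<le> K * \<bar>s - t\<bar>"
  shows "\<bar>G s - G 0 - s * G1 0 - s\<^sup>2 / 2 * G2 0\<bar> \<le> K * \<bar>s\<bar> ^ 3"
proof -
  define d where "d = (\<lambda>m::nat. if m = 0 then G else if m = 1 then G1 else G2)"
  have "\<exists>t. \<bar>t\<bar> \<le> \<bar>s\<bar> \<and> G s = (\<Sum>m<2. d m 0 / fact m * s ^ m) + d 2 t / fact 2 * s ^ 2"
    by (rule Maclaurin_bi_le) (use G in \<open>auto simp: d_def less_2_cases_iff\<close>)
  then obtain t where t: "\<bar>t\<bar> \<le> \<bar>s\<bar>" and "G s = (\<Sum>m<2. d m 0 / fact m * s ^ m) + d 2 t / fact 2 * s ^ 2"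
    by blast
  hence "G s - G 0 - s * G1 0 - s\<^sup>2 / 2 * G2 0 = s\<^sup>2 / 2 * (G2 t - G2 0)"
    by (simp add: d_def numeral_2_eq_2 algebra_simps)
  hence "\<bar>G s - G 0 - s * G1 0 - s\<^sup>2 / 2 * G2 0\<bar> = s\<^sup>2 / 2 * \<bar>G2 t - G2 0\<bar>"
    by (simp only: abs_mult) (simp add: abs_mult)
  also have "\<dots> \<le> s\<^sup>2 * (K * \<bar>s\<bar>)"
  proof (intro mult_mono)
    have "K \<ge> 0" using K[of 1 0] by simp
    thus "\<bar>G2 t - G2 0\<bar> \<le> K * \<bar>s\<bar>"
      using K[of t 0] mult_left_mono[OF t, of K] by simp
  qed auto
  also have "\<dots> = K * \<bar>s\<bar> ^ 3" by (simp add: power3_eq_cube power2_eq_square)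
  finally show ?thesis .
qed

definition unit_uniform :: "real measure" where "unit_uniform = restrict_space lborel {0..1}"

lemma prob_space_unit_uniform: "prob_space unit_uniform"
  by (rule prob_spaceI) (simp add: unit_uniform_def space_restrict_space emeasure_restrict_space)

lemma measurable_unit_uniform: "f \<in> borel_measurable borel \<Longrightarrow> f \<in> borel_measurable unit_uniform"
  unfolding unit_uniform_def by (rule measurable_restrict_space1) simp

lemma integral_unit_uniform:
  fixes F g :: "real \<Rightarrow> real"
  assumes g: "continuous_on UNIV g" and F: "\<And>x. (F has_real_derivative g x) (at x)" and "\<delta> > 0"
  shows "(\<integral>u. g (x + \<delta> * u) \<partial>unit_uniform) = (F (x + \<delta>) - F x) / \<delta>"
proof -
  have cont: "continuous_on {0..1} (\<lambda>u. g (x + \<delta> * u))"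
    by (rule continuous_on_compose2[OF g]) (auto intro!: continuous_intros)
  have "((\<lambda>u. g (x + \<delta> * u)) has_integral F (x + \<delta> * 1) / \<delta> - F (x + \<delta> * 0) / \<delta>) {0..1}"
  proof (rule fundamental_theorem_of_calculus)
    fix u :: real
    have "((\<lambda>u. F (x + \<delta> * u) / \<delta>) has_real_derivative g (x + \<delta> * u)) (at u)"
      using \<open>\<delta> > 0\<close> by (auto intro!: derivative_eq_intros DERIV_chain2[OF F])
    thus "((\<lambda>u. F (x + \<delta> * u) / \<delta>) has_vector_derivative g (x + \<delta> * u)) (at u within {0..1})"
      by (simp add: has_real_derivative_iff_has_vector_derivative has_vector_derivative_at_within)
  qed simp
  moreover have "(\<integral>u. g (x + \<delta> * u) \<partial>unit_uniform) = integral {0..1} (\<lambda>u. g (x + \<delta> * u))"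
    using set_borel_integral_eq_integral(2)[OF borel_integrable_atLeastAtMost'[OF cont]]
    unfolding unit_uniform_def by (simp add: integral_restrict_space set_lebesgue_integral_def)
  ultimately show ?thesis by (simp add: diff_divide_distrib integral_unique)
qed

lemma has_derivative_unit_uniform_average:
  fixes g :: "real \<Rightarrow> real"
  assumes g: "continuous_on UNIV g" and \<delta>: "\<delta> > 0"
  shows "((\<lambda>x. \<integral>u. g (x + \<delta> * u) \<partial>unit_uniform) has_real_derivative (g (x + \<delta>) - g x) / \<delta>) (at x)"
proof -
  have "\<exists>F. \<forall>x :: real. -\<infinity> < ereal x \<longrightarrow> ereal x < \<infinity> \<longrightarrow> (F has_vector_derivative g x) (at x)"
    by (rule einterval_antiderivative) (use g in \<open>auto simp: continuous_on_eq_continuous_at\<close>)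
  then obtain F where F: "\<And>x. (F has_real_derivative g x) (at x)"
    by (auto simp: has_real_derivative_iff_has_vector_derivative)
  have "((\<lambda>x. (F (x + \<delta>) - F x) / \<delta>) has_real_derivative (g (x + \<delta>) - g x) / \<delta>) (at x)"
    using \<delta> by (auto intro!: derivative_eq_intros F DERIV_chain2[OF F])
  thus ?thesis by (simp add: integral_unit_uniform[OF g F \<delta>])
qed

definition segment_average :: "real \<Rightarrow> (nat \<Rightarrow> real) \<Rightarrow> ((nat \<Rightarrow> real) \<Rightarrow> real) \<Rightarrow> (nat \<Rightarrow> real) \<Rightarrow> real" where
  "segment_average \<delta> e = random_shift unit_uniform (\<lambda>u j. \<delta> * u * e j)"

definition diff_quot :: "real \<Rightarrow> (nat \<Rightarrow> real) \<Rightarrow> ((nat \<Rightarrow> real) \<Rightarrow> real) \<Rightarrow> (nat \<Rightarrow> real) \<Rightarrow> real" where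
  "diff_quot \<delta> e h x = inverse \<delta> * (h (line x e \<delta>) - h x)"

lemma bounded_Lipschitz_segment_average:
  "bounded_Lipschitz J h \<Longrightarrow> bounded_Lipschitz J (segment_average \<delta> e h)"
  unfolding segment_average_def
  by (rule prob_space.bounded_Lipschitz_random_shift[OF prob_space_unit_uniform])
    (auto intro!: measurable_unit_uniform)

lemma smooth_along_segment_average:
  "smooth_along J C e h h1 h2 \<Longrightarrow>
    smooth_along J C e (segment_average \<delta> d h) (segment_average \<delta> d h1) (segment_average \<delta> d h2)"
  unfolding segment_average_def
  by (rule prob_space.smooth_along_random_shift[OF prob_space_unit_uniform])
    (auto intro!: measurable_unit_uniform)

lemma bounded_Lipschitz_diff_quot: "bounded_Lipschitz J h \<Longrightarrow> bounded_Lipschitz J (diff_quot \<delta> e h)"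
  unfolding diff_quot_def
  by (intro bounded_Lipschitz_cmult bounded_Lipschitz_diff bounded_Lipschitz_translate)

lemma l1_dist_line_le:
  assumes "\<And>j. \<bar>e j\<bar> \<le> 1"
  shows "l1_dist J (line x e s) (line x e t) \<le> real (Suc J) * \<bar>s - t\<bar>"
proof -
  have "\<bar>line x e s j - line x e t j\<bar> \<le> \<bar>s - t\<bar>" for j
  proof -
    have "\<bar>line x e s j - line x e t j\<bar> = \<bar>s - t\<bar> * \<bar>e j\<bar>"
      by (simp add: abs_mult[symmetric] algebra_simps)
    also have "\<dots> \<le> \<bar>s - t\<bar> * 1" by (intro mult_left_mono assms) auto
    finally show ?thesis by simp
  qed
  hence "l1_dist J (line x e s) (line x e t) \<le> (\<Sum>j\<le>J. \<bar>s - t\<bar>)" by (intro sum_mono)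
  thus ?thesis by simp
qed

lemma segment_average_close:
  assumes h: "bounded_Lipschitz J h" and L: "\<And>x y. \<bar>h x - h y\<bar> \<le> L * l1_dist J x y"
    and "L \<ge> 0" "\<delta> \<ge> 0" and e: "\<And>j. \<bar>e j\<bar> \<le> 1"
  shows "\<bar>segment_average \<delta> e h x - h x\<bar> \<le> L * real (Suc J) * \<delta>"
proof -
  interpret prob_space unit_uniform by (rule prob_space_unit_uniform)
  have "\<bar>expectation (\<lambda>u. h (line x e (\<delta> * u))) - expectation (\<lambda>u. h x)\<bar> \<le> L * real (Suc J) * \<delta>"
  proof (rule abs_expectation_diff_le)
    show "integrable unit_uniform (\<lambda>u. h (line x e (\<delta> * u)))"
      by (rule bounded_Lipschitz_integrable[OF h]) (auto intro!: measurable_unit_uniform)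
    fix u assume "u \<in> space unit_uniform"
    hence u: "0 \<le> u" "u \<le> 1" by (auto simp: unit_uniform_def space_restrict_space)
    have "\<bar>h (line x e (\<delta> * u)) - h (line x e 0)\<bar> \<le> L * (real (Suc J) * \<bar>\<delta> * u - 0\<bar>)"
      by (rule order_trans[OF L]) (intro mult_left_mono l1_dist_line_le e \<open>L \<ge> 0\<close>)
    also have "\<dots> \<le> L * (real (Suc J) * \<delta>)"
      using u \<open>\<delta> \<ge> 0\<close> \<open>L \<ge> 0\<close> by (intro mult_left_mono) (auto simp: mult_left_le)
    finally show "\<bar>h (line x e (\<delta> * u)) - h x\<bar> \<le> L * real (Suc J) * \<delta>" by (simp add: mult.assoc)
  qed simp
  thus ?thesis by (simp add: segment_average_def random_shift_def prob_space)
qed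

lemma has_derivative_segment_average:
  assumes h: "bounded_Lipschitz J h" and \<delta>: "\<delta> > 0"
  shows "((\<lambda>s. segment_average \<delta> e h (line x e s)) has_real_derivative diff_quot \<delta> e h (line x e s)) (at s)"
proof -
  have "continuous_on UNIV (line x e)"
    by (rule continuous_on_coordinatewise_then_product) (auto intro!: continuous_intros)
  hence "continuous_on UNIV (\<lambda>s. h (line x e s))"
    by (rule continuous_on_compose2[OF bounded_Lipschitz_continuous[OF h]]) auto
  from has_derivative_unit_uniform_average[OF this \<delta>, of s] show ?thesis
    by (simp add: segment_average_def random_shift_def diff_quot_def algebra_simps divide_inverse)
qed

text \<open>Averaging twice over a segment makes a Lipschitz function twice differentiable along that segment, and the
  second derivative is a difference quotient of h, hence again Lipschitz.\<close>

lemma smooth_along_segment_average_twice: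
  assumes h: "bounded_Lipschitz J h" and \<delta>: "\<delta> > 0" and e: "\<And>j. \<bar>e j\<bar> \<le> 1"
  shows "\<exists>C. smooth_along J C e (segment_average \<delta> e (segment_average \<delta> e h))
    (diff_quot \<delta> e (segment_average \<delta> e h)) (diff_quot \<delta> e (diff_quot \<delta> e h))"
proof -
  let ?h = "segment_average \<delta> e (segment_average \<delta> e h)"
  let ?h1 = "diff_quot \<delta> e (segment_average \<delta> e h)" and ?h2 = "diff_quot \<delta> e (diff_quot \<delta> e h)"
  have bL: "bounded_Lipschitz J ?h" "bounded_Lipschitz J ?h1" "bounded_Lipschitz J ?h2"
    by (intro bounded_Lipschitz_segment_average bounded_Lipschitz_diff_quot h)+
  obtain B where B: "B \<ge> 0" "\<And>x. \<bar>?h2 x\<bar> \<le> B"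
    using bounded_Lipschitz_bounded[OF bL(3)] by blast
  obtain L where L: "L \<ge> 0" "\<And>x y. \<bar>?h2 x - ?h2 y\<bar> \<le> L * l1_dist J x y"
    using bounded_Lipschitz_Lipschitz[OF bL(3)] by blast
  have Taylor: "\<bar>?h (line x e s) - ?h x - s * ?h1 x - s\<^sup>2 / 2 * ?h2 x\<bar> \<le> (L * real (Suc J)) * \<bar>s\<bar> ^ 3" for x s
  proof -
    have "((\<lambda>s. segment_average \<delta> e h (line (line x e s) e \<delta>)) has_real_derivative
        diff_quot \<delta> e h (line (line x e s) e \<delta>)) (at s)" for s
      using has_derivative_segment_average[OF h \<delta>, of e "line x e \<delta>" s] by (simp add: algebra_simps)
    hence second: "((\<lambda>s. ?h1 (line x e s)) has_real_derivative ?h2 (line x e s)) (at s)" for s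
      unfolding diff_quot_def[of \<delta> e "segment_average \<delta> e h"] diff_quot_def[of \<delta> e "diff_quot \<delta> e h"]
      by (intro DERIV_cmult DERIV_diff has_derivative_segment_average[OF h \<delta>])
    have "\<bar>?h2 (line x e s) - ?h2 (line x e t)\<bar> \<le> L * (real (Suc J) * \<bar>s - t\<bar>)" for s t
      by (rule order_trans[OF L(2)]) (intro mult_left_mono l1_dist_line_le e L(1))
    hence "\<bar>?h (line x e s) - ?h (line x e 0) - s * ?h1 (line x e 0) - s\<^sup>2 / 2 * ?h2 (line x e 0)\<bar>
        \<le> (L * real (Suc J)) * \<bar>s\<bar> ^ 3"
      by (intro Taylor2_Lipschitz[where G="\<lambda>s. ?h (line x e s)" and ?G1.0="\<lambda>s. ?h1 (line x e s)"] second
          has_derivative_segment_average[OF bounded_Lipschitz_segment_average[OF h] \<delta>])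
        (simp_all add: mult.assoc)
    thus ?thesis by simp
  qed
  define C where "C = B + L * real (Suc J)"
  have C: "B \<le> C" "L * real (Suc J) \<le> C" using B(1) L(1) unfolding C_def by auto
  have "\<bar>?h2 x\<bar> \<le> C" for x using B(2)[of x] C(1) by linarith
  moreover have "\<bar>?h (line x e s) - ?h x - s * ?h1 x - s\<^sup>2 / 2 * ?h2 x\<bar> \<le> C * \<bar>s\<bar> ^ 3" for x s
    by (rule order_trans[OF Taylor mult_right_mono[OF C(2)]]) simp
  ultimately show ?thesis unfolding smooth_along_def using bL by blast
qed

lemma segment_average_twice_close:
  assumes h: "bounded_Lipschitz J h" and e: "\<And>j. \<bar>e j\<bar> \<le> 1" and "\<epsilon> > 0"
  shows "\<exists>\<delta>>0. \<forall>x. \<bar>segment_average \<delta> e (segment_average \<delta> e h) x - h x\<bar> \<le> \<epsilon>"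
proof -
  obtain L where L: "L \<ge> 0" "\<And>x y. \<bar>h x - h y\<bar> \<le> L * l1_dist J x y"
    using bounded_Lipschitz_Lipschitz[OF h] by blast
  define K where "K = L * real (Suc J)"
  have "K \<ge> 0" using L(1) unfolding K_def by simp
  define \<delta> where "\<delta> = \<epsilon> / (2 * (K + 1))"
  have \<delta>: "\<delta> > 0" "K * \<delta> \<le> \<epsilon> / 2"
    using \<open>\<epsilon> > 0\<close> \<open>K \<ge> 0\<close> unfolding \<delta>_def by (simp_all add: field_simps)
  have Lipschitz: "\<bar>segment_average \<delta> e h x - segment_average \<delta> e h y\<bar> \<le> L * l1_dist J x y" for x y
    unfolding segment_average_def
    by (rule prob_space.random_shift_Lipschitz[OF prob_space_unit_uniform h _ L(2)])
      (auto intro!: measurable_unit_uniform)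
  have "\<bar>segment_average \<delta> e (segment_average \<delta> e h) x - h x\<bar> \<le> \<epsilon>" for x
  proof -
    have "\<bar>segment_average \<delta> e (segment_average \<delta> e h) x - segment_average \<delta> e h x\<bar> \<le> K * \<delta>"
      unfolding K_def using \<delta>(1) by (intro segment_average_close bounded_Lipschitz_segment_average h Lipschitz L e) auto
    moreover have "\<bar>segment_average \<delta> e h x - h x\<bar> \<le> K * \<delta>"
      unfolding K_def using \<delta>(1) by (intro segment_average_close h L e) auto
    ultimately show ?thesis using \<delta>(2) by linarith
  qed
  thus ?thesis using \<delta>(1) by blast
qed

lemma smooth_approximation:
  assumes h: "bounded_Lipschitz J h" and e: "\<And>i j. \<bar>e i j\<bar> \<le> 1" and "\<epsilon> > 0"
  shows "\<exists>g C. bounded_Lipschitz J g \<and> (\<forall>x. \<bar>g x - h x\<bar> \<le> \<epsilon>) \<and> (\<forall>i<(m::nat). \<exists>h1 h2. smooth_along J C (e i) g h1 h2)"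
  using \<open>\<epsilon> > 0\<close>
proof (induction m arbitrary: \<epsilon>)
  case 0
  show ?case by (rule exI[of _ h]) (use h 0 in auto)
next
  case (Suc m)
  from Suc.IH[of "\<epsilon> / 2"] Suc.prems obtain g C where g: "bounded_Lipschitz J g" "\<And>x. \<bar>g x - h x\<bar> \<le> \<epsilon> / 2"
      "\<And>i. i < m \<Longrightarrow> \<exists>h1 h2. smooth_along J C (e i) g h1 h2"
    by auto
  obtain \<delta> where \<delta>: "\<delta> > 0" "\<And>x. \<bar>segment_average \<delta> (e m) (segment_average \<delta> (e m) g) x - g x\<bar> \<le> \<epsilon> / 2"
    using segment_average_twice_close[where e="e m", OF g(1) e, of "\<epsilon> / 2"] Suc.prems by auto
  define k where "k = segment_average \<delta> (e m) (segment_average \<delta> (e m) g)"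
  have "\<bar>k x - h x\<bar> \<le> \<epsilon>" for x using \<delta>(2)[of x] g(2)[of x] unfolding k_def by linarith
  moreover have "bounded_Lipschitz J k" unfolding k_def by (intro bounded_Lipschitz_segment_average g)
  moreover obtain C' h1' h2' where C': "smooth_along J C' (e m) k h1' h2'"
    using smooth_along_segment_average_twice[where e="e m", OF g(1) \<delta>(1) e] unfolding k_def by blast
  moreover have "\<exists>h1 h2. smooth_along J (max C C') (e i) k h1 h2" if "i < Suc m" for i
  proof (cases "i = m")
    case True
    thus ?thesis using smooth_along_mono[OF C'] by (meson max.cobounded2)
  next
    case False
    with that g(3)[of i] obtain h1 h2 where "smooth_along J C (e i) g h1 h2" by auto
    hence "smooth_along J C (e i) k (segment_average \<delta> (e m) (segment_average \<delta> (e m) h1))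
        (segment_average \<delta> (e m) (segment_average \<delta> (e m) h2))"
      unfolding k_def by (intro smooth_along_segment_average)
    thus ?thesis using smooth_along_mono by (meson max.cobounded1)
  qed
  ultimately show ?case by blast
qed

section \<open>Brownian motion\<close>

lemma
  assumes "brownian_motion P W"
  shows brownian_motion_prob_space: "prob_space P"
    and brownian_motion_measurable: "t \<ge> 0 \<Longrightarrow> W t \<in> borel_measurable P"
    and brownian_motion_zero: "\<omega> \<in> space P \<Longrightarrow> W 0 \<omega> = 0"
    and brownian_motion_continuous: "\<omega> \<in> space P \<Longrightarrow> continuous_on {0..} (\<lambda>t. W t \<omega>)"
  using assms unfolding brownian_motion_def by blast+

lemma brownian_motion_indep_increments:
  fixes ts :: "nat \<Rightarrow> real"
  assumes "brownian_motion P W" "0 \<le> ts 0" "mono ts"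
  shows "prob_space.indep_vars P (\<lambda>_. borel) (\<lambda>j \<omega>. W (ts (Suc j)) \<omega> - W (ts j) \<omega>) {..<k}"
  using assms monoD[OF assms(3)] unfolding brownian_motion_def by simp

lemma centred_normal_moments:
  assumes X: "distributed P lborel X (normal_density 0 \<sigma>)" and \<sigma>: "\<sigma> > 0"
  shows "integrable P X" "integrable P (\<lambda>\<omega>. (X \<omega>)\<^sup>2)" "integrable P (\<lambda>\<omega>. \<bar>X \<omega>\<bar> ^ 3)"
    "(\<integral>\<omega>. X \<omega> \<partial>P) = 0" "(\<integral>\<omega>. (X \<omega>)\<^sup>2 \<partial>P) = \<sigma>\<^sup>2" "(\<integral>\<omega>. \<bar>X \<omega>\<bar> ^ 3 \<partial>P) \<le> 2 * \<sigma> ^ 3"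
proof -
  have density_nonneg: "\<And>x. x \<in> space lborel \<Longrightarrow> 0 \<le> normal_density 0 \<sigma> x" by simp
  note distr_int = distributed_integrable[OF X _ density_nonneg]
    and distr_eq = distributed_integral[OF X _ density_nonneg]
  show "integrable P X"
    using distr_int[of "\<lambda>x. x"] integrable_normal_moment[OF \<sigma>, of 0 1] by simp
  show "integrable P (\<lambda>\<omega>. (X \<omega>)\<^sup>2)"
    using distr_int[of "\<lambda>x. x\<^sup>2"] integrable_normal_moment[OF \<sigma>, of 0 2] by simp
  show "integrable P (\<lambda>\<omega>. \<bar>X \<omega>\<bar> ^ 3)"
    using distr_int[of "\<lambda>x. \<bar>x\<bar>^3"] integrable_normal_moment_abs[OF \<sigma>, of 0 3] by simp
  show "(\<integral>\<omega>. X \<omega> \<partial>P) = 0"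
    using distr_eq[of "\<lambda>x. x"] integral_normal_moment_odd[OF \<sigma>, of 0 0] by simp
  show "(\<integral>\<omega>. (X \<omega>)\<^sup>2 \<partial>P) = \<sigma>\<^sup>2"
    using distr_eq[of "\<lambda>x. x\<^sup>2"] integral_normal_moment_even[OF \<sigma>, of 0 1] by simp
  have "(\<integral>\<omega>. \<bar>X \<omega>\<bar> ^ 3 \<partial>P) = 2 * \<sigma> ^ 3 * sqrt (2 / pi)"
    using distr_eq[of "\<lambda>x. \<bar>x\<bar>^3"] integral_normal_moment_abs_odd[OF \<sigma>, of 0 1] by simp
  also have "\<dots> \<le> 2 * \<sigma> ^ 3 * 1"
    using \<sigma> pi_gt3 by (intro mult_left_mono) auto
  finally show "(\<integral>\<omega>. \<bar>X \<omega>\<bar> ^ 3 \<partial>P) \<le> 2 * \<sigma> ^ 3" by simp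
qed

lemma brownian_increment_moments:
  assumes W: "brownian_motion P W" and st: "0 \<le> s" "s \<le> t"
  shows "integrable P (\<lambda>\<omega>. W t \<omega> - W s \<omega>)" "integrable P (\<lambda>\<omega>. (W t \<omega> - W s \<omega>)\<^sup>2)"
    "integrable P (\<lambda>\<omega>. \<bar>W t \<omega> - W s \<omega>\<bar> ^ 3)"
    "(\<integral>\<omega>. W t \<omega> - W s \<omega> \<partial>P) = 0" "(\<integral>\<omega>. (W t \<omega> - W s \<omega>)\<^sup>2 \<partial>P) = t - s"
    "(\<integral>\<omega>. \<bar>W t \<omega> - W s \<omega>\<bar> ^ 3 \<partial>P) \<le> 2 * sqrt (t - s) ^ 3"
proof -
  have "integrable P (\<lambda>\<omega>. W t \<omega> - W s \<omega>) \<and> integrable P (\<lambda>\<omega>. (W t \<omega> - W s \<omega>)\<^sup>2) \<and>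
    integrable P (\<lambda>\<omega>. \<bar>W t \<omega> - W s \<omega>\<bar> ^ 3) \<and>
    (\<integral>\<omega>. W t \<omega> - W s \<omega> \<partial>P) = 0 \<and> (\<integral>\<omega>. (W t \<omega> - W s \<omega>)\<^sup>2 \<partial>P) = t - s \<and>
    (\<integral>\<omega>. \<bar>W t \<omega> - W s \<omega>\<bar> ^ 3 \<partial>P) \<le> 2 * sqrt (t - s) ^ 3"
  proof (cases "s = t")
    case False
    hence "distributed P lborel (\<lambda>\<omega>. W t \<omega> - W s \<omega>) (normal_density 0 (sqrt (t - s)))" "sqrt (t - s) > 0"
      using W st unfolding brownian_motion_def by auto
    from centred_normal_moments[OF this] st show ?thesis by simp
  qed simp
  thus "integrable P (\<lambda>\<omega>. W t \<omega> - W s \<omega>)" "integrable P (\<lambda>\<omega>. (W t \<omega> - W s \<omega>)\<^sup>2)"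
    "integrable P (\<lambda>\<omega>. \<bar>W t \<omega> - W s \<omega>\<bar> ^ 3)"
    "(\<integral>\<omega>. W t \<omega> - W s \<omega> \<partial>P) = 0" "(\<integral>\<omega>. (W t \<omega> - W s \<omega>)\<^sup>2 \<partial>P) = t - s"
    "(\<integral>\<omega>. \<bar>W t \<omega> - W s \<omega>\<bar> ^ 3 \<partial>P) \<le> 2 * sqrt (t - s) ^ 3"
    by blast+
qed

lemma brownian_increment_indep_later:
  fixes \<tau> :: "nat \<Rightarrow> real" and g :: "(nat \<Rightarrow> real) \<Rightarrow> real"
  assumes W: "brownian_motion P W" and \<tau>: "mono \<tau>" "0 \<le> \<tau> 0" and \<kappa>: "\<And>j. \<kappa> j \<in> {Suc k..m}"
    and g: "g \<in> borel_measurable borel"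
  shows "prob_space.indep_var P borel (\<lambda>\<omega>. g (\<lambda>j. W (\<tau> (\<kappa> j)) \<omega> - W (\<tau> (Suc k)) \<omega>))
    borel (\<lambda>\<omega>. W (\<tau> (Suc k)) \<omega> - W (\<tau> k) \<omega>)"
proof -
  interpret prob_space P by (rule brownian_motion_prob_space[OF W])
  define D where "D = (\<lambda>i \<omega>. W (\<tau> (k + Suc i)) \<omega> - W (\<tau> (k + i)) \<omega>)"
  define later where "later = (\<lambda>(f :: nat \<Rightarrow> real) j. \<Sum>i = 1..<\<kappa> j - k. f i)"
  have sub: "{1..<\<kappa> j - k} \<subseteq> {1..m}" for j using \<kappa>[of j] by auto
  have increments: "(\<lambda>j. W (\<tau> (\<kappa> j)) \<omega> - W (\<tau> (Suc k)) \<omega>) = later (\<lambda>i\<in>{1..m}. D i \<omega>)" for \<omega>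
  proof
    fix j
    have "later (\<lambda>i\<in>{1..m}. D i \<omega>) j = (\<Sum>i = 1..<\<kappa> j - k. D i \<omega>)"
      unfolding later_def by (rule sum.cong) (use sub[of j] in \<open>simp_all add: subset_iff\<close>)
    also have "\<dots> = W (\<tau> (k + (\<kappa> j - k))) \<omega> - W (\<tau> (k + 1)) \<omega>"
      unfolding D_def using \<kappa>[of j] by (intro sum_Suc_diff') auto
    finally show "W (\<tau> (\<kappa> j)) \<omega> - W (\<tau> (Suc k)) \<omega> = later (\<lambda>i\<in>{1..m}. D i \<omega>) j"
      using \<kappa>[of j] by simp
  qed
  have "0 \<le> \<tau> k" using \<tau>(2) monoD[OF \<tau>(1), of 0 k] by simp
  moreover have "mono (\<lambda>i. \<tau> (k + i))" by (intro monoI monoD[OF \<tau>(1)]) simp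
  ultimately have "indep_vars (\<lambda>_. borel) D {..<Suc m}"
    using brownian_motion_indep_increments[OF W, of "\<lambda>i. \<tau> (k + i)" "Suc m"] unfolding D_def by simp
  hence "indep_var (PiM {1..m} (\<lambda>_. borel)) (\<lambda>\<omega>. \<lambda>i\<in>{1..m}. D i \<omega>) (PiM {0} (\<lambda>_. borel)) (\<lambda>\<omega>. \<lambda>i\<in>{0}. D i \<omega>)"
    by (rule indep_var_restrict) auto
  hence "indep_var borel ((\<lambda>f. g (later f)) \<circ> (\<lambda>\<omega>. \<lambda>i\<in>{1..m}. D i \<omega>)) borel ((\<lambda>f. f 0) \<circ> (\<lambda>\<omega>. \<lambda>i\<in>{0}. D i \<omega>))"
  proof (rule indep_var_compose)
    have "later \<in> borel_measurable (PiM {1..m} (\<lambda>_. borel))"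
      unfolding later_def using subsetD[OF sub]
      by (intro measurable_coordinatewise_then_product borel_measurable_sum measurable_component_singleton)
    thus "(\<lambda>f. g (later f)) \<in> borel_measurable (PiM {1..m} (\<lambda>_. borel))"
      using g by (rule measurable_compose)
  qed (rule measurable_component_singleton, simp)
  thus ?thesis unfolding increments by (simp add: comp_def D_def)
qed

lemma brownian_increment_orthogonal_later:
  fixes \<tau> :: "nat \<Rightarrow> real"
  assumes W: "brownian_motion P W" and \<tau>: "mono \<tau>" "0 \<le> \<tau> 0" and \<kappa>: "\<And>j. \<kappa> j \<in> {Suc k..m}"
    and g: "bounded_Lipschitz J g"
  defines "Y \<equiv> \<lambda>\<omega> j. W (\<tau> (\<kappa> j)) \<omega> - W (\<tau> (Suc k)) \<omega>"
    and "\<eta> \<equiv> \<lambda>\<omega>. W (\<tau> (Suc k)) \<omega> - W (\<tau> k) \<omega>"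
  shows "(\<integral>\<omega>. g (Y \<omega>) * \<eta> \<omega> \<partial>P) = 0"
    "(\<integral>\<omega>. g (Y \<omega>) * ((\<eta> \<omega>)\<^sup>2 - (\<tau> (Suc k) - \<tau> k)) \<partial>P) = 0"
proof -
  interpret prob_space P by (rule brownian_motion_prob_space[OF W])
  have \<tau>_nonneg: "0 \<le> \<tau> i" for i using \<tau>(2) monoD[OF \<tau>(1), of 0 i] by simp
  note moments = brownian_increment_moments[OF W \<tau>_nonneg monoD[OF \<tau>(1)], of k "Suc k", folded \<eta>_def]
  have g_borel: "g \<in> borel_measurable borel"
    by (rule borel_measurable_continuous_onI[OF bounded_Lipschitz_continuous[OF g]])
  have indep: "indep_var borel (\<lambda>\<omega>. g (Y \<omega>)) borel \<eta>"
    unfolding Y_def \<eta>_def by (rule brownian_increment_indep_later[OF W \<tau> \<kappa> g_borel])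
  have gY: "integrable P (\<lambda>\<omega>. g (Y \<omega>))"
    unfolding Y_def
    by (intro bounded_Lipschitz_integrable[OF g] borel_measurable_diff brownian_motion_measurable[OF W] \<tau>_nonneg)
  have factorise: "expectation (\<lambda>\<omega>. g (Y \<omega>) * f (\<eta> \<omega>)) = expectation (\<lambda>\<omega>. g (Y \<omega>)) * expectation (\<lambda>\<omega>. f (\<eta> \<omega>))"
    if f: "f \<in> borel_measurable borel" "integrable P (\<lambda>\<omega>. f (\<eta> \<omega>))" for f :: "real \<Rightarrow> real"
    using indep_var_compose[OF indep measurable_ident f(1)]
    by (intro indep_var_lebesgue_integral gY f(2)) (simp add: comp_def)
  show "(\<integral>\<omega>. g (Y \<omega>) * \<eta> \<omega> \<partial>P) = 0"
    using factorise[of "\<lambda>x. x"] moments by (simp add: \<eta>_def)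
  have int: "integrable P (\<lambda>\<omega>. (\<eta> \<omega>)\<^sup>2)" using moments(2) unfolding \<eta>_def by simp
  have "expectation (\<lambda>\<omega>. (\<eta> \<omega>)\<^sup>2 - (\<tau> (Suc k) - \<tau> k)) = 0"
    using int moments(5) by (simp add: prob_space \<eta>_def)
  thus "(\<integral>\<omega>. g (Y \<omega>) * ((\<eta> \<omega>)\<^sup>2 - (\<tau> (Suc k) - \<tau> k)) \<partial>P) = 0"
    using factorise[of "\<lambda>x. x\<^sup>2 - (\<tau> (Suc k) - \<tau> k)"] int by simp
qed

section \<open>Lindeberg replacement by a Brownian motion\<close>

lemma (in prob_space) expectation_Taylor2:
  assumes h: "smooth_along J C e h h1 h2"
    and X: "\<And>j. (\<lambda>\<omega>. X \<omega> j) \<in> borel_measurable M"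
    and \<xi>: "integrable M \<xi>" "integrable M (\<lambda>\<omega>. (\<xi> \<omega>)\<^sup>2)" "integrable M (\<lambda>\<omega>. \<bar>\<xi> \<omega>\<bar> ^ 3)"
    and first: "expectation (\<lambda>\<omega>. h1 (X \<omega>) * \<xi> \<omega>) = 0"
    and second: "\<bar>expectation (\<lambda>\<omega>. h2 (X \<omega>) * ((\<xi> \<omega>)\<^sup>2 - v))\<bar> \<le> d"
  shows "\<bar>expectation (\<lambda>\<omega>. h (line (X \<omega>) e (\<xi> \<omega>))) - expectation (\<lambda>\<omega>. h (X \<omega>)) - v / 2 * expectation (\<lambda>\<omega>. h2 (X \<omega>))\<bar>
    \<le> C * expectation (\<lambda>\<omega>. \<bar>\<xi> \<omega>\<bar> ^ 3) + d"
proof -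
  note bL = smooth_alongD(1-3)[OF h]
  have [measurable]: "\<xi> \<in> borel_measurable M" using \<xi>(1) by simp
  have int_shifted: "integrable M (\<lambda>\<omega>. h (line (X \<omega>) e (\<xi> \<omega>)))"
    by (rule bounded_Lipschitz_integrable[OF bL(1)]) (use X in measurable)
  note int = bounded_Lipschitz_integrable[where X=X, OF bL(1) X] bounded_Lipschitz_integrable[where X=X, OF bL(3) X]
    bounded_Lipschitz_mult_integrable[where X=X, OF bL(2) X \<xi>(1)] bounded_Lipschitz_mult_integrable[where X=X, OF bL(3) X \<xi>(2)]
  define R where "R = (\<lambda>\<omega>. h (line (X \<omega>) e (\<xi> \<omega>)) - h (X \<omega>) - h1 (X \<omega>) * \<xi> \<omega> - h2 (X \<omega>) * (\<xi> \<omega>)\<^sup>2 / 2)"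
  have int_R: "integrable M R" unfolding R_def using int_shifted int by simp
  have "\<bar>expectation R\<bar> \<le> expectation (\<lambda>\<omega>. \<bar>R \<omega>\<bar>)" by (rule integral_abs_bound)
  also have "\<dots> \<le> expectation (\<lambda>\<omega>. C * \<bar>\<xi> \<omega>\<bar> ^ 3)"
    by (rule integral_mono) (use int_R \<xi>(3) smooth_alongD(5)[OF h, of "X _" "\<xi> _"] in \<open>auto simp: R_def algebra_simps\<close>)
  finally have remainder: "\<bar>expectation R\<bar> \<le> C * expectation (\<lambda>\<omega>. \<bar>\<xi> \<omega>\<bar> ^ 3)" by simp
  have "expectation R = expectation (\<lambda>\<omega>. h (line (X \<omega>) e (\<xi> \<omega>))) - expectation (\<lambda>\<omega>. h (X \<omega>))
     - expectation (\<lambda>\<omega>. h2 (X \<omega>) * (\<xi> \<omega>)\<^sup>2) / 2"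
    unfolding R_def using int_shifted int first by simp
  moreover have "expectation (\<lambda>\<omega>. h2 (X \<omega>) * ((\<xi> \<omega>)\<^sup>2 - v))
      = expectation (\<lambda>\<omega>. h2 (X \<omega>) * (\<xi> \<omega>)\<^sup>2) - v * expectation (\<lambda>\<omega>. h2 (X \<omega>))"
    using int by (simp add: algebra_simps)
  moreover have "d \<ge> 0" using second by linarith
  ultimately show ?thesis using second remainder by (simp add: field_simps)
qed

locale lindeberg_replacement = prob_space M for M :: "'a measure" +
  fixes P :: "'b measure" and W :: "real \<Rightarrow> 'b \<Rightarrow> real" and \<xi> :: "nat \<Rightarrow> 'a \<Rightarrow> real"
    and b v d :: "nat \<Rightarrow> real" and \<kappa> :: "nat \<Rightarrow> nat" and J :: nat
  assumes W: "brownian_motion P W"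
    and \<xi>_measurable [measurable]: "\<And>k. \<xi> k \<in> borel_measurable M"
    and \<xi>_bounded: "\<And>k \<omega>. \<omega> \<in> space M \<Longrightarrow> \<bar>\<xi> k \<omega>\<bar> \<le> b k"
    and v_nonneg: "\<And>k. v k \<ge> 0" and \<kappa>_le: "\<And>j. \<kappa> j \<le> \<kappa> J"
    and centred: "\<And>k g. bounded_Lipschitz J g \<Longrightarrow>
      expectation (\<lambda>\<omega>. g (\<lambda>j. \<Sum>l<min k (\<kappa> j). \<xi> l \<omega>) * \<xi> k \<omega>) = 0"
    and variance: "\<And>k g B. bounded_Lipschitz J g \<Longrightarrow> (\<And>x. \<bar>g x\<bar> \<le> B) \<Longrightarrow>
      \<bar>expectation (\<lambda>\<omega>. g (\<lambda>j. \<Sum>l<min k (\<kappa> j). \<xi> l \<omega>) * ((\<xi> k \<omega>)\<^sup>2 - v k))\<bar> \<le> B * d k"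
begin

definition stopped_sum :: "nat \<Rightarrow> 'a \<Rightarrow> nat \<Rightarrow> real" where
  "stopped_sum k \<omega> j = (\<Sum>l<min k (\<kappa> j). \<xi> l \<omega>)"

definition clock :: "nat \<Rightarrow> real" where "clock k = (\<Sum>l<k. v l)"

definition brownian_tail :: "nat \<Rightarrow> 'b \<Rightarrow> nat \<Rightarrow> real" where
  "brownian_tail k \<omega> j = W (clock (max (\<kappa> j) k)) \<omega> - W (clock k) \<omega>"

definition active :: "nat \<Rightarrow> nat \<Rightarrow> real" where "active k j = of_bool (k < \<kappa> j)"

text \<open>The first k steps come from the martingale, the later ones from the Brownian motion. Using iterated
  integrals keeps the two sources independent without constructing a product space.\<close>

definition hybrid :: "((nat \<Rightarrow> real) \<Rightarrow> real) \<Rightarrow> nat \<Rightarrow> real" where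
  "hybrid h k = expectation (\<lambda>\<omega>. random_shift P (brownian_tail k) h (stopped_sum k \<omega>))"

sublocale P: prob_space P by (rule brownian_motion_prob_space[OF W])

lemma clock_mono: "mono clock"
  unfolding clock_def by (intro monoI sum_mono2) (auto intro: v_nonneg)

lemma clock_nonneg: "clock k \<ge> 0"
  unfolding clock_def by (intro sum_nonneg v_nonneg)

lemma clock_Suc: "clock (Suc k) - clock k = v k"
  unfolding clock_def by simp

lemma W_clock_measurable [measurable]: "W (clock k) \<in> borel_measurable P"
  by (rule brownian_motion_measurable[OF W clock_nonneg])

lemma brownian_tail_measurable [measurable]: "(\<lambda>\<omega>. brownian_tail k \<omega> j) \<in> borel_measurable P"
  unfolding brownian_tail_def by measurable

lemma stopped_sum_measurable: "(\<lambda>\<omega>. stopped_sum k \<omega> j) \<in> borel_measurable M"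
  unfolding stopped_sum_def by measurable

lemma stopped_sum_Suc: "stopped_sum (Suc k) \<omega> = line (stopped_sum k \<omega>) (active k) (\<xi> k \<omega>)"
proof
  fix j show "stopped_sum (Suc k) \<omega> j = line (stopped_sum k \<omega>) (active k) (\<xi> k \<omega>) j"
    unfolding stopped_sum_def active_def by (cases "k < \<kappa> j") (auto simp: min_def)
qed

lemma brownian_tail_Suc:
  "brownian_tail k \<omega> = line (brownian_tail (Suc k) \<omega>) (active k) (W (clock (Suc k)) \<omega> - W (clock k) \<omega>)"
proof
  fix j
  show "brownian_tail k \<omega> j = line (brownian_tail (Suc k) \<omega>) (active k) (W (clock (Suc k)) \<omega> - W (clock k) \<omega>) j"
    unfolding brownian_tail_def active_def
    by (cases "k < \<kappa> j") (auto simp: max_def not_less le_Suc_eq)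
qed

lemma brownian_exchange:
  assumes h: "smooth_along J C (active k) h h1 h2"
  shows "\<bar>random_shift P (brownian_tail k) h x - random_shift P (brownian_tail (Suc k)) h x
    - v k / 2 * random_shift P (brownian_tail (Suc k)) h2 x\<bar> \<le> C * (2 * sqrt (v k) ^ 3)"
proof -
  define \<eta> where "\<eta> = (\<lambda>\<omega>. W (clock (Suc k)) \<omega> - W (clock k) \<omega>)"
  define X where "X = (\<lambda>\<omega> j. brownian_tail (Suc k) \<omega> j + x j)"
  note moments = brownian_increment_moments[OF W clock_nonneg monoD[OF clock_mono], of k "Suc k", folded \<eta>_def]
  have \<kappa>: "max (\<kappa> j) (Suc k) \<in> {Suc k..max (\<kappa> J) (Suc k)}" for j using \<kappa>_le[of j] by auto
  note orthogonal = brownian_increment_orthogonal_later[OF W clock_mono clock_nonneg \<kappa>,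
      folded brownian_tail_def \<eta>_def]
  have "\<bar>P.expectation (\<lambda>\<omega>. h (line (X \<omega>) (active k) (\<eta> \<omega>))) - P.expectation (\<lambda>\<omega>. h (X \<omega>))
      - v k / 2 * P.expectation (\<lambda>\<omega>. h2 (X \<omega>))\<bar> \<le> C * P.expectation (\<lambda>\<omega>. \<bar>\<eta> \<omega>\<bar> ^ 3) + 0"
  proof (rule P.expectation_Taylor2[OF h])
    show "P.expectation (\<lambda>\<omega>. h1 (X \<omega>) * \<eta> \<omega>) = 0"
      using orthogonal(1)[OF bounded_Lipschitz_translate[OF smooth_alongD(2)[OF h], of x]]
      unfolding X_def \<eta>_def brownian_tail_def by simp
    show "\<bar>P.expectation (\<lambda>\<omega>. h2 (X \<omega>) * ((\<eta> \<omega>)\<^sup>2 - v k))\<bar> \<le> 0"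
      using orthogonal(2)[OF bounded_Lipschitz_translate[OF smooth_alongD(3)[OF h], of x]]
      unfolding X_def \<eta>_def brownian_tail_def clock_Suc by simp
    show "(\<lambda>\<omega>. X \<omega> j) \<in> borel_measurable P" for j unfolding X_def by measurable
  qed (use moments in \<open>auto simp: \<eta>_def\<close>)
  also have "\<dots> \<le> C * (2 * sqrt (v k) ^ 3)"
    using moments(6) smooth_alongD(6)[OF h] by (simp add: clock_Suc mult_left_mono \<eta>_def)
  finally show ?thesis
    unfolding random_shift_def brownian_tail_Suc[of k]
    by (simp add: X_def \<eta>_def add.assoc add.commute add.left_commute)
qed

lemma martingale_exchange:
  assumes H: "smooth_along J C (active k) H H1 H2"
  shows "\<bar>expectation (\<lambda>\<omega>. H (stopped_sum (Suc k) \<omega>)) - expectation (\<lambda>\<omega>. H (stopped_sum k \<omega>))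
    - v k / 2 * expectation (\<lambda>\<omega>. H2 (stopped_sum k \<omega>))\<bar> \<le> C * b k ^ 3 + C * d k"
proof -
  have bounded_int: "integrable M (\<lambda>\<omega>. f (\<xi> k \<omega>))"
    if "f \<in> borel_measurable borel" "\<And>x. \<bar>x\<bar> \<le> b k \<Longrightarrow> \<bar>f x\<bar> \<le> B" for f :: "real \<Rightarrow> real" and B
  proof (rule integrable_const_bound[where B=B])
    show "AE \<omega> in M. norm (f (\<xi> k \<omega>)) \<le> B" using that(2) \<xi>_bounded by (intro AE_I2) auto
    show "(\<lambda>\<omega>. f (\<xi> k \<omega>)) \<in> borel_measurable M" using that(1) by measurable
  qed
  have first_moment: "integrable M (\<xi> k)" by (rule bounded_int[of "\<lambda>x. x" "b k"]) auto
  have second_moment: "integrable M (\<lambda>\<omega>. (\<xi> k \<omega>)\<^sup>2)"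
    by (rule bounded_int[of "\<lambda>x. x\<^sup>2" "(b k)\<^sup>2"]) (auto intro: abs_le_square_iff[THEN iffD1])
  have third_moment: "integrable M (\<lambda>\<omega>. \<bar>\<xi> k \<omega>\<bar> ^ 3)"
    by (rule bounded_int[of "\<lambda>x. \<bar>x\<bar>^3" "b k ^ 3"]) (auto intro: power_mono)
  have "expectation (\<lambda>\<omega>. \<bar>\<xi> k \<omega>\<bar> ^ 3) \<le> b k ^ 3"
    by (rule integral_le_const[OF third_moment]) (use \<xi>_bounded in \<open>auto intro!: AE_I2 power_mono\<close>)
  hence "C * expectation (\<lambda>\<omega>. \<bar>\<xi> k \<omega>\<bar> ^ 3) \<le> C * b k ^ 3"
    using smooth_alongD(6)[OF H] by (rule mult_left_mono)
  moreover have "\<bar>expectation (\<lambda>\<omega>. H (line (stopped_sum k \<omega>) (active k) (\<xi> k \<omega>))) - expectation (\<lambda>\<omega>. H (stopped_sum k \<omega>))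
      - v k / 2 * expectation (\<lambda>\<omega>. H2 (stopped_sum k \<omega>))\<bar> \<le> C * expectation (\<lambda>\<omega>. \<bar>\<xi> k \<omega>\<bar> ^ 3) + C * d k"
  proof (rule expectation_Taylor2[OF H stopped_sum_measurable first_moment second_moment third_moment])
    show "expectation (\<lambda>\<omega>. H1 (stopped_sum k \<omega>) * \<xi> k \<omega>) = 0"
      unfolding stopped_sum_def by (rule centred[OF smooth_alongD(2)[OF H]])
    show "\<bar>expectation (\<lambda>\<omega>. H2 (stopped_sum k \<omega>) * ((\<xi> k \<omega>)\<^sup>2 - v k))\<bar> \<le> C * d k"
      unfolding stopped_sum_def by (rule variance[OF smooth_alongD(3,4)[OF H]])
  qed
  ultimately show ?thesis unfolding stopped_sum_Suc by linarith
qed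

lemma hybrid_Suc:
  assumes h: "smooth_along J C (active k) h h1 h2"
  shows "\<bar>hybrid h (Suc k) - hybrid h k\<bar> \<le> C * (d k + b k ^ 3 + 2 * sqrt (v k) ^ 3)"
proof -
  define H where "H = random_shift P (brownian_tail (Suc k))"
  define Q where "Q = random_shift P (brownian_tail k) h"
  note bL = smooth_alongD(1-3)[OF h]
  have H: "smooth_along J C (active k) (H h) (H h1) (H h2)"
    unfolding H_def by (rule P.smooth_along_random_shift[OF h brownian_tail_measurable])
  have int: "integrable M (\<lambda>\<omega>. g (stopped_sum k \<omega>))" if "bounded_Lipschitz J g" for g
    by (rule bounded_Lipschitz_integrable[OF that stopped_sum_measurable])
  have Q: "bounded_Lipschitz J Q"
    unfolding Q_def by (rule P.bounded_Lipschitz_random_shift[OF bL(1) brownian_tail_measurable])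
  have "\<bar>expectation (\<lambda>\<omega>. Q (stopped_sum k \<omega>) - H h (stopped_sum k \<omega>) - v k / 2 * H h2 (stopped_sum k \<omega>))\<bar>
      \<le> C * (2 * sqrt (v k) ^ 3)"
    unfolding Q_def H_def by (rule abs_expectation_le) (rule brownian_exchange[OF h])
  hence "\<bar>hybrid h k - expectation (\<lambda>\<omega>. H h (stopped_sum k \<omega>)) - v k / 2 * expectation (\<lambda>\<omega>. H h2 (stopped_sum k \<omega>))\<bar>
      \<le> C * (2 * sqrt (v k) ^ 3)"
    unfolding hybrid_def Q_def[symmetric] using int[OF Q] int[OF smooth_alongD(1)[OF H]] int[OF smooth_alongD(3)[OF H]] by simp
  with martingale_exchange[OF H] show ?thesis
    unfolding hybrid_def[of h "Suc k"] H_def[symmetric] by (simp add: algebra_simps)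
qed

theorem lindeberg_bound:
  assumes h: "bounded_Lipschitz J h" "\<And>k. k < \<kappa> J \<Longrightarrow> \<exists>h1 h2. smooth_along J C (active k) h h1 h2"
  shows "\<bar>expectation (\<lambda>\<omega>. h (\<lambda>j. \<Sum>l<\<kappa> j. \<xi> l \<omega>)) - (\<integral>\<omega>. h (\<lambda>j. W (\<Sum>l<\<kappa> j. v l) \<omega>) \<partial>P)\<bar>
    \<le> C * (\<Sum>k<\<kappa> J. d k + b k ^ 3 + 2 * sqrt (v k) ^ 3)"
proof -
  have telescope: "\<bar>hybrid h n - hybrid h 0\<bar> \<le> C * (\<Sum>k<n. d k + b k ^ 3 + 2 * sqrt (v k) ^ 3)" if "n \<le> \<kappa> J" for n
    using that
  proof (induction n)
    case (Suc n)
    from h(2)[of n] Suc.prems obtain h1 h2 where "smooth_along J C (active n) h h1 h2" by auto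
    from hybrid_Suc[OF this] Suc show ?case by (simp add: algebra_simps)
  qed simp
  have "hybrid h (\<kappa> J) = expectation (\<lambda>\<omega>. h (\<lambda>j. \<Sum>l<\<kappa> j. \<xi> l \<omega>))"
    unfolding hybrid_def random_shift_def stopped_sum_def brownian_tail_def using \<kappa>_le
    by (simp add: max_absorb2 min_absorb2 P.prob_space)
  moreover have "hybrid h 0 = (\<integral>\<omega>. h (\<lambda>j. W (\<Sum>l<\<kappa> j. v l) \<omega>) \<partial>P)"
    unfolding hybrid_def random_shift_def stopped_sum_def brownian_tail_def clock_def
    using brownian_motion_zero[OF W] by (simp add: prob_space cong: Bochner_Integration.integral_cong)
  ultimately show ?thesis using telescope[of "\<kappa> J"] by simp
qed

end

section \<open>Inf-convolutions of Skorohod continuous functionals\<close>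

text \<open>Taking the infimum over admissible \<delta>, instead of summing suprema over [0, m], avoids having to know that cadlag
  paths are locally bounded.\<close>

definition loc_unif_dist :: "(real \<Rightarrow> real) \<Rightarrow> (real \<Rightarrow> real) \<Rightarrow> real" where
  "loc_unif_dist x y = Inf {\<delta>. \<delta> > 0 \<and> (\<delta> < 1 \<longrightarrow> (\<forall>t\<in>{0..1/\<delta>}. \<bar>x t - y t\<bar> \<le> \<delta>))}"

lemma bdd_below_pos: "bdd_below {\<delta>::real. \<delta> > 0 \<and> P \<delta>}"
  by (rule bdd_belowI[of _ 0]) auto

lemma loc_unif_dist_le:
  assumes "\<delta> > 0" "\<And>t. 0 \<le> t \<Longrightarrow> t \<le> 1/\<delta> \<Longrightarrow> \<bar>x t - y t\<bar> \<le> \<delta>"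
  shows "loc_unif_dist x y \<le> \<delta>"
  unfolding loc_unif_dist_def by (rule cInf_lower[OF _ bdd_below_pos]) (use assms in auto)

lemma loc_unif_dist_le_one: "loc_unif_dist x y \<le> 1"
  unfolding loc_unif_dist_def by (rule cInf_lower[OF _ bdd_below_pos]) auto

lemma loc_unif_dist_nonneg: "0 \<le> loc_unif_dist x y"
  unfolding loc_unif_dist_def by (rule cInf_greatest) (auto intro!: exI[of _ 1])

lemma loc_unif_dist_le_bound:
  assumes "\<And>t. 0 \<le> t \<Longrightarrow> \<bar>x t - y t\<bar> \<le> a"
  shows "loc_unif_dist x y \<le> a"
proof (rule field_le_epsilon)
  fix e :: real assume "e > 0"
  moreover have "a \<ge> 0" using assms[of 0] by simp
  ultimately show "loc_unif_dist x y \<le> a + e"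
    using assms by (intro loc_unif_dist_le) (auto intro: order_trans[OF assms])
qed

lemma loc_unif_dist_self: "loc_unif_dist x x = 0"
  using loc_unif_dist_le_bound[of x x 0] loc_unif_dist_nonneg[of x x] by simp

lemma loc_unif_dist_commute: "loc_unif_dist x y = loc_unif_dist y x"
  unfolding loc_unif_dist_def by (simp add: abs_minus_commute)

lemma loc_unif_dist_lessD:
  assumes "loc_unif_dist x y < \<delta>" "\<delta> \<le> 1" "0 \<le> t" "t \<le> 1/\<delta>"
  shows "\<bar>x t - y t\<bar> \<le> \<delta>"
proof -
  have "{\<delta>. \<delta> > 0 \<and> (\<delta> < 1 \<longrightarrow> (\<forall>t\<in>{0..1/\<delta>}. \<bar>x t - y t\<bar> \<le> \<delta>))} \<noteq> {}" by (auto intro!: exI[of _ 1])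
  from cInf_lessD[OF this assms(1)[unfolded loc_unif_dist_def]]
  obtain d where d: "d > 0" "d < \<delta>" "\<And>t. d < 1 \<Longrightarrow> t \<in> {0..1/d} \<Longrightarrow> \<bar>x t - y t\<bar> \<le> d" by blast
  have "1/\<delta> \<le> 1/d" using d by (simp add: frac_le)
  hence "\<bar>x t - y t\<bar> \<le> d" using d(2) assms by (intro d(3)) auto
  thus ?thesis using d by simp
qed

lemma loc_unif_dist_triangle: "loc_unif_dist x z \<le> loc_unif_dist x y + loc_unif_dist y z"
proof (rule field_le_epsilon)
  fix e :: real assume e: "e > 0"
  define a where "a = loc_unif_dist x y + e/2"
  define b where "b = loc_unif_dist y z + e/2"
  have ab: "a > 0" "b > 0" "loc_unif_dist x y < a" "loc_unif_dist y z < b"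
    using e loc_unif_dist_nonneg[of x y] loc_unif_dist_nonneg[of y z] unfolding a_def b_def by auto
  have "loc_unif_dist x z \<le> a + b"
  proof (cases "a + b < 1")
    case True
    show ?thesis
    proof (rule loc_unif_dist_le)
      fix t assume t: "0 \<le> t" "t \<le> 1/(a+b)"
      have "1/(a+b) \<le> 1/a" "1/(a+b) \<le> 1/b" using ab by (auto simp: frac_le)
      hence "t \<le> 1/a" "t \<le> 1/b" using t by linarith+
      hence "\<bar>x t - y t\<bar> \<le> a" "\<bar>y t - z t\<bar> \<le> b"
        using t True ab by (auto intro: loc_unif_dist_lessD[of x y a t] loc_unif_dist_lessD[of y z b t])
      thus "\<bar>x t - z t\<bar> \<le> a + b" by linarith
    qed (use ab in simp)
  next
    case False thus ?thesis using loc_unif_dist_le_one[of x z] by linarith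
  qed
  thus "loc_unif_dist x z \<le> loc_unif_dist x y + loc_unif_dist y z + e" unfolding a_def b_def by simp
qed

lemma sk_converges_locally_uniformly:
  assumes "\<And>m. uniform_limit {0..m} xs x sequentially"
  shows "sk_converges xs x"
  unfolding sk_converges_def
proof (intro exI[of _ "\<lambda>_ t. t"] conjI allI impI)
  show "time_change (\<lambda>t. t)" unfolding time_change_def by (auto simp: strict_mono_on_def)
  fix m e :: real assume "e > 0"
  from uniform_limitD[OF assms this, of m]
  show "\<forall>\<^sub>F n in sequentially. \<forall>t\<in>{0..m}. \<bar>xs n t - x t\<bar> \<le> e"
    by eventually_elim (auto simp: dist_real_def intro: less_imp_le)
qed simp_all

lemma sk_converges_loc_unif_dist:
  assumes "(\<lambda>n. loc_unif_dist (xs n) x) \<longlonglongrightarrow> 0"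
  shows "sk_converges xs x"
proof (intro sk_converges_locally_uniformly uniform_limitI)
  fix m e :: real assume e: "e > 0"
  define d where "d = min (1 / max 1 m) (e / 2)"
  have d: "d > 0" "d \<le> 1" "d < e" "m \<le> 1/d"
  proof -
    show "d > 0" "d \<le> 1" "d < e" using e unfolding d_def by (auto simp: min_less_iff_disj min_le_iff_disj)
    have "1 / (1 / max 1 m) \<le> 1/d" using e unfolding d_def by (intro divide_left_mono) auto
    thus "m \<le> 1/d" by simp
  qed
  have "\<forall>\<^sub>F n in sequentially. loc_unif_dist (xs n) x < d" using assms d(1) by (rule order_tendstoD)
  thus "\<forall>\<^sub>F n in sequentially. \<forall>t\<in>{0..m}. dist (xs n t) (x t) < e"
  proof eventually_elim
    case (elim n)
    show ?case
    proof
      fix t assume "t \<in> {0..m}"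
      hence "\<bar>xs n t - x t\<bar> \<le> d" using d(4) by (intro loc_unif_dist_lessD[OF elim d(2)]) auto
      thus "dist (xs n t) (x t) < e" using d(3) by (simp add: dist_real_def)
    qed
  qed
qed

lemma cadlag_const: "cadlag (\<lambda>_. a)"
  unfolding cadlag_def by auto

lemma continuous_cadlag:
  assumes "continuous_on {0..} y" shows "cadlag y"
  unfolding cadlag_def
proof (intro conjI allI impI exI)
  have lim: "(y \<longlongrightarrow> y t) (at t within {0..})" if "t \<ge> 0" for t
    using assms that by (auto simp: continuous_on_def)
  show "(y \<longlongrightarrow> y t) (at_right t)" if "t \<ge> 0" for t
    using that by (intro tendsto_within_subset[OF lim]) auto
  show "(y \<longlongrightarrow> y t) (at_left t)" if t: "t > 0" for t
  proof -
    have "(y \<longlongrightarrow> y t) (at t within {0<..})" using t by (intro tendsto_within_subset[OF lim]) auto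
    hence "(y \<longlongrightarrow> y t) (at t)" using t by (simp add: at_within_open[of t "{0<..}"])
    thus ?thesis by (rule tendsto_within_subset) auto
  qed
qed

lemma sk_test_bounded:
  assumes "sk_test f" shows "\<exists>B. \<forall>x. cadlag x \<longrightarrow> \<bar>f x\<bar> \<le> B"
  using assms unfolding sk_test_def by blast

lemma sk_test_tendsto:
  assumes "sk_test f" "cadlag x" "\<And>n. cadlag (xs n)" "sk_converges xs x"
  shows "(\<lambda>n. f (xs n)) \<longlonglongrightarrow> f x"
proof -
  have "\<forall>xs x. cadlag x \<and> (\<forall>n. cadlag (xs n)) \<and> sk_converges xs x \<longrightarrow> (\<lambda>n. f (xs n)) \<longlonglongrightarrow> f x"
    using assms(1) unfolding sk_test_def by (elim conjE)
  with assms(2-4) show ?thesis by simp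
qed

lemma sk_test_uminus: "sk_test f \<Longrightarrow> sk_test (\<lambda>x. - f x)"
  unfolding sk_test_def by (auto intro: tendsto_minus)

text \<open>Lipschitz minorants increasing to the bounded continuous functional f. They are defined on all functions, so that
  discretised paths need not be checked to be cadlag.\<close>

definition infconv :: "((real \<Rightarrow> real) \<Rightarrow> real) \<Rightarrow> real \<Rightarrow> (real \<Rightarrow> real) \<Rightarrow> real" where
  "infconv f L x = (INF y\<in>{y. cadlag y}. f y + L * loc_unif_dist x y)"

context
  fixes f :: "(real \<Rightarrow> real) \<Rightarrow> real" and B :: real
  assumes f_bounded: "\<forall>x. cadlag x \<longrightarrow> \<bar>f x\<bar> \<le> B"
begin

lemma infconv_bdd_below:
  assumes "L \<ge> 0" shows "bdd_below ((\<lambda>y. f y + L * loc_unif_dist x y) ` {y. cadlag y})"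
proof (rule bdd_belowI2)
  fix y assume "y \<in> {y. cadlag y}"
  thus "- B \<le> f y + L * loc_unif_dist x y"
    using f_bounded[rule_format, of y] mult_nonneg_nonneg[OF assms loc_unif_dist_nonneg[of x y]] by simp
qed

lemma infconv_lower: "L \<ge> 0 \<Longrightarrow> cadlag y \<Longrightarrow> infconv f L x \<le> f y + L * loc_unif_dist x y"
  unfolding infconv_def by (rule cINF_lower[OF infconv_bdd_below]) auto

lemma infconv_le: "L \<ge> 0 \<Longrightarrow> cadlag x \<Longrightarrow> infconv f L x \<le> f x"
  using infconv_lower[of L x x] by (simp add: loc_unif_dist_self)

lemma infconv_greatest: "(\<And>y. cadlag y \<Longrightarrow> a \<le> f y + L * loc_unif_dist x y) \<Longrightarrow> a \<le> infconv f L x"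
  unfolding infconv_def using cadlag_const by (intro cINF_greatest) auto

lemma infconv_ge:
  assumes "L \<ge> 0" shows "- B \<le> infconv f L x"
proof (rule infconv_greatest)
  fix y assume "cadlag y"
  thus "- B \<le> f y + L * loc_unif_dist x y"
    using f_bounded[rule_format, of y] mult_nonneg_nonneg[OF assms loc_unif_dist_nonneg[of x y]] by simp
qed

lemma infconv_le_bound:
  assumes "L \<ge> 0" shows "infconv f L x \<le> B + L"
proof -
  have "L * loc_unif_dist x (\<lambda>_. 0) \<le> L * 1" by (intro mult_left_mono loc_unif_dist_le_one assms)
  thus ?thesis using infconv_lower[OF assms cadlag_const[of 0], of x] f_bounded[rule_format, OF cadlag_const[of 0]] by linarith
qed

lemma infconv_bounded:
  assumes "L \<ge> 0" shows "\<bar>infconv f L x\<bar> \<le> B + L"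
  using infconv_ge[OF assms, of x] infconv_le_bound[OF assms, of x] assms by (simp add: abs_le_iff)

lemma infconv_le_add:
  assumes "L \<ge> 0" shows "infconv f L x \<le> infconv f L x' + L * loc_unif_dist x x'"
proof -
  have "infconv f L x - L * loc_unif_dist x x' \<le> infconv f L x'"
  proof (rule infconv_greatest)
    fix y assume "cadlag y"
    have "L * loc_unif_dist x y \<le> L * (loc_unif_dist x x' + loc_unif_dist x' y)"
      by (intro mult_left_mono loc_unif_dist_triangle assms)
    thus "infconv f L x - L * loc_unif_dist x x' \<le> f y + L * loc_unif_dist x' y"
      using infconv_lower[OF assms \<open>cadlag y\<close>, of x] by (simp add: algebra_simps)
  qed
  thus ?thesis by simp
qed

lemma infconv_Lipschitz: "L \<ge> 0 \<Longrightarrow> \<bar>infconv f L x - infconv f L x'\<bar> \<le> L * loc_unif_dist x x'"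
  using infconv_le_add[of L x x'] infconv_le_add[of L x' x] by (simp add: loc_unif_dist_commute abs_le_iff)

lemma infconv_near_minimiser:
  assumes "e > 0" shows "\<exists>y. cadlag y \<and> f y + L * loc_unif_dist x y < infconv f L x + e"
proof (rule ccontr)
  assume "\<not> ?thesis"
  hence "infconv f L x + e \<le> infconv f L x" by (intro infconv_greatest) (auto simp: not_less)
  with assms show False by simp
qed

lemma infconv_tendsto:
  assumes f: "sk_test f" and x: "cadlag x"
  shows "(\<lambda>n. infconv f (real n) x) \<longlonglongrightarrow> f x"
proof -
  have "\<exists>y. cadlag y \<and> f y + real n * loc_unif_dist x y < infconv f (real n) x + 1 / (real n + 1)" for n
    by (rule infconv_near_minimiser) simp
  then obtain ys where ys: "\<And>n. cadlag (ys n)"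
    "\<And>n. f (ys n) + real n * loc_unif_dist x (ys n) < infconv f (real n) x + 1 / (real n + 1)"
    by metis
  have "loc_unif_dist (ys n) x \<le> (2 * B + 1) / real n" if "n \<ge> 1" for n
  proof -
    have "1 / (real n + 1) \<le> 1" by simp
    hence "real n * loc_unif_dist x (ys n) \<le> 2 * B + 1"
      using ys(2)[of n] infconv_le[of "real n", OF _ x] f_bounded[rule_format, OF x] f_bounded[rule_format, OF ys(1)[of n]]
      by linarith
    thus ?thesis using that by (simp add: field_simps loc_unif_dist_commute)
  qed
  hence "(\<lambda>n. loc_unif_dist (ys n) x) \<longlonglongrightarrow> 0"
    by (intro tendsto_sandwich[OF _ _ tendsto_const lim_const_over_n[of "2 * B + 1"]])
      (auto simp: loc_unif_dist_nonneg intro: eventually_sequentiallyI[of 1])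
  hence "(\<lambda>n. f (ys n)) \<longlonglongrightarrow> f x"
    by (intro sk_test_tendsto[OF f x ys(1)] sk_converges_loc_unif_dist)
  moreover have "(\<lambda>n. 1 / (real n + 1)) \<longlonglongrightarrow> 0" by real_asymp
  ultimately have lower: "(\<lambda>n. f (ys n) - 1 / (real n + 1)) \<longlonglongrightarrow> f x - 0" by (rule tendsto_diff)
  have "f (ys n) - 1 / (real n + 1) \<le> infconv f (real n) x" for n
    using ys(2)[of n] mult_nonneg_nonneg[OF of_nat_0_le_iff loc_unif_dist_nonneg[of x "ys n"], of n] by linarith
  moreover have "infconv f (real n) x \<le> f x" for n by (rule infconv_le) (auto simp: x)
  ultimately show ?thesis
    using lower by (intro tendsto_sandwich[OF _ _ lower[simplified] tendsto_const] always_eventually allI)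
qed

end

section \<open>A criterion for weak convergence in the Skorohod space\<close>

definition steps :: "nat \<Rightarrow> nat \<Rightarrow> (nat \<Rightarrow> real) \<Rightarrow> real \<Rightarrow> real" where
  "steps K J z t = z (min (nat \<lfloor>real K * t\<rfloor>) J)"

definition discretise :: "nat \<Rightarrow> (real \<Rightarrow> real) \<Rightarrow> real \<Rightarrow> real" where
  "discretise K y = steps K (K * K) (\<lambda>j. y (real j / real K))"

definition grid_floor :: "nat \<Rightarrow> real \<Rightarrow> real" where
  "grid_floor K t = real (nat \<lfloor>real K * t\<rfloor>) / real K"

lemma grid_floor_nonneg: "0 \<le> grid_floor K t"
  unfolding grid_floor_def by simp

lemma grid_floor_le: "0 \<le> t \<Longrightarrow> grid_floor K t \<le> t"
  unfolding grid_floor_def by (cases "K = 0") (auto simp: divide_le_eq mult.commute of_nat_floor)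

lemma less_grid_floor_add: "K > 0 \<Longrightarrow> t < grid_floor K t + 1 / real K"
proof -
  assume K: "K > 0"
  have "real K * t < real (nat \<lfloor>real K * t\<rfloor>) + 1" by linarith
  thus ?thesis using K unfolding grid_floor_def by (simp add: field_simps)
qed

lemma discretise_eq:
  assumes "t \<le> real K" shows "discretise K y t = y (grid_floor K t)"
proof -
  have "real K * t \<le> real (K * K)" using assms by (simp add: mult_left_mono)
  hence "nat \<lfloor>real K * t\<rfloor> \<le> nat \<lfloor>real (K * K)\<rfloor>" by (intro nat_mono floor_mono)
  hence "nat \<lfloor>real K * t\<rfloor> \<le> K * K" by (simp only: floor_of_nat nat_int)
  thus ?thesis unfolding discretise_def steps_def grid_floor_def by simp
qed

lemma loc_unif_dist_steps: "loc_unif_dist (steps K J z) (steps K J z') \<le> l1_dist J z z'"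
  by (rule loc_unif_dist_le_bound)
    (auto simp: steps_def intro!: member_le_sum[where f="\<lambda>j. \<bar>z j - z' j\<bar>"])

lemma bounded_Lipschitz_infconv_steps:
  assumes f: "sk_test f" and L: "L \<ge> 0"
  shows "bounded_Lipschitz J (\<lambda>z. infconv f L (steps K J z))"
proof -
  obtain B where B: "\<forall>x. cadlag x \<longrightarrow> \<bar>f x\<bar> \<le> B" using sk_test_bounded[OF f] by blast
  show ?thesis
  proof (rule bounded_LipschitzI)
    show "\<bar>infconv f L (steps K J z)\<bar> \<le> B + L" for z by (rule infconv_bounded[OF B L])
    show "\<bar>infconv f L (steps K J z) - infconv f L (steps K J z')\<bar> \<le> L * l1_dist J z z'" for z z'
      by (rule order_trans[OF infconv_Lipschitz[OF B L]]) (intro mult_left_mono loc_unif_dist_steps L)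
  qed
qed

lemma loc_unif_dist_discretise_tendsto:
  assumes y: "continuous_on {0..} y"
  shows "(\<lambda>K. loc_unif_dist y (discretise K y)) \<longlonglongrightarrow> 0"
proof (rule tendstoI)
  fix r :: real assume r: "r > 0"
  define d where "d = r / 2"
  have d: "d > 0" "d < r" using r unfolding d_def by auto
  have "uniformly_continuous_on {0..1/d} y"
    by (rule compact_uniformly_continuous) (use y in \<open>auto intro: continuous_on_subset\<close>)
  then obtain e where e: "e > 0" "\<And>s t. s \<in> {0..1/d} \<Longrightarrow> t \<in> {0..1/d} \<Longrightarrow> dist s t < e \<Longrightarrow> dist (y s) (y t) < d"
    unfolding uniformly_continuous_on_def using d(1) by metis
  have "\<forall>\<^sub>F K in sequentially. 1/d < real K" by real_asymp
  moreover have "\<forall>\<^sub>F K in sequentially. 1 / real K < e" using e(1) by real_asymp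
  ultimately show "\<forall>\<^sub>F K in sequentially. dist (loc_unif_dist y (discretise K y)) 0 < r"
  proof eventually_elim
    case (elim K)
    have K: "K > 0" using elim(1) d(1) by (metis divide_pos_pos less_trans of_nat_0_less_iff zero_less_one)
    have "loc_unif_dist y (discretise K y) \<le> d"
    proof (rule loc_unif_dist_le[OF d(1)])
      fix t assume t: "0 \<le> t" "t \<le> 1/d"
      have "dist t (grid_floor K t) < e"
        using grid_floor_le[OF t(1), of K] less_grid_floor_add[OF K, of t] elim(2) by (simp add: dist_real_def)
      hence "dist (y t) (y (grid_floor K t)) < d"
        using t grid_floor_le[OF t(1), of K] grid_floor_nonneg[of K t] by (intro e(2)) auto
      thus "\<bar>y t - discretise K y t\<bar> \<le> d"
        using t elim(1) by (simp add: discretise_eq dist_real_def)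
    qed
    thus ?case using d(2) loc_unif_dist_nonneg[of y "discretise K y"] by (simp add: dist_real_def)
  qed
qed

lemma infconv_discretise_tendsto:
  assumes f: "sk_test f" and L: "L \<ge> 0" and y: "continuous_on {0..} y"
  shows "(\<lambda>K. infconv f L (discretise K y)) \<longlonglongrightarrow> infconv f L y"
proof -
  obtain B where B: "\<forall>x. cadlag x \<longrightarrow> \<bar>f x\<bar> \<le> B" using sk_test_bounded[OF f] by blast
  have lim: "(\<lambda>K. L * loc_unif_dist y (discretise K y)) \<longlonglongrightarrow> 0"
    using tendsto_mult_left[OF loc_unif_dist_discretise_tendsto[OF y], of L] by simp
  have "\<bar>infconv f L (discretise K y) - infconv f L y\<bar> \<le> L * loc_unif_dist y (discretise K y)" for K
    using infconv_Lipschitz[OF B L, of "discretise K y" y] by (simp add: loc_unif_dist_commute)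
  hence "(\<lambda>K. infconv f L (discretise K y) - infconv f L y) \<longlonglongrightarrow> 0"
    by (intro Lim_null_comparison[OF always_eventually lim]) simp
  thus ?thesis by (rule LIM_zero_cancel)
qed

definition holds_except :: "'a measure \<Rightarrow> real \<Rightarrow> ('a \<Rightarrow> bool) \<Rightarrow> bool" where
  "holds_except M \<delta> Q \<longleftrightarrow> (\<exists>A\<in>sets M. measure M A \<le> \<delta> \<and> (\<forall>\<omega>\<in>space M - A. Q \<omega>))"

lemma holds_exceptI:
  assumes "A \<in> sets M" "measure M A \<le> \<delta>" "\<And>\<omega>. \<omega> \<in> space M \<Longrightarrow> \<omega> \<notin> A \<Longrightarrow> Q \<omega>"
  shows "holds_except M \<delta> Q"
  unfolding holds_except_def using assms by blast

lemma holds_except_mono: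
  assumes "holds_except M \<delta> Q" "\<delta> \<le> \<delta>'" "\<And>\<omega>. \<omega> \<in> space M \<Longrightarrow> Q \<omega> \<Longrightarrow> R \<omega>"
  shows "holds_except M \<delta>' R"
  using assms unfolding holds_except_def by (meson DiffD1 order_trans)

lemma holds_except_conj:
  assumes "holds_except M \<delta> Q" "holds_except M \<epsilon> R"
  shows "holds_except M (\<delta> + \<epsilon>) (\<lambda>\<omega>. Q \<omega> \<and> R \<omega>)"
proof -
  obtain A where A: "A \<in> sets M" "measure M A \<le> \<delta>" "\<And>\<omega>. \<omega> \<in> space M - A \<Longrightarrow> Q \<omega>"
    using assms(1) unfolding holds_except_def by blast
  obtain B where B: "B \<in> sets M" "measure M B \<le> \<epsilon>" "\<And>\<omega>. \<omega> \<in> space M - B \<Longrightarrow> R \<omega>"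
    using assms(2) unfolding holds_except_def by blast
  show ?thesis
    using measure_Un_le[OF A(1) B(1)] A B by (intro holds_exceptI[of "A \<union> B"]) auto
qed

lemma holds_except_triangle:
  fixes x y z :: "'a \<Rightarrow> 'b \<Rightarrow> real"
  assumes "holds_except M (\<delta> / 2) (\<lambda>\<omega>. \<forall>t\<in>S. \<bar>x \<omega> t - y \<omega> t\<bar> \<le> \<epsilon> / 2)"
    and "holds_except M (\<delta> / 2) (\<lambda>\<omega>. \<forall>t\<in>S. \<bar>y \<omega> t - z \<omega> t\<bar> \<le> \<epsilon> / 2)"
  shows "holds_except M \<delta> (\<lambda>\<omega>. \<forall>t\<in>S. \<bar>x \<omega> t - z \<omega> t\<bar> \<le> \<epsilon>)"
proof (rule holds_except_mono[OF holds_except_conj[OF assms]])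
  fix \<omega> assume close: "(\<forall>t\<in>S. \<bar>x \<omega> t - y \<omega> t\<bar> \<le> \<epsilon> / 2) \<and> (\<forall>t\<in>S. \<bar>y \<omega> t - z \<omega> t\<bar> \<le> \<epsilon> / 2)"
  show "\<forall>t\<in>S. \<bar>x \<omega> t - z \<omega> t\<bar> \<le> \<epsilon>"
  proof
    fix t assume "t \<in> S"
    with close have "\<bar>x \<omega> t - y \<omega> t\<bar> \<le> \<epsilon> / 2" "\<bar>y \<omega> t - z \<omega> t\<bar> \<le> \<epsilon> / 2" by blast+
    thus "\<bar>x \<omega> t - z \<omega> t\<bar> \<le> \<epsilon>" by linarith
  qed
qed simp

lemma holds_except_ball:
  assumes "finite S" "\<And>j. j \<in> S \<Longrightarrow> holds_except M (\<delta> j) (Q j)"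
  shows "holds_except M (\<Sum>j\<in>S. \<delta> j) (\<lambda>\<omega>. \<forall>j\<in>S. Q j \<omega>)"
proof -
  obtain A where A: "\<And>j. j \<in> S \<Longrightarrow> A j \<in> sets M" "\<And>j. j \<in> S \<Longrightarrow> measure M (A j) \<le> \<delta> j"
    "\<And>j \<omega>. j \<in> S \<Longrightarrow> \<omega> \<in> space M - A j \<Longrightarrow> Q j \<omega>"
    using assms(2) unfolding holds_except_def by metis
  have "measure M (\<Union>j\<in>S. A j) \<le> (\<Sum>j\<in>S. measure M (A j))" by (rule measure_UNION_le[OF assms(1) A(1)])
  also have "\<dots> \<le> (\<Sum>j\<in>S. \<delta> j)" by (intro sum_mono A(2))
  finally show ?thesis
    using A assms(1) by (intro holds_exceptI[of "\<Union>j\<in>S. A j"]) (auto intro!: sets.finite_UN)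
qed

lemma (in prob_space) expectation_infconv_le:
  assumes f_bounded: "\<forall>x. cadlag x \<longrightarrow> \<bar>f x\<bar> \<le> B" and Ld: "L \<ge> 0" "d \<ge> 0"
    and X: "\<And>\<omega>. \<omega> \<in> space M \<Longrightarrow> cadlag (X \<omega>)" "(\<lambda>\<omega>. f (X \<omega>)) \<in> borel_measurable M"
    and V: "integrable M (\<lambda>\<omega>. infconv f L (V \<omega>))"
    and close: "holds_except M \<delta> (\<lambda>\<omega>. loc_unif_dist (V \<omega>) (X \<omega>) \<le> d)"
  shows "expectation (\<lambda>\<omega>. infconv f L (V \<omega>)) - L * d - (2 * B + L) * \<delta> \<le> expectation (\<lambda>\<omega>. f (X \<omega>))"
proof -
  obtain A where A: "A \<in> sets M" "prob A \<le> \<delta>" "\<And>\<omega>. \<omega> \<in> space M - A \<Longrightarrow> loc_unif_dist (V \<omega>) (X \<omega>) \<le> d"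
    using close unfolding holds_except_def by blast
  have fX: "integrable M (\<lambda>\<omega>. f (X \<omega>))"
    by (rule integrable_const_bound[where B=B]) (use f_bounded X in auto)
  have pointwise: "infconv f L (V \<omega>) - L * d - (2 * B + L) * indicator A \<omega> \<le> f (X \<omega>)" if \<omega>: "\<omega> \<in> space M" for \<omega>
  proof (cases "\<omega> \<in> A")
    case True
    have "infconv f L (V \<omega>) \<le> B + L" by (rule infconv_le_bound[OF f_bounded Ld(1)])
    moreover have "f (X \<omega>) \<ge> - B" using f_bounded[rule_format, OF X(1)[OF \<omega>]] by linarith
    moreover have "L * d \<ge> 0" using Ld by simp
    ultimately show ?thesis using True by simp
  next
    case False
    have "infconv f L (V \<omega>) \<le> infconv f L (X \<omega>) + L * loc_unif_dist (V \<omega>) (X \<omega>)"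
      by (rule infconv_le_add[OF f_bounded Ld(1)])
    also have "\<dots> \<le> f (X \<omega>) + L * d"
      using A(3)[of \<omega>] \<omega> False Ld(1)
      by (intro add_mono infconv_le[OF f_bounded] X mult_left_mono) auto
    finally show ?thesis using False by simp
  qed
  have "expectation (\<lambda>\<omega>. infconv f L (V \<omega>)) - L * d - (2 * B + L) * prob A
      = expectation (\<lambda>\<omega>. infconv f L (V \<omega>) - L * d - (2 * B + L) * indicator A \<omega>)"
    using V A(1) by (simp add: emeasure_eq_measure prob_space)
  also have "\<dots> \<le> expectation (\<lambda>\<omega>. f (X \<omega>))"
    by (rule integral_mono) (use V fX A(1) pointwise in \<open>auto simp: emeasure_eq_measure\<close>)
  finally have "expectation (\<lambda>\<omega>. infconv f L (V \<omega>)) - L * d - (2 * B + L) * prob A \<le> expectation (\<lambda>\<omega>. f (X \<omega>))" .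
  moreover have "B \<ge> 0" using f_bounded[rule_format, OF cadlag_const] by (meson abs_ge_zero order_trans)
  hence "(2 * B + L) * prob A \<le> (2 * B + L) * \<delta>" using A(2) Ld(1) by (intro mult_left_mono) auto
  ultimately show ?thesis by linarith
qed

locale skorohod_limit_criterion = M: prob_space M + P: prob_space P
  for M :: "'a measure" and P :: "'b measure" +
  fixes X U :: "nat \<Rightarrow> 'a \<Rightarrow> real \<Rightarrow> real" and Y :: "'b \<Rightarrow> real \<Rightarrow> real"
  assumes X_measurable: "\<And>f. sk_test f \<Longrightarrow> \<forall>\<^sub>F n in sequentially. (\<lambda>\<omega>. f (X n \<omega>)) \<in> borel_measurable M"
    and X_cadlag: "\<forall>\<^sub>F n in sequentially. \<forall>\<omega>\<in>space M. cadlag (X n \<omega>)"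
    and U_measurable: "\<And>n t. t \<ge> 0 \<Longrightarrow> (\<lambda>\<omega>. U n \<omega> t) \<in> borel_measurable M"
    and Y_measurable: "\<And>t. t \<ge> 0 \<Longrightarrow> (\<lambda>\<omega>. Y \<omega> t) \<in> borel_measurable P"
    and Y_continuous: "\<And>\<omega>. \<omega> \<in> space P \<Longrightarrow> continuous_on {0..} (Y \<omega>)"
    and finite_dimensional: "\<And>K J h. K > 0 \<Longrightarrow> bounded_Lipschitz J h \<Longrightarrow>
      (\<lambda>n. \<integral>\<omega>. h (\<lambda>j. U n \<omega> (real j / real K)) \<partial>M) \<longlonglongrightarrow> (\<integral>\<omega>. h (\<lambda>j. Y \<omega> (real j / real K)) \<partial>P)"
    and grid_approximation: "\<And>T \<epsilon> \<delta>. T > 0 \<Longrightarrow> \<epsilon> > 0 \<Longrightarrow> \<delta> > 0 \<Longrightarrow> \<forall>\<^sub>F K in sequentially. \<forall>\<^sub>F n in sequentially.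
      holds_except M \<delta> (\<lambda>\<omega>. \<forall>t\<in>{0..T}. \<bar>X n \<omega> t - U n \<omega> (grid_floor K t)\<bar> \<le> \<epsilon>)"
begin

lemma expectation_infconv_discretise_tendsto:
  assumes f: "sk_test f" and L: "L \<ge> 0"
  shows "(\<lambda>\<omega>. infconv f L (Y \<omega>)) \<in> borel_measurable P"
    "(\<lambda>K. P.expectation (\<lambda>\<omega>. infconv f L (discretise K (Y \<omega>)))) \<longlonglongrightarrow> P.expectation (\<lambda>\<omega>. infconv f L (Y \<omega>))"
proof -
  obtain B where B: "\<forall>x. cadlag x \<longrightarrow> \<bar>f x\<bar> \<le> B" using sk_test_bounded[OF f] by blast
  have meas: "(\<lambda>\<omega>. infconv f L (discretise K (Y \<omega>))) \<in> borel_measurable P" for K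
    unfolding discretise_def
    by (rule bounded_Lipschitz_measurable[OF bounded_Lipschitz_infconv_steps[OF f L]]) (rule Y_measurable, simp)
  have lim: "(\<lambda>K. infconv f L (discretise K (Y \<omega>))) \<longlonglongrightarrow> infconv f L (Y \<omega>)" if "\<omega> \<in> space P" for \<omega>
    by (rule infconv_discretise_tendsto[OF f L Y_continuous[OF that]])
  show limit_meas: "(\<lambda>\<omega>. infconv f L (Y \<omega>)) \<in> borel_measurable P"
    by (rule borel_measurable_LIMSEQ_real[OF lim meas])
  show "(\<lambda>K. P.expectation (\<lambda>\<omega>. infconv f L (discretise K (Y \<omega>)))) \<longlonglongrightarrow> P.expectation (\<lambda>\<omega>. infconv f L (Y \<omega>))"
  proof (rule integral_dominated_convergence[where w="\<lambda>_. B + L"])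
    show "AE \<omega> in P. norm (infconv f L (discretise K (Y \<omega>))) \<le> B + L" for K
      by (intro AE_I2) (simp add: infconv_bounded[OF B L])
  qed (use limit_meas meas lim in \<open>auto intro: AE_I2\<close>)
qed

lemma expectation_infconv_tendsto:
  assumes f: "sk_test f"
  shows "(\<lambda>n. P.expectation (\<lambda>\<omega>. infconv f (real n) (Y \<omega>))) \<longlonglongrightarrow> P.expectation (\<lambda>\<omega>. f (Y \<omega>))"
proof -
  obtain B where B: "\<forall>x. cadlag x \<longrightarrow> \<bar>f x\<bar> \<le> B" using sk_test_bounded[OF f] by blast
  have cadlag: "cadlag (Y \<omega>)" if "\<omega> \<in> space P" for \<omega> using Y_continuous[OF that] by (rule continuous_cadlag)
  have meas: "(\<lambda>\<omega>. infconv f (real n) (Y \<omega>)) \<in> borel_measurable P" for n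
    by (rule expectation_infconv_discretise_tendsto[OF f]) simp
  have lim: "(\<lambda>n. infconv f (real n) (Y \<omega>)) \<longlonglongrightarrow> f (Y \<omega>)" if "\<omega> \<in> space P" for \<omega>
    by (rule infconv_tendsto[OF B f cadlag[OF that]])
  have limit_meas: "(\<lambda>\<omega>. f (Y \<omega>)) \<in> borel_measurable P"
    by (rule borel_measurable_LIMSEQ_real[OF lim meas])
  show ?thesis
  proof (rule integral_dominated_convergence[where w="\<lambda>_. B"])
    have "\<bar>infconv f (real n) (Y \<omega>)\<bar> \<le> B" if "\<omega> \<in> space P" for n \<omega>
      using infconv_ge[OF B, of "real n" "Y \<omega>"] infconv_le[OF B of_nat_0_le_iff cadlag[OF that], of n]
        B[rule_format, OF cadlag[OF that]] by (simp add: abs_le_iff)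
    thus "AE \<omega> in P. norm (infconv f (real n) (Y \<omega>)) \<le> B" for n by (intro AE_I2) simp
  qed (use limit_meas meas lim in \<open>auto intro: AE_I2\<close>)
qed

lemma expectation_infconv_discretise_approx:
  assumes f: "sk_test f" and e: "e > 0"
  shows "\<exists>L\<ge>0. \<forall>\<^sub>F K in sequentially.
    P.expectation (\<lambda>\<omega>. f (Y \<omega>)) - e < P.expectation (\<lambda>\<omega>. infconv f L (discretise K (Y \<omega>)))"
proof -
  have "\<forall>\<^sub>F n in sequentially. P.expectation (\<lambda>\<omega>. f (Y \<omega>)) - e < P.expectation (\<lambda>\<omega>. infconv f (real n) (Y \<omega>))"
    by (rule order_tendstoD[OF expectation_infconv_tendsto[OF f]]) (use e in simp)
  then obtain n where n: "P.expectation (\<lambda>\<omega>. f (Y \<omega>)) - e < P.expectation (\<lambda>\<omega>. infconv f (real n) (Y \<omega>))"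
    by (blast dest: eventually_happens'[OF sequentially_bot])
  show ?thesis
    by (intro exI[of _ "real n"] conjI order_tendstoD(1)[OF expectation_infconv_discretise_tendsto(2)[OF f] n]) simp_all
qed

lemma expectation_limit_lower_bound:
  assumes f: "sk_test f" and e: "e > 0"
  shows "\<forall>\<^sub>F n in sequentially. P.expectation (\<lambda>\<omega>. f (Y \<omega>)) - e \<le> M.expectation (\<lambda>\<omega>. f (X n \<omega>))"
proof -
  obtain B where B: "\<forall>x. cadlag x \<longrightarrow> \<bar>f x\<bar> \<le> B" using sk_test_bounded[OF f] by blast
  have B_nonneg: "B \<ge> 0" using B[rule_format, OF cadlag_const] by (meson abs_ge_zero order_trans)
  obtain L where L: "L \<ge> 0" and limit: "\<forall>\<^sub>F K in sequentially.
      P.expectation (\<lambda>\<omega>. f (Y \<omega>)) - e / 4 < P.expectation (\<lambda>\<omega>. infconv f L (discretise K (Y \<omega>)))"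
    using expectation_infconv_discretise_approx[OF f, of "e / 4"] e by auto
  define d where "d = e / (4 * (L + 1))"
  define \<delta> where "\<delta> = e / (4 * (2 * B + L + 1))"
  have d: "d > 0" "\<delta> > 0" "L * d \<le> e / 4" "(2 * B + L) * \<delta> \<le> e / 4" "1/d > 0"
    using e L B_nonneg unfolding d_def \<delta>_def by (auto simp: field_simps)
  have "\<forall>\<^sub>F K in sequentially. 1/d < real K" by real_asymp
  from eventually_happens'[OF sequentially_bot eventually_conj[OF this
      eventually_conj[OF limit grid_approximation[OF d(5,1,2)]]]]
  obtain K where K: "1/d < real K"
    and limit_K: "P.expectation (\<lambda>\<omega>. f (Y \<omega>)) - e / 4 < P.expectation (\<lambda>\<omega>. infconv f L (discretise K (Y \<omega>)))"
    and grid: "\<forall>\<^sub>F n in sequentially. holds_except M \<delta> (\<lambda>\<omega>. \<forall>t\<in>{0..1/d}. \<bar>X n \<omega> t - U n \<omega> (grid_floor K t)\<bar> \<le> d)"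
    by blast
  have "K > 0" using K d(1) by (metis divide_pos_pos less_trans of_nat_0_less_iff zero_less_one)
  note bL = bounded_Lipschitz_infconv_steps[OF f L]
  have "\<forall>\<^sub>F n in sequentially. P.expectation (\<lambda>\<omega>. infconv f L (discretise K (Y \<omega>))) - e / 4
      < M.expectation (\<lambda>\<omega>. infconv f L (discretise K (U n \<omega>)))"
    unfolding discretise_def by (rule order_tendstoD[OF finite_dimensional[OF \<open>K > 0\<close> bL]]) (use e in simp)
  thus ?thesis using grid X_cadlag X_measurable[OF f]
  proof eventually_elim
    case (elim n)
    have "M.expectation (\<lambda>\<omega>. infconv f L (discretise K (U n \<omega>))) - L * d - (2 * B + L) * \<delta> \<le> M.expectation (\<lambda>\<omega>. f (X n \<omega>))"
    proof (rule M.expectation_infconv_le[OF B L less_imp_le[OF d(1)]])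
      show "integrable M (\<lambda>\<omega>. infconv f L (discretise K (U n \<omega>)))"
        unfolding discretise_def by (rule M.bounded_Lipschitz_integrable[OF bL]) (rule U_measurable, simp)
      show "holds_except M \<delta> (\<lambda>\<omega>. loc_unif_dist (discretise K (U n \<omega>)) (X n \<omega>) \<le> d)"
        using K by (intro holds_except_mono[OF elim(2)] loc_unif_dist_le[OF d(1)])
          (auto simp: discretise_eq abs_minus_commute)
    qed (use elim in auto)
    thus ?case using elim(1) limit_K d(3,4) by linarith
  qed
qed

theorem weak_convergence: "sk_conv_dist M X P Y"
  unfolding sk_conv_dist_def
proof (intro allI impI)
  fix f assume f: "sk_test f"
  have "\<forall>\<^sub>F n in sequentially. \<bar>M.expectation (\<lambda>\<omega>. f (X n \<omega>)) - P.expectation (\<lambda>\<omega>. f (Y \<omega>))\<bar> < e" if "e > 0" for e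
  proof -
    have half: "e / 2 > 0" using that by simp
    show ?thesis
      using expectation_limit_lower_bound[OF f half] expectation_limit_lower_bound[OF sk_test_uminus[OF f] half]
      by eventually_elim (use that in auto)
  qed
  thus "(\<lambda>n. M.expectation (\<lambda>\<omega>. f (X n \<omega>))) \<longlonglongrightarrow> P.expectation (\<lambda>\<omega>. f (Y \<omega>))"
    by (auto simp: tendsto_iff dist_real_def)
qed

end

lemma eventually_floor_affine_at_right:
  fixes s x t :: real
  assumes "s > 0" shows "\<forall>\<^sub>F t' in at_right t. \<lfloor>x + s * t'\<rfloor> = \<lfloor>x + s * t\<rfloor>"
  unfolding eventually_at_right_field
proof (intro exI[of _ "(real_of_int \<lfloor>x + s * t\<rfloor> + 1 - x) / s"] conjI allI impI)
  have "x + s * t < real_of_int \<lfloor>x + s * t\<rfloor> + 1" by linarith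
  thus "t < (real_of_int \<lfloor>x + s * t\<rfloor> + 1 - x) / s" using assms by (simp add: field_simps)
  fix t' assume t': "t < t'" "t' < (real_of_int \<lfloor>x + s * t\<rfloor> + 1 - x) / s"
  have "s * t' < real_of_int \<lfloor>x + s * t\<rfloor> + 1 - x" using t'(2) assms by (simp add: field_simps)
  moreover have "s * t < s * t'" using t'(1) assms by simp
  ultimately show "\<lfloor>x + s * t'\<rfloor> = \<lfloor>x + s * t\<rfloor>" by (intro floor_unique) linarith+
qed

lemma eventually_floor_affine_at_left:
  fixes s x t :: real
  assumes "s > 0" shows "\<forall>\<^sub>F t' in at_left t. \<lfloor>x + s * t'\<rfloor> = \<lceil>x + s * t\<rceil> - 1"
  unfolding eventually_at_left_field
proof (intro exI[of _ "(real_of_int (\<lceil>x + s * t\<rceil> - 1) - x) / s"] conjI allI impI)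
  have "real_of_int (\<lceil>x + s * t\<rceil> - 1) < x + s * t" by linarith
  thus "(real_of_int (\<lceil>x + s * t\<rceil> - 1) - x) / s < t" using assms by (simp add: field_simps)
  fix t' assume t': "(real_of_int (\<lceil>x + s * t\<rceil> - 1) - x) / s < t'" "t' < t"
  have "real_of_int (\<lceil>x + s * t\<rceil> - 1) - x < s * t'" using t'(1) assms by (simp add: field_simps)
  moreover have "s * t' < s * t" using t'(2) assms by simp
  ultimately show "\<lfloor>x + s * t'\<rfloor> = \<lceil>x + s * t\<rceil> - 1" by (intro floor_unique) linarith+
qed

lemma cadlag_step_path:
  fixes s x :: real and g :: "nat \<Rightarrow> real"
  assumes s: "s > 0" and v: "continuous_on {0..} v"
  shows "cadlag (\<lambda>t. v t * g (nat \<lfloor>x + s * t\<rfloor>))"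
proof -
  have step: "((\<lambda>t. v t * g (nat \<lfloor>x + s * t\<rfloor>)) \<longlongrightarrow> l * g (nat m)) F"
    if "(v \<longlongrightarrow> l) F" "\<forall>\<^sub>F t in F. \<lfloor>x + s * t\<rfloor> = m" for l m F
    using tendsto_mult[OF that(1) tendsto_const]
    by (rule Lim_transform_eventually) (use that(2) in eventually_elim, simp)
  note cadlag_v = continuous_cadlag[OF v, unfolded cadlag_def]
  show ?thesis unfolding cadlag_def
    using cadlag_v step[OF _ eventually_floor_affine_at_right[OF s]] step[OF _ eventually_floor_affine_at_left[OF s]]
    by blast
qed

lemma uniform_limit_step_paths:
  fixes s x m :: real and gs :: "nat \<Rightarrow> nat \<Rightarrow> real"
  assumes s: "s > 0" and v: "continuous_on {0..} v" and gs: "\<And>k. (\<lambda>n. gs n k) \<longlonglongrightarrow> g k"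
  shows "uniform_limit {0..m} (\<lambda>n t. v t * gs n (nat \<lfloor>x + s * t\<rfloor>)) (\<lambda>t. v t * g (nat \<lfloor>x + s * t\<rfloor>)) sequentially"
proof (intro uniform_lim_mult uniform_limit_const)
  define k where "k = nat \<lfloor>x + s * m\<rfloor>"
  have index: "(\<lambda>t. nat \<lfloor>x + s * t\<rfloor>) \<in> {0..m} \<rightarrow> {..k}"
    unfolding k_def using s by (auto intro!: nat_mono floor_mono)
  have "uniform_limit (\<Union>j\<in>{..k}. {j}) gs g sequentially"
    using gs by (intro uniform_limit_on_UNION) auto
  hence "uniform_limit {..k} gs g sequentially" by simp
  from uniform_limit_compose'[OF this index]
  show "uniform_limit {0..m} (\<lambda>n t. gs n (nat \<lfloor>x + s * t\<rfloor>)) (\<lambda>t. g (nat \<lfloor>x + s * t\<rfloor>)) sequentially" .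
  have "(\<lambda>t. g (nat \<lfloor>x + s * t\<rfloor>)) ` {0..m} \<subseteq> g ` {..k}" using index by auto
  thus "bounded ((\<lambda>t. g (nat \<lfloor>x + s * t\<rfloor>)) ` {0..m})"
    by (rule bounded_subset[rotated]) (simp add: finite_imp_bounded)
  show "bounded (v ` {0..m})"
    by (intro compact_imp_bounded compact_continuous_image continuous_on_subset[OF v]) auto
qed

lemma sk_test_step_path_measurable:
  fixes s x :: real and X :: "nat \<Rightarrow> 'a \<Rightarrow> real"
  assumes f: "sk_test f" and s: "s > 0" and v: "continuous_on {0..} v"
    and X: "\<And>k. X k \<in> borel_measurable M"
  shows "(\<lambda>\<omega>. f (\<lambda>t. v t * X (nat \<lfloor>x + s * t\<rfloor>) \<omega>)) \<in> borel_measurable M"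
proof -
  define \<Psi> where "\<Psi> = (\<lambda>g :: nat \<Rightarrow> real. f (\<lambda>t. v t * g (nat \<lfloor>x + s * t\<rfloor>)))"
  have "continuous_on UNIV \<Psi>"
    unfolding continuous_on_sequentially
  proof (intro allI ballI impI)
    fix gs :: "nat \<Rightarrow> nat \<Rightarrow> real" and g :: "nat \<Rightarrow> real"
    assume "(\<forall>n. gs n \<in> UNIV) \<and> gs \<longlonglongrightarrow> g"
    hence "(\<lambda>n. gs n k) \<longlonglongrightarrow> g k" for k by (auto intro: tendsto_coordinate)
    thus "(\<Psi> \<circ> gs) \<longlonglongrightarrow> \<Psi> g"
      unfolding \<Psi>_def comp_def
      by (intro sk_test_tendsto[OF f] cadlag_step_path s v sk_converges_locally_uniformly uniform_limit_step_paths)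
  qed
  hence "\<Psi> \<in> borel_measurable borel" by (rule borel_measurable_continuous_onI)
  moreover have "(\<lambda>\<omega> k. X k \<omega>) \<in> borel_measurable M" using X by (rule measurable_coordinatewise_then_product)
  ultimately have "(\<lambda>\<omega>. \<Psi> (\<lambda>k. X k \<omega>)) \<in> borel_measurable M" by (rule measurable_compose[rotated])
  thus ?thesis unfolding \<Psi>_def .
qed

section \<open>Bounded martingale differences\<close>

definition bounded_measurable :: "'a measure \<Rightarrow> 'a measure \<Rightarrow> ('a \<Rightarrow> real) \<Rightarrow> bool" where
  "bounded_measurable M F f \<longleftrightarrow> f \<in> borel_measurable F \<and> (\<exists>B. \<forall>\<omega>\<in>space M. \<bar>f \<omega>\<bar> \<le> B)"

lemma bounded_measurableI:
  "f \<in> borel_measurable F \<Longrightarrow> (\<And>\<omega>. \<omega> \<in> space M \<Longrightarrow> \<bar>f \<omega>\<bar> \<le> B) \<Longrightarrow> bounded_measurable M F f"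
  unfolding bounded_measurable_def by blast

lemma bounded_measurable_measurable: "bounded_measurable M F f \<Longrightarrow> f \<in> borel_measurable F"
  unfolding bounded_measurable_def by blast

lemma bounded_measurable_const: "bounded_measurable M F (\<lambda>_. c)"
  by (rule bounded_measurableI[where B="\<bar>c\<bar>"]) auto

lemma bounded_measurable_add:
  assumes "bounded_measurable M F f" "bounded_measurable M F g"
  shows "bounded_measurable M F (\<lambda>\<omega>. f \<omega> + g \<omega>)"
proof -
  obtain B C where "\<forall>\<omega>\<in>space M. \<bar>f \<omega>\<bar> \<le> B" "\<forall>\<omega>\<in>space M. \<bar>g \<omega>\<bar> \<le> C"
    using assms unfolding bounded_measurable_def by blast
  hence "\<bar>f \<omega> + g \<omega>\<bar> \<le> B + C" if "\<omega> \<in> space M" for \<omega>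
    using that by (meson abs_triangle_ineq add_mono order_trans)
  moreover have "(\<lambda>\<omega>. f \<omega> + g \<omega>) \<in> borel_measurable F"
    using assms by (intro borel_measurable_add bounded_measurable_measurable)
  ultimately show ?thesis by (rule bounded_measurableI[rotated])
qed

lemma bounded_measurable_mult:
  assumes "bounded_measurable M F f" "bounded_measurable M F g"
  shows "bounded_measurable M F (\<lambda>\<omega>. f \<omega> * g \<omega>)"
proof -
  obtain B C where BC: "\<forall>\<omega>\<in>space M. \<bar>f \<omega>\<bar> \<le> B" "\<forall>\<omega>\<in>space M. \<bar>g \<omega>\<bar> \<le> C"
    using assms unfolding bounded_measurable_def by blast
  have "\<bar>f \<omega> * g \<omega>\<bar> \<le> B * C" if "\<omega> \<in> space M" for \<omega>
    using BC that unfolding abs_mult by (intro mult_mono) (auto intro: order_trans[OF abs_ge_zero])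
  moreover have "(\<lambda>\<omega>. f \<omega> * g \<omega>) \<in> borel_measurable F"
    using assms by (intro borel_measurable_times bounded_measurable_measurable)
  ultimately show ?thesis by (rule bounded_measurableI[rotated])
qed

lemma bounded_measurable_cmult:
  "bounded_measurable M F f \<Longrightarrow> bounded_measurable M F (\<lambda>\<omega>. c * f \<omega>)"
  by (rule bounded_measurable_mult[OF bounded_measurable_const])

lemma bounded_measurable_diff:
  "bounded_measurable M F f \<Longrightarrow> bounded_measurable M F g \<Longrightarrow> bounded_measurable M F (\<lambda>\<omega>. f \<omega> - g \<omega>)"
  using bounded_measurable_add[of M F f "\<lambda>\<omega>. (-1) * g \<omega>"] bounded_measurable_cmult[of M F g "-1"] by simp

lemma bounded_measurable_power:
  "bounded_measurable M F f \<Longrightarrow> bounded_measurable M F (\<lambda>\<omega>. f \<omega> ^ n)"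
  by (induction n) (auto intro: bounded_measurable_const bounded_measurable_mult)

lemma bounded_measurable_sum:
  "(\<And>i. i \<in> I \<Longrightarrow> bounded_measurable M F (f i)) \<Longrightarrow> bounded_measurable M F (\<lambda>\<omega>. \<Sum>i\<in>I. f i \<omega>)"
  by (induction I rule: infinite_finite_induct) (auto intro: bounded_measurable_const bounded_measurable_add)

lemma bounded_measurable_prod:
  "(\<And>i. i \<in> I \<Longrightarrow> bounded_measurable M F (f i)) \<Longrightarrow> bounded_measurable M F (\<lambda>\<omega>. \<Prod>i\<in>I. f i \<omega>)"
  by (induction I rule: infinite_finite_induct) (auto intro: bounded_measurable_const bounded_measurable_mult)

lemmas bounded_measurable_intros = bounded_measurable_const bounded_measurable_add bounded_measurable_mult
  bounded_measurable_diff bounded_measurable_power bounded_measurable_sum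

lemma bounded_measurable_subalgebra:
  "subalgebra M F \<Longrightarrow> bounded_measurable M F f \<Longrightarrow> bounded_measurable M M f"
  unfolding bounded_measurable_def using measurable_from_subalg by blast

lemma bounded_measurable_bounded_Lipschitz:
  assumes h: "bounded_Lipschitz J h" and X: "\<And>j. (\<lambda>\<omega>. X \<omega> j) \<in> borel_measurable F"
  shows "bounded_measurable M F (\<lambda>\<omega>. h (X \<omega>))"
proof -
  obtain B where "\<And>x. \<bar>h x\<bar> \<le> B" using bounded_Lipschitz_bounded[OF h] by blast
  thus ?thesis by (intro bounded_measurableI bounded_Lipschitz_measurable[OF h X])
qed

lemma (in prob_space) bounded_measurable_integrable: "bounded_measurable M M f \<Longrightarrow> integrable M f"
  unfolding bounded_measurable_def by (auto intro!: integrable_const_bound AE_I2)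

lemma add_power4_le:
  fixes s x :: real
  shows "(s + x) ^ 4 \<le> s ^ 4 + 4 * s ^ 3 * x + 8 * x\<^sup>2 * s\<^sup>2 + 3 * x ^ 4"
proof -
  have "(s + x) ^ 4 + 2 * x\<^sup>2 * (s - x)\<^sup>2 = s ^ 4 + 4 * s ^ 3 * x + 8 * x\<^sup>2 * s\<^sup>2 + 3 * x ^ 4"
    by (simp add: power2_eq_square power4_eq_xxxx power3_eq_cube algebra_simps)
  moreover have "2 * x\<^sup>2 * (s - x)\<^sup>2 \<ge> 0" by simp
  ultimately show ?thesis by linarith
qed

locale bounded_martingale_differences = prob_space M for M :: "'a measure" +
  fixes F :: "nat \<Rightarrow> 'a measure" and \<xi> :: "nat \<Rightarrow> 'a \<Rightarrow> real" and b :: "nat \<Rightarrow> real"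
  assumes subalgebra: "\<And>k. subalgebra M (F k)"
    and adapted: "\<And>k l. l < k \<Longrightarrow> \<xi> l \<in> borel_measurable (F k)"
    and bounded: "\<And>l \<omega>. \<omega> \<in> space M \<Longrightarrow> \<bar>\<xi> l \<omega>\<bar> \<le> b l"
    and orthogonal: "\<And>k g. bounded_measurable M (F k) g \<Longrightarrow> expectation (\<lambda>\<omega>. g \<omega> * \<xi> k \<omega>) = 0"
begin

lemma bound_nonneg: "0 \<le> b l"
proof -
  obtain \<omega> where "\<omega> \<in> space M" using not_empty by blast
  from bounded[OF this, of l] show ?thesis by linarith
qed

lemma bounded_measurable_difference: "l < k \<Longrightarrow> bounded_measurable M (F k) (\<xi> l)"
  by (rule bounded_measurableI[where B="b l"]) (auto intro: adapted bounded)

lemma bounded_measurable_difference_M: "bounded_measurable M M (\<xi> l)"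
  by (rule bounded_measurable_subalgebra[OF subalgebra bounded_measurable_difference[OF lessI]])

definition block_sum :: "nat \<Rightarrow> nat \<Rightarrow> 'a \<Rightarrow> real" where
  "block_sum p k \<omega> = (\<Sum>l=p..<k. \<xi> l \<omega>)"

lemma block_sum_Suc: "p \<le> k \<Longrightarrow> block_sum p (Suc k) \<omega> = block_sum p k \<omega> + \<xi> k \<omega>"
  unfolding block_sum_def by simp

lemma bounded_measurable_block_sum: "j \<le> k \<Longrightarrow> bounded_measurable M (F k) (block_sum p j)"
  unfolding block_sum_def by (intro bounded_measurable_sum bounded_measurable_difference) auto

lemma bounded_measurable_block_sum_M: "bounded_measurable M M (block_sum p k)"
  by (rule bounded_measurable_subalgebra[OF subalgebra bounded_measurable_block_sum[OF order_refl]])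

lemma difference_square_le: "\<omega> \<in> space M \<Longrightarrow> (\<xi> l \<omega>)\<^sup>2 \<le> (b l)\<^sup>2"
  using bounded[of \<omega> l] bound_nonneg[of l] by (simp add: abs_le_square_iff[symmetric])

lemma second_moment_le: "expectation (\<lambda>\<omega>. (block_sum p k \<omega>)\<^sup>2) \<le> (\<Sum>l=p..<k. (b l)\<^sup>2)"
proof (induction k)
  case (Suc k)
  show ?case
  proof (cases "p \<le> k")
    case True
    define S where "S = block_sum p k"
    note S = bounded_measurable_block_sum[OF order_refl, of k p, folded S_def]
    note SM = bounded_measurable_block_sum_M[of p k, folded S_def]
    note int = bounded_measurable_integrable[OF bounded_measurable_power[OF SM, of 2]]
      bounded_measurable_integrable[OF bounded_measurable_mult[OF bounded_measurable_cmult[OF SM, of 2]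
        bounded_measurable_difference_M[of k]]]
    have "expectation (\<lambda>\<omega>. (block_sum p (Suc k) \<omega>)\<^sup>2) \<le> expectation (\<lambda>\<omega>. (S \<omega>)\<^sup>2 + 2 * S \<omega> * \<xi> k \<omega> + (b k)\<^sup>2)"
    proof (rule integral_mono)
      show "integrable M (\<lambda>\<omega>. (block_sum p (Suc k) \<omega>)\<^sup>2)"
        by (intro bounded_measurable_integrable bounded_measurable_power bounded_measurable_block_sum_M)
      show "integrable M (\<lambda>\<omega>. (S \<omega>)\<^sup>2 + 2 * S \<omega> * \<xi> k \<omega> + (b k)\<^sup>2)" using int by simp
      show "(block_sum p (Suc k) \<omega>)\<^sup>2 \<le> (S \<omega>)\<^sup>2 + 2 * S \<omega> * \<xi> k \<omega> + (b k)\<^sup>2" if "\<omega> \<in> space M" for \<omega>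
        using difference_square_le[OF that, of k] by (simp add: block_sum_Suc[OF True] S_def power2_sum)
    qed
    also have "\<dots> = expectation (\<lambda>\<omega>. (S \<omega>)\<^sup>2) + (b k)\<^sup>2"
      using int orthogonal[OF bounded_measurable_cmult[OF S, of 2]] by (simp add: prob_space)
    finally show ?thesis using Suc True by (simp add: S_def)
  qed (simp add: block_sum_def)
qed (simp add: block_sum_def)

lemma fourth_moment_le: "expectation (\<lambda>\<omega>. (block_sum p k \<omega>) ^ 4) \<le> 4 * (\<Sum>l=p..<k. (b l)\<^sup>2)\<^sup>2"
proof (induction k)
  case (Suc k)
  show ?case
  proof (cases "p \<le> k")
    case True
    define S where "S = block_sum p k"
    define V where "V = (\<Sum>l=p..<k. (b l)\<^sup>2)"
    note S = bounded_measurable_block_sum[OF order_refl, of k p, folded S_def]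
    note SM = bounded_measurable_block_sum_M[of p k, folded S_def]
    note int = bounded_measurable_integrable[OF bounded_measurable_power[OF SM, of 4]]
      bounded_measurable_integrable[OF bounded_measurable_power[OF SM, of 2]]
      bounded_measurable_integrable[OF bounded_measurable_mult[OF
        bounded_measurable_cmult[OF bounded_measurable_power[OF SM, of 3], of 4]
          bounded_measurable_difference_M[of k]]]
    have "expectation (\<lambda>\<omega>. (block_sum p (Suc k) \<omega>) ^ 4)
        \<le> expectation (\<lambda>\<omega>. S \<omega> ^ 4 + 4 * S \<omega> ^ 3 * \<xi> k \<omega> + (8 * (b k)\<^sup>2) * (S \<omega>)\<^sup>2 + 3 * (b k) ^ 4)"
    proof (rule integral_mono)
      show "integrable M (\<lambda>\<omega>. (block_sum p (Suc k) \<omega>) ^ 4)"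
        by (intro bounded_measurable_integrable bounded_measurable_power bounded_measurable_block_sum_M)
      show "integrable M (\<lambda>\<omega>. S \<omega> ^ 4 + 4 * S \<omega> ^ 3 * \<xi> k \<omega> + (8 * (b k)\<^sup>2) * (S \<omega>)\<^sup>2 + 3 * (b k) ^ 4)"
        using int by simp
      fix \<omega> assume \<omega>: "\<omega> \<in> space M"
      have "((\<xi> k \<omega>)\<^sup>2)\<^sup>2 \<le> ((b k)\<^sup>2)\<^sup>2" using power_mono[OF difference_square_le[OF \<omega>, of k], of 2] by simp
      moreover have "8 * (\<xi> k \<omega>)\<^sup>2 * (S \<omega>)\<^sup>2 \<le> 8 * (b k)\<^sup>2 * (S \<omega>)\<^sup>2"
        using difference_square_le[OF \<omega>] by (intro mult_right_mono mult_left_mono) auto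
      ultimately show "(block_sum p (Suc k) \<omega>) ^ 4 \<le> S \<omega> ^ 4 + 4 * S \<omega> ^ 3 * \<xi> k \<omega> + (8 * (b k)\<^sup>2) * (S \<omega>)\<^sup>2 + 3 * (b k) ^ 4"
        using add_power4_le[of "S \<omega>" "\<xi> k \<omega>"] by (simp add: block_sum_Suc[OF True] S_def)
    qed
    also have "\<dots> = expectation (\<lambda>\<omega>. S \<omega> ^ 4) + 8 * (b k)\<^sup>2 * expectation (\<lambda>\<omega>. (S \<omega>)\<^sup>2) + 3 * (b k) ^ 4"
      using int orthogonal[OF bounded_measurable_cmult[OF bounded_measurable_power[OF S, of 3], of 4]] by (simp add: prob_space)
    also have "\<dots> \<le> 4 * V\<^sup>2 + 8 * (b k)\<^sup>2 * V + 3 * (b k) ^ 4"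
      using Suc second_moment_le[of p k] unfolding S_def V_def by (intro add_mono mult_left_mono) auto
    also have "\<dots> \<le> 4 * (V + (b k)\<^sup>2)\<^sup>2"
      using bound_nonneg[of k] by (simp add: power2_sum power4_eq_xxxx power2_eq_square algebra_simps zero_le_mult_iff)
    finally show ?thesis using True by (simp add: V_def)
  qed (simp add: block_sum_def)
qed (simp add: block_sum_def)

definition below :: "real \<Rightarrow> nat \<Rightarrow> nat \<Rightarrow> 'a set" where
  "below \<epsilon> p l = {\<omega>\<in>space M. \<forall>j\<in>{p..l}. \<bar>block_sum p j \<omega>\<bar> < \<epsilon>}"

text \<open>Stopping at the first exceedance preserves the hypotheses, so the moment bound applies to the stopped sum, which
  stays beyond \<epsilon> once the original sum has exceeded \<epsilon>.\<close>

definition stopped_difference :: "real \<Rightarrow> nat \<Rightarrow> nat \<Rightarrow> 'a \<Rightarrow> real" where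
  "stopped_difference \<epsilon> p l \<omega> = indicator (below \<epsilon> p l) \<omega> * \<xi> l \<omega>"

lemma below_measurable: "l \<le> k \<Longrightarrow> below \<epsilon> p l \<in> sets (F k)"
proof -
  assume lk: "l \<le> k"
  have "below \<epsilon> p l = {\<omega>\<in>space (F k). \<forall>j\<in>{p..l}. \<bar>block_sum p j \<omega>\<bar> < \<epsilon>}"
    using subalgebra[of k] unfolding below_def subalgebra_def by simp
  also have "\<dots> \<in> sets (F k)"
  proof (rule sets.sets_Collect_finite_All)
    fix j assume "j \<in> {p..l}"
    hence [measurable]: "block_sum p j \<in> borel_measurable (F k)"
      using lk by (intro bounded_measurable_measurable[OF bounded_measurable_block_sum]) auto
    show "{\<omega> \<in> space (F k). \<bar>block_sum p j \<omega>\<bar> < \<epsilon>} \<in> sets (F k)" by measurable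
  qed auto
  finally show ?thesis .
qed

lemma stopped_martingale_differences: "bounded_martingale_differences M F (stopped_difference \<epsilon> p) b"
proof unfold_locales
  have ind: "bounded_measurable M (F k) (indicator (below \<epsilon> p l))" if "l \<le> k" for k l
    by (rule bounded_measurableI[where B=1]) (use below_measurable[OF that] in \<open>auto simp: indicator_def\<close>)
  show "subalgebra M (F k)" for k by (rule subalgebra)
  show "stopped_difference \<epsilon> p l \<in> borel_measurable (F k)" if "l < k" for k l
    using bounded_measurable_mult[OF ind bounded_measurable_difference[OF that], of l] that
    unfolding stopped_difference_def bounded_measurable_def by auto
  show "\<bar>stopped_difference \<epsilon> p l \<omega>\<bar> \<le> b l" if "\<omega> \<in> space M" for l \<omega>
    using bounded[OF that, of l] bound_nonneg[of l] unfolding stopped_difference_def by (auto simp: indicator_def)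
  show "expectation (\<lambda>\<omega>. g \<omega> * stopped_difference \<epsilon> p k \<omega>) = 0" if "bounded_measurable M (F k) g" for k g
    using orthogonal[OF bounded_measurable_mult[OF that ind[OF order_refl]]]
    unfolding stopped_difference_def by (simp add: mult.assoc)
qed

lemma stopped_sum_exceeds:
  assumes \<omega>: "\<omega> \<in> space M" and "\<omega> \<notin> below \<epsilon> p m"
  shows "\<epsilon> \<le> \<bar>\<Sum>l=p..<m. stopped_difference \<epsilon> p l \<omega>\<bar>"
proof -
  define exceeds where "exceeds = (\<lambda>j. p \<le> j \<and> \<epsilon> \<le> \<bar>block_sum p j \<omega>\<bar>)"
  define k where "k = (LEAST j. exceeds j)"
  obtain j where j: "exceeds j" "j \<le> m" using assms unfolding below_def exceeds_def by (auto simp: not_less)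
  have k: "exceeds k" "k \<le> m"
    unfolding k_def using LeastI[of exceeds, OF j(1)] Least_le[of exceeds, OF j(1)] j(2) by auto
  have before: "\<bar>block_sum p j \<omega>\<bar> < \<epsilon>" if "p \<le> j" "j < k" for j
    using not_less_Least[of j exceeds] that unfolding k_def exceeds_def by auto
  have "stopped_difference \<epsilon> p l \<omega> = \<xi> l \<omega>" if "l < k" for l
    using before that \<omega> unfolding stopped_difference_def below_def by (auto simp: indicator_def)
  moreover have "stopped_difference \<epsilon> p l \<omega> = 0" if "l \<ge> k" for l
    using k that unfolding stopped_difference_def below_def exceeds_def by (auto simp: indicator_def not_less)
  ultimately have "(\<Sum>l=p..<k. stopped_difference \<epsilon> p l \<omega>) + (\<Sum>l=k..<m. stopped_difference \<epsilon> p l \<omega>) = block_sum p k \<omega>"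
    unfolding block_sum_def by simp
  moreover have "(\<Sum>l=p..<k. stopped_difference \<epsilon> p l \<omega>) + (\<Sum>l=k..<m. stopped_difference \<epsilon> p l \<omega>)
      = (\<Sum>l=p..<m. stopped_difference \<epsilon> p l \<omega>)"
    using k unfolding exceeds_def by (intro sum.atLeastLessThan_concat) auto
  ultimately show ?thesis using k(1) unfolding exceeds_def by simp
qed

theorem maximal_inequality:
  assumes \<epsilon>: "\<epsilon> > 0"
  shows "holds_except M (4 * (\<Sum>l=p..<m. (b l)\<^sup>2)\<^sup>2 / \<epsilon> ^ 4) (\<lambda>\<omega>. \<forall>k\<in>{p..m}. \<bar>block_sum p k \<omega>\<bar> < \<epsilon>)"
proof -
  interpret stopped: bounded_martingale_differences M F "stopped_difference \<epsilon> p" b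
    by (rule stopped_martingale_differences)
  define A where "A = {\<omega> \<in> space M. stopped.block_sum p m \<omega> ^ 4 \<ge> \<epsilon> ^ 4}"
  have int: "integrable M (\<lambda>\<omega>. stopped.block_sum p m \<omega> ^ 4)"
    by (intro bounded_measurable_integrable bounded_measurable_power stopped.bounded_measurable_block_sum_M)
  have "prob A \<le> expectation (\<lambda>\<omega>. stopped.block_sum p m \<omega> ^ 4) / \<epsilon> ^ 4"
    unfolding A_def using int \<epsilon> by (intro integral_Markov_inequality_measure[where A="{}"]) auto
  also have "\<dots> \<le> 4 * (\<Sum>l=p..<m. (b l)\<^sup>2)\<^sup>2 / \<epsilon> ^ 4"
    using \<epsilon> by (intro divide_right_mono stopped.fourth_moment_le) auto
  finally have prob_A: "prob A \<le> 4 * (\<Sum>l=p..<m. (b l)\<^sup>2)\<^sup>2 / \<epsilon> ^ 4" .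
  have A_measurable: "A \<in> sets M" unfolding A_def using int by measurable
  show ?thesis
  proof (rule holds_exceptI[OF A_measurable prob_A])
    fix \<omega> assume \<omega>: "\<omega> \<in> space M" "\<omega> \<notin> A"
    have "\<epsilon> ^ 4 \<le> \<bar>stopped.block_sum p m \<omega>\<bar> ^ 4" if "\<epsilon> \<le> \<bar>stopped.block_sum p m \<omega>\<bar>"
      using that \<epsilon> by (intro power_mono) auto
    hence "\<bar>stopped.block_sum p m \<omega>\<bar> < \<epsilon>" using \<omega> unfolding A_def by (auto simp: power_even_abs not_le[symmetric])
    hence "\<omega> \<in> below \<epsilon> p m"
      using stopped_sum_exceeds[OF \<omega>(1), of \<epsilon> p m] unfolding stopped.block_sum_def by auto
    thus "\<forall>k\<in>{p..m}. \<bar>block_sum p k \<omega>\<bar> < \<epsilon>" unfolding below_def by simp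
  qed
qed

end

section \<open>A functional central limit theorem for martingale arrays\<close>

lemma tendsto_by_approximation:
  fixes x :: "'b \<Rightarrow> real"
  assumes "\<And>\<epsilon>. \<epsilon> > 0 \<Longrightarrow> \<exists>y z. (\<forall>n. \<bar>x n - y n\<bar> \<le> \<epsilon>) \<and> (y \<longlongrightarrow> z) F \<and> \<bar>z - L\<bar> \<le> \<epsilon>"
  shows "(x \<longlongrightarrow> L) F"
proof (rule tendstoI)
  fix e :: real assume "e > 0"
  hence "e / 3 > 0" by simp
  from assms[OF this] obtain y z where y: "\<And>n. \<bar>x n - y n\<bar> \<le> e / 3" "(y \<longlongrightarrow> z) F" and z: "\<bar>z - L\<bar> \<le> e / 3"
    by blast
  from tendstoD[OF y(2) \<open>e / 3 > 0\<close>] show "\<forall>\<^sub>F n in F. dist (x n) L < e"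
  proof eventually_elim
    case (elim n)
    show ?case using elim y(1)[of n] z unfolding dist_real_def by linarith
  qed
qed

lemma sum_square_increments_le:
  fixes x :: "nat \<Rightarrow> real"
  assumes "\<And>j. j \<le> J \<Longrightarrow> 0 \<le> x (Suc j) - x j" "\<And>j. j \<le> J \<Longrightarrow> x (Suc j) - x j \<le> \<eta>"
  shows "(\<Sum>j\<le>J. (x (Suc j) - x j)\<^sup>2) \<le> \<eta> * (x (Suc J) - x 0)"
proof -
  have "(\<Sum>j\<le>J. (x (Suc j) - x j)\<^sup>2) \<le> (\<Sum>j\<le>J. \<eta> * (x (Suc j) - x j))"
    unfolding power2_eq_square using assms by (intro sum_mono mult_right_mono) auto
  also have "\<dots> = \<eta> * (x (Suc J) - x 0)"
    using sum_lessThan_telescope[of x "Suc J"] unfolding sum_distrib_left[symmetric] lessThan_Suc_atMost by simp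
  finally show ?thesis .
qed

lemma grid_square_sum_tendsto_zero:
  fixes Q :: "real \<Rightarrow> real"
  assumes cont: "continuous_on {0..} Q" and mono: "mono_on {0..} Q" and T: "T > 0"
  shows "(\<lambda>K. \<Sum>j\<le>nat \<lfloor>real K * T\<rfloor>. (Q (real (Suc j) / real K) - Q (real j / real K))\<^sup>2) \<longlonglongrightarrow> 0"
proof (rule tendstoI)
  fix e :: real assume e: "e > 0"
  define R where "R = Q (T + 1) - Q 0"
  have R: "R \<ge> 0" unfolding R_def using mono_onD[OF mono, of 0 "T + 1"] T by simp
  define \<eta> where "\<eta> = e / (R + 1)"
  have \<eta>: "\<eta> > 0" "\<eta> * R < e" using e R unfolding \<eta>_def by (auto simp: field_simps)
  have "uniformly_continuous_on {0..T+1} Q"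
    by (rule compact_uniformly_continuous) (auto intro: continuous_on_subset[OF cont])
  then obtain d where d: "d > 0" "\<And>s t. s \<in> {0..T+1} \<Longrightarrow> t \<in> {0..T+1} \<Longrightarrow> dist s t < d \<Longrightarrow> dist (Q s) (Q t) < \<eta>"
    unfolding uniformly_continuous_on_def using \<eta>(1) by metis
  have "\<forall>\<^sub>F K in sequentially. 1 < real K" by real_asymp
  moreover have "\<forall>\<^sub>F K in sequentially. 1 / real K < d" using d(1) by real_asymp
  ultimately show "\<forall>\<^sub>F K in sequentially.
      dist (\<Sum>j\<le>nat \<lfloor>real K * T\<rfloor>. (Q (real (Suc j) / real K) - Q (real j / real K))\<^sup>2) 0 < e"
  proof eventually_elim
    case (elim K)
    define J where "J = nat \<lfloor>real K * T\<rfloor>"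
    define t where "t = (\<lambda>j. real j / real K)"
    have "real J \<le> real K * T" unfolding J_def using T by (simp add: of_nat_floor)
    hence "real (Suc J) \<le> (T + 1) * real K" using elim(1) by (simp add: algebra_simps)
    hence last: "t (Suc J) \<le> T + 1" unfolding t_def using elim(1) by (simp add: divide_le_eq)
    have t_mono: "t j \<le> t k" if "j \<le> k" for j k unfolding t_def using that by (intro divide_right_mono) auto
    have range: "t j \<in> {0..T+1}" if "j \<le> Suc J" for j
      using t_mono[OF that] last by (simp add: t_def)
    have increment: "0 \<le> Q (t (Suc j)) - Q (t j)" "Q (t (Suc j)) - Q (t j) \<le> \<eta>" if "j \<le> J" for j
    proof -
      have "dist (t (Suc j)) (t j) < d"
        using elim unfolding t_def dist_real_def by (simp add: diff_divide_distrib[symmetric])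
      hence "dist (Q (t (Suc j))) (Q (t j)) < \<eta>" using that by (intro d(2) range) auto
      thus "Q (t (Suc j)) - Q (t j) \<le> \<eta>" by (simp add: dist_real_def)
      show "0 \<le> Q (t (Suc j)) - Q (t j)" using mono_onD[OF mono, of "t j" "t (Suc j)"] range t_mono that by simp
    qed
    have "(\<Sum>j\<le>J. (Q (t (Suc j)) - Q (t j))\<^sup>2) \<le> \<eta> * (Q (t (Suc J)) - Q (t 0))"
      by (rule sum_square_increments_le[where x="\<lambda>j. Q (t j)", OF increment])
    also have "\<dots> \<le> \<eta> * R"
      using mono_onD[OF mono, of "t (Suc J)" "T + 1"] range[of "Suc J"] last T \<eta>(1) unfolding R_def
      by (intro mult_left_mono) (auto simp: t_def)
    finally have "(\<Sum>j\<le>J. (Q (t (Suc j)) - Q (t j))\<^sup>2) < e" using \<eta>(2) by linarith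
    moreover have "0 \<le> (\<Sum>j\<le>J. (Q (t (Suc j)) - Q (t j))\<^sup>2)" by (intro sum_nonneg) simp
    ultimately show ?case unfolding J_def t_def by (simp add: dist_real_def)
  qed
qed

lemma mono_less_iff_threshold:
  fixes \<kappa> :: "nat \<Rightarrow> nat"
  assumes "mono \<kappa>" "k < \<kappa> J"
  shows "\<exists>i\<le>J. \<forall>j. k < \<kappa> j \<longleftrightarrow> i \<le> j"
proof -
  define i where "i = (LEAST j. k < \<kappa> j)"
  have "k < \<kappa> i" "i \<le> J" unfolding i_def using assms(2) by (auto intro: LeastI Least_le)
  moreover have "i \<le> j" if "k < \<kappa> j" for j unfolding i_def using that by (rule Least_le)
  ultimately show ?thesis using monoD[OF assms(1)] by (meson less_le_trans)
qed

locale martingale_array = prob_space M for M :: "'a measure" +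
  fixes F :: "nat \<Rightarrow> nat \<Rightarrow> 'a measure" and \<xi> :: "nat \<Rightarrow> nat \<Rightarrow> 'a \<Rightarrow> real"
    and b v d :: "nat \<Rightarrow> nat \<Rightarrow> real" and \<kappa> :: "nat \<Rightarrow> real \<Rightarrow> nat" and V Q :: "real \<Rightarrow> real"
  assumes differences: "\<And>n. bounded_martingale_differences M (F n) (\<xi> n) (b n)"
    and conditional_variance: "\<And>n k g B. bounded_measurable M (F n k) g \<Longrightarrow> (\<And>\<omega>. \<omega> \<in> space M \<Longrightarrow> \<bar>g \<omega>\<bar> \<le> B) \<Longrightarrow>
      \<bar>expectation (\<lambda>\<omega>. g \<omega> * ((\<xi> n k \<omega>)\<^sup>2 - v n k))\<bar> \<le> B * d n k"
    and v_nonneg: "\<And>n k. 0 \<le> v n k" and v_le: "\<And>n k. v n k \<le> (b n k)\<^sup>2"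
    and \<kappa>_mono: "\<And>n s t. s \<le> t \<Longrightarrow> \<kappa> n s \<le> \<kappa> n t"
    and variance_limit: "\<And>t. t \<ge> 0 \<Longrightarrow> (\<lambda>n. \<Sum>l<\<kappa> n t. v n l) \<longlonglongrightarrow> V t"
    and square_limit: "\<And>t. t \<ge> 0 \<Longrightarrow> (\<lambda>n. \<Sum>l<\<kappa> n t. (b n l)\<^sup>2) \<longlonglongrightarrow> Q t"
    and error_limit: "\<And>t. t \<ge> 0 \<Longrightarrow> (\<lambda>n. \<Sum>l<\<kappa> n t. d n l) \<longlonglongrightarrow> 0"
    and cube_limit: "\<And>t. t \<ge> 0 \<Longrightarrow> (\<lambda>n. \<Sum>l<\<kappa> n t. (b n l) ^ 3) \<longlonglongrightarrow> 0"
    and V_continuous: "continuous_on {0..} V" and Q_continuous: "continuous_on {0..} Q"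
begin

definition partial_sum :: "nat \<Rightarrow> real \<Rightarrow> 'a \<Rightarrow> real" where
  "partial_sum n t \<omega> = (\<Sum>l<\<kappa> n t. \<xi> n l \<omega>)"

lemma b_nonneg: "0 \<le> b n l"
  by (rule bounded_martingale_differences.bound_nonneg[OF differences])

lemma \<xi>_measurable: "\<xi> n l \<in> borel_measurable M"
  by (rule bounded_measurable_measurable[OF bounded_martingale_differences.bounded_measurable_difference_M[OF differences]])

lemma partial_sum_measurable: "partial_sum n t \<in> borel_measurable M"
  unfolding partial_sum_def by (intro borel_measurable_sum \<xi>_measurable)

lemma V_nonneg: "t \<ge> 0 \<Longrightarrow> 0 \<le> V t"
  by (rule LIMSEQ_le_const[OF variance_limit]) (auto intro!: sum_nonneg v_nonneg)

lemma Q_mono: "mono_on {0..} Q"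
proof (rule mono_onI)
  fix s t :: real assume "s \<in> {0..}" "t \<in> {0..}" "s \<le> t"
  thus "Q s \<le> Q t"
    by (intro LIMSEQ_le[OF square_limit square_limit]) (auto intro!: exI[of _ 0] sum_mono2 \<kappa>_mono)
qed

context
  fixes P :: "'b measure" and W :: "real \<Rightarrow> 'b \<Rightarrow> real"
  assumes W: "brownian_motion P W"
begin

interpretation P: prob_space P by (rule brownian_motion_prob_space[OF W])

lemma lindeberg_error:
  fixes t :: "nat \<Rightarrow> real"
  assumes t: "mono t" "\<And>j. t j \<le> t J" and h: "bounded_Lipschitz J h"
    and smooth: "\<And>i. i \<le> J \<Longrightarrow> \<exists>h1 h2. smooth_along J C (\<lambda>j. of_bool (i \<le> j)) h h1 h2"
  shows "\<bar>expectation (\<lambda>\<omega>. h (\<lambda>j. partial_sum n (t j) \<omega>)) - (\<integral>\<omega>. h (\<lambda>j. W (\<Sum>l<\<kappa> n (t j). v n l) \<omega>) \<partial>P)\<bar>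
    \<le> C * (\<Sum>k<\<kappa> n (t J). d n k + 3 * b n k ^ 3)"
proof -
  interpret rows: bounded_martingale_differences M "F n" "\<xi> n" "b n" by (rule differences)
  have stopped: "bounded_measurable M (F n k) (\<lambda>\<omega>. g (\<lambda>j. \<Sum>l<min k (\<kappa> n (t j)). \<xi> n l \<omega>))"
    if "bounded_Lipschitz J g" for g k
    by (intro bounded_measurable_bounded_Lipschitz[OF that] borel_measurable_sum rows.adapted) auto
  interpret lindeberg: lindeberg_replacement M P W "\<xi> n" "b n" "v n" "d n" "\<lambda>j. \<kappa> n (t j)" J
  proof unfold_locales
    show "\<kappa> n (t j) \<le> \<kappa> n (t J)" for j by (intro \<kappa>_mono t)
    show "expectation (\<lambda>\<omega>. g (\<lambda>j. \<Sum>l<min k (\<kappa> n (t j)). \<xi> n l \<omega>) * \<xi> n k \<omega>) = 0"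
      if "bounded_Lipschitz J g" for k g
      by (rule rows.orthogonal[OF stopped[OF that]])
    show "\<bar>expectation (\<lambda>\<omega>. g (\<lambda>j. \<Sum>l<min k (\<kappa> n (t j)). \<xi> n l \<omega>) * ((\<xi> n k \<omega>)\<^sup>2 - v n k))\<bar> \<le> B * d n k"
      if "bounded_Lipschitz J g" "\<And>x. \<bar>g x\<bar> \<le> B" for k g B
      by (rule conditional_variance[OF stopped[OF that(1)] that(2)])
  qed (auto intro: W \<xi>_measurable rows.bounded v_nonneg)
  have "\<exists>h1 h2. smooth_along J C (lindeberg.active k) h h1 h2" if "k < \<kappa> n (t J)" for k
  proof -
    have "mono (\<lambda>j. \<kappa> n (t j))" by (intro monoI \<kappa>_mono monoD[OF t(1)])
    from mono_less_iff_threshold[OF this that] obtain i where "i \<le> J" "\<And>j. k < \<kappa> n (t j) \<longleftrightarrow> i \<le> j" by blast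
    thus ?thesis using smooth[of i] unfolding lindeberg.active_def by simp
  qed
  from lindeberg.lindeberg_bound[OF h this]
  have bound: "\<bar>expectation (\<lambda>\<omega>. h (\<lambda>j. partial_sum n (t j) \<omega>)) - (\<integral>\<omega>. h (\<lambda>j. W (\<Sum>l<\<kappa> n (t j). v n l) \<omega>) \<partial>P)\<bar>
    \<le> C * (\<Sum>k<\<kappa> n (t J). d n k + b n k ^ 3 + 2 * sqrt (v n k) ^ 3)"
    unfolding partial_sum_def .
  have "sqrt (v n k) ^ 3 \<le> b n k ^ 3" for k
    using real_sqrt_le_mono[OF v_le[of n k]] b_nonneg[of n k] v_nonneg[of n k] by (intro power_mono) auto
  hence "(\<Sum>k<\<kappa> n (t J). d n k + b n k ^ 3 + 2 * sqrt (v n k) ^ 3) \<le> (\<Sum>k<\<kappa> n (t J). d n k + 3 * b n k ^ 3)"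
    by (intro sum_mono) (simp add: algebra_simps)
  moreover have "C \<ge> 0" using smooth[of 0] by (auto dest: smooth_alongD(6))
  ultimately show ?thesis using bound by (meson mult_left_mono order_trans)
qed

lemma expectation_brownian_clock_tendsto:
  fixes t :: "nat \<Rightarrow> real"
  assumes t: "\<And>j. t j \<ge> 0" and h: "bounded_Lipschitz J h"
  shows "(\<lambda>n. \<integral>\<omega>. h (\<lambda>j. W (\<Sum>l<\<kappa> n (t j). v n l) \<omega>) \<partial>P) \<longlonglongrightarrow> (\<integral>\<omega>. h (\<lambda>j. W (V (t j)) \<omega>) \<partial>P)"
proof -
  obtain B where B: "\<And>x. \<bar>h x\<bar> \<le> B" using bounded_Lipschitz_bounded[OF h] by blast
  have v_sum_nonneg: "0 \<le> (\<Sum>l<\<kappa> n (t j). v n l)" for n j by (intro sum_nonneg v_nonneg)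
  show ?thesis
  proof (rule integral_dominated_convergence[where w="\<lambda>_. B"])
    show "(\<lambda>\<omega>. h (\<lambda>j. W (V (t j)) \<omega>)) \<in> borel_measurable P"
      by (intro bounded_Lipschitz_measurable[OF h] brownian_motion_measurable[OF W] V_nonneg t)
    show "(\<lambda>\<omega>. h (\<lambda>j. W (\<Sum>l<\<kappa> n (t j). v n l) \<omega>)) \<in> borel_measurable P" for n
      by (intro bounded_Lipschitz_measurable[OF h] brownian_motion_measurable[OF W] v_sum_nonneg)
    show "AE \<omega> in P. norm (h (\<lambda>j. W (\<Sum>l<\<kappa> n (t j). v n l) \<omega>)) \<le> B" for n using B by simp
    show "AE \<omega> in P. (\<lambda>n. h (\<lambda>j. W (\<Sum>l<\<kappa> n (t j). v n l) \<omega>)) \<longlonglongrightarrow> h (\<lambda>j. W (V (t j)) \<omega>)"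
    proof (intro AE_I2 bounded_Lipschitz_tendsto[OF h])
      fix \<omega> j assume "\<omega> \<in> space P"
      thus "(\<lambda>n. W (\<Sum>l<\<kappa> n (t j). v n l) \<omega>) \<longlonglongrightarrow> W (V (t j)) \<omega>"
        by (intro continuous_on_tendsto_compose[OF brownian_motion_continuous[OF W]] variance_limit t)
          (auto intro!: always_eventually V_nonneg t v_sum_nonneg)
    qed
  qed simp
qed

lemma smooth_finite_dimensional_limit:
  fixes t :: "nat \<Rightarrow> real"
  assumes t: "mono t" "0 \<le> t 0" "\<And>j. t j \<le> t J" and h: "bounded_Lipschitz J h"
    and smooth: "\<And>i. i \<le> J \<Longrightarrow> \<exists>h1 h2. smooth_along J C (\<lambda>j. of_bool (i \<le> j)) h h1 h2"
  shows "(\<lambda>n. expectation (\<lambda>\<omega>. h (\<lambda>j. partial_sum n (t j) \<omega>))) \<longlonglongrightarrow> (\<integral>\<omega>. h (\<lambda>j. W (V (t j)) \<omega>) \<partial>P)"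
proof -
  have t_nonneg: "t j \<ge> 0" for j using t(2) monoD[OF t(1), of 0 j] by simp
  have "(\<lambda>n. C * ((\<Sum>k<\<kappa> n (t J). d n k) + 3 * (\<Sum>k<\<kappa> n (t J). b n k ^ 3))) \<longlonglongrightarrow> C * (0 + 3 * 0)"
    by (intro tendsto_intros error_limit cube_limit t_nonneg)
  hence "(\<lambda>n. C * (\<Sum>k<\<kappa> n (t J). d n k + 3 * b n k ^ 3)) \<longlonglongrightarrow> 0"
    by (simp add: sum.distrib sum_distrib_left)
  hence "(\<lambda>n. expectation (\<lambda>\<omega>. h (\<lambda>j. partial_sum n (t j) \<omega>)) - (\<integral>\<omega>. h (\<lambda>j. W (\<Sum>l<\<kappa> n (t j). v n l) \<omega>) \<partial>P)) \<longlonglongrightarrow> 0"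
    by (rule Lim_null_comparison[rotated]) (use lindeberg_error[OF t(1,3) h smooth] in simp)
  from tendsto_add[OF this expectation_brownian_clock_tendsto[where t=t, OF t_nonneg h]] show ?thesis by simp
qed

lemma finite_dimensional_limit:
  fixes t :: "nat \<Rightarrow> real"
  assumes t: "mono t" "0 \<le> t 0" and h: "bounded_Lipschitz J h"
  shows "(\<lambda>n. expectation (\<lambda>\<omega>. h (\<lambda>j. partial_sum n (t j) \<omega>))) \<longlonglongrightarrow> (\<integral>\<omega>. h (\<lambda>j. W (V (t j)) \<omega>) \<partial>P)"
proof -
  define s where "s = (\<lambda>j. t (min j J))"
  have s: "mono s" "0 \<le> s 0" "\<And>j. s j \<le> s J"
    unfolding s_def using t by (auto intro!: monoI monoD[OF t(1)] min.mono)
  have s_nonneg: "0 \<le> s j" for j using s(2) monoD[OF s(1), of 0 j] by simp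
  have "(\<lambda>n. expectation (\<lambda>\<omega>. h (\<lambda>j. partial_sum n (s j) \<omega>))) \<longlonglongrightarrow> (\<integral>\<omega>. h (\<lambda>j. W (V (s j)) \<omega>) \<partial>P)"
  proof (rule tendsto_by_approximation)
    fix \<epsilon> :: real assume "\<epsilon> > 0"
    have "\<bar>of_bool (i \<le> j) :: real\<bar> \<le> 1" for i j :: nat by simp
    from smooth_approximation[where e="\<lambda>i j. of_bool (i \<le> j)" and m="Suc J", OF h this \<open>\<epsilon> > 0\<close>]
    obtain g C where g: "bounded_Lipschitz J g" and close: "\<And>x. \<bar>g x - h x\<bar> \<le> \<epsilon>"
      and smooth: "\<And>i. i \<le> J \<Longrightarrow> \<exists>h1 h2. smooth_along J C (\<lambda>j. of_bool (i \<le> j)) g h1 h2"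
      by (auto simp: less_Suc_eq_le)
    have sums_close: "\<bar>expectation (\<lambda>\<omega>. h (\<lambda>j. partial_sum n (s j) \<omega>))
        - expectation (\<lambda>\<omega>. g (\<lambda>j. partial_sum n (s j) \<omega>))\<bar> \<le> \<epsilon>" for n
      using close by (intro abs_expectation_diff_le bounded_Lipschitz_integrable[OF h]
          bounded_Lipschitz_integrable[OF g] partial_sum_measurable) (simp add: abs_minus_commute)
    have limits_close: "\<bar>(\<integral>\<omega>. g (\<lambda>j. W (V (s j)) \<omega>) \<partial>P) - (\<integral>\<omega>. h (\<lambda>j. W (V (s j)) \<omega>) \<partial>P)\<bar> \<le> \<epsilon>"
      by (intro P.abs_expectation_diff_le P.bounded_Lipschitz_integrable[OF h] P.bounded_Lipschitz_integrable[OF g]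
          brownian_motion_measurable[OF W] V_nonneg s_nonneg close)
    have limit: "(\<lambda>n. expectation (\<lambda>\<omega>. g (\<lambda>j. partial_sum n (s j) \<omega>))) \<longlonglongrightarrow> (\<integral>\<omega>. g (\<lambda>j. W (V (s j)) \<omega>) \<partial>P)"
      by (rule smooth_finite_dimensional_limit[OF s g smooth])
    show "\<exists>y z. (\<forall>n. \<bar>expectation (\<lambda>\<omega>. h (\<lambda>j. partial_sum n (s j) \<omega>)) - y n\<bar> \<le> \<epsilon>) \<and> y \<longlonglongrightarrow> z \<and>
        \<bar>z - (\<integral>\<omega>. h (\<lambda>j. W (V (s j)) \<omega>) \<partial>P)\<bar> \<le> \<epsilon>"
      by (intro exI conjI allI) (rule sums_close limit limits_close)+
  qed
  thus ?thesis
    unfolding s_def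
    using bounded_Lipschitz_truncate[OF h, of "\<lambda>j. partial_sum _ (t j) _"]
      bounded_Lipschitz_truncate[OF h, of "\<lambda>j. W (V (t j)) _"]
    by simp
qed

end

lemma increment_maximal_inequality:
  assumes "s \<le> t" "\<epsilon> > 0"
  shows "holds_except M (4 * ((\<Sum>l<\<kappa> n t. (b n l)\<^sup>2) - (\<Sum>l<\<kappa> n s. (b n l)\<^sup>2))\<^sup>2 / \<epsilon> ^ 4)
    (\<lambda>\<omega>. \<forall>u\<in>{s..t}. \<bar>partial_sum n u \<omega> - partial_sum n s \<omega>\<bar> < \<epsilon>)"
proof -
  interpret rows: bounded_martingale_differences M "F n" "\<xi> n" "b n" by (rule differences)
  have split: "(\<Sum>l=\<kappa> n s..<\<kappa> n u. f l) = (\<Sum>l<\<kappa> n u. f l) - (\<Sum>l<\<kappa> n s. f l)" if "s \<le> u" for u and f :: "nat \<Rightarrow> real"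
    using sum_diff_nat_ivl[OF le0 \<kappa>_mono[OF that], of f] by (simp add: atLeast0LessThan)
  show ?thesis
  proof (rule holds_except_mono[OF rows.maximal_inequality[OF \<open>\<epsilon> > 0\<close>, of "\<kappa> n s" "\<kappa> n t"]])
    fix \<omega> assume below: "\<forall>k\<in>{\<kappa> n s..\<kappa> n t}. \<bar>rows.block_sum (\<kappa> n s) k \<omega>\<bar> < \<epsilon>"
    show "\<forall>u\<in>{s..t}. \<bar>partial_sum n u \<omega> - partial_sum n s \<omega>\<bar> < \<epsilon>"
    proof
      fix u assume u: "u \<in> {s..t}"
      hence "\<bar>rows.block_sum (\<kappa> n s) (\<kappa> n u) \<omega>\<bar> < \<epsilon>" using bspec[OF below, of "\<kappa> n u"] by (simp add: \<kappa>_mono)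
      thus "\<bar>partial_sum n u \<omega> - partial_sum n s \<omega>\<bar> < \<epsilon>"
        unfolding rows.block_sum_def partial_sum_def using u by (simp add: split)
    qed
  qed (simp add: split[OF \<open>s \<le> t\<close>])
qed

lemma partial_sums_tight:
  assumes "T > 0" "\<delta> > 0"
  shows "\<exists>\<Lambda>>0. \<forall>\<^sub>F n in sequentially. holds_except M \<delta> (\<lambda>\<omega>. \<forall>t\<in>{0..T}. \<bar>partial_sum n t \<omega>\<bar> \<le> \<Lambda>)"
proof -
  have "(\<lambda>m. 4 * (Q T + 1)\<^sup>2 / real m ^ 4) \<longlonglongrightarrow> 0" by real_asymp
  hence "\<forall>\<^sub>F m in sequentially. 4 * (Q T + 1)\<^sup>2 / real m ^ 4 < \<delta>" using \<open>\<delta> > 0\<close> by (rule order_tendstoD)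
  from eventually_happens'[OF sequentially_bot eventually_conj[OF this eventually_gt_at_top[of 0]]]
  obtain m :: nat where m: "4 * (Q T + 1)\<^sup>2 / real m ^ 4 < \<delta>" "m > 0" by blast
  define \<Lambda> where "\<Lambda> = real m"
  have \<Lambda>: "\<Lambda> > 0" "4 * (Q T + 1)\<^sup>2 / \<Lambda> ^ 4 < \<delta>" using m unfolding \<Lambda>_def by simp_all
  have "\<forall>\<^sub>F n in sequentially. (\<Sum>l<\<kappa> n T. (b n l)\<^sup>2) < Q T + 1"
    by (rule order_tendstoD[OF square_limit]) (use \<open>T > 0\<close> in auto)
  hence "\<forall>\<^sub>F n in sequentially. holds_except M \<delta> (\<lambda>\<omega>. \<forall>t\<in>{0..T}. \<bar>partial_sum n t \<omega>\<bar> \<le> \<Lambda>)"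
  proof eventually_elim
    case (elim n)
    interpret rows: bounded_martingale_differences M "F n" "\<xi> n" "b n" by (rule differences)
    have "(\<Sum>l=0..<\<kappa> n T. (b n l)\<^sup>2)\<^sup>2 \<le> (Q T + 1)\<^sup>2"
      using elim by (intro power_mono) (auto simp: atLeast0LessThan intro: sum_nonneg)
    hence "4 * (\<Sum>l=0..<\<kappa> n T. (b n l)\<^sup>2)\<^sup>2 / \<Lambda> ^ 4 \<le> 4 * (Q T + 1)\<^sup>2 / \<Lambda> ^ 4"
      by (intro divide_right_mono mult_left_mono) auto
    hence "4 * (\<Sum>l=0..<\<kappa> n T. (b n l)\<^sup>2)\<^sup>2 / \<Lambda> ^ 4 \<le> \<delta>" using \<Lambda>(2) by linarith
    thus ?case
    proof (rule holds_except_mono[OF rows.maximal_inequality[OF \<Lambda>(1), of 0 "\<kappa> n T"]])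
      fix \<omega> assume below: "\<forall>k\<in>{0..\<kappa> n T}. \<bar>rows.block_sum 0 k \<omega>\<bar> < \<Lambda>"
      have "\<bar>partial_sum n t \<omega>\<bar> < \<Lambda>" if "t \<in> {0..T}" for t
        using bspec[OF below, of "\<kappa> n t"] that
        by (simp add: \<kappa>_mono partial_sum_def rows.block_sum_def atLeast0LessThan)
      thus "\<forall>t\<in>{0..T}. \<bar>partial_sum n t \<omega>\<bar> \<le> \<Lambda>" by (auto intro: less_imp_le)
    qed
  qed
  thus ?thesis using \<Lambda>(1) by blast
qed

lemma grid_cell_property:
  assumes cells: "\<forall>j\<in>{..nat \<lfloor>real K * T\<rfloor>}. \<forall>u\<in>{real j / real K..real (Suc j) / real K}. R (real j / real K) u"
    and K: "K > 0" and u: "u \<in> {0..T}"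
  shows "R (grid_floor K u) u"
proof -
  define j where "j = nat \<lfloor>real K * u\<rfloor>"
  have "j \<in> {..nat \<lfloor>real K * T\<rfloor>}" unfolding j_def using u by (simp add: nat_mono floor_mono mult_left_mono)
  moreover have "u \<in> {real j / real K..real (Suc j) / real K}"
    using grid_floor_le[of u K] less_grid_floor_add[OF K, of u] u
    unfolding j_def grid_floor_def by (simp add: add_divide_distrib)
  ultimately show ?thesis using cells unfolding grid_floor_def j_def[symmetric] by blast
qed

lemma grid_oscillation:
  assumes T: "T > 0" and \<epsilon>: "\<epsilon> > 0" and \<delta>: "\<delta> > 0"
  shows "\<forall>\<^sub>F K in sequentially. \<forall>\<^sub>F n in sequentially.
    holds_except M \<delta> (\<lambda>\<omega>. \<forall>t\<in>{0..T}. \<bar>partial_sum n t \<omega> - partial_sum n (grid_floor K t) \<omega>\<bar> \<le> \<epsilon>)"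
proof -
  have "\<forall>\<^sub>F K in sequentially.
      (\<Sum>j\<le>nat \<lfloor>real K * T\<rfloor>. (Q (real (Suc j) / real K) - Q (real j / real K))\<^sup>2) < \<delta> * \<epsilon> ^ 4 / 4"
    by (rule order_tendstoD[OF grid_square_sum_tendsto_zero[OF Q_continuous Q_mono T]]) (use \<epsilon> \<delta> in simp)
  thus ?thesis using eventually_gt_at_top[of 0]
  proof eventually_elim
    case (elim K)
    define J where "J = nat \<lfloor>real K * T\<rfloor>"
    define t where "t = (\<lambda>j. real j / real K)"
    define S where "S = (\<lambda>n j. \<Sum>l<\<kappa> n (t j). (b n l)\<^sup>2)"
    have "(\<lambda>n. \<Sum>j\<le>J. (S n (Suc j) - S n j)\<^sup>2) \<longlonglongrightarrow> (\<Sum>j\<le>J. (Q (t (Suc j)) - Q (t j))\<^sup>2)"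
      unfolding S_def by (intro tendsto_intros square_limit) (simp_all add: t_def)
    hence "\<forall>\<^sub>F n in sequentially. (\<Sum>j\<le>J. (S n (Suc j) - S n j)\<^sup>2) < \<delta> * \<epsilon> ^ 4 / 4"
      by (rule order_tendstoD) (use elim(1) in \<open>simp add: J_def t_def\<close>)
    thus ?case
    proof eventually_elim
      case (elim n)
      have "holds_except M (\<Sum>j\<le>J. 4 * (S n (Suc j) - S n j)\<^sup>2 / \<epsilon> ^ 4)
          (\<lambda>\<omega>. \<forall>j\<in>{..J}. \<forall>u\<in>{t j..t (Suc j)}. \<bar>partial_sum n u \<omega> - partial_sum n (t j) \<omega>\<bar> < \<epsilon>)"
        unfolding S_def
        by (intro holds_except_ball increment_maximal_inequality \<epsilon>) (auto simp: t_def intro: divide_right_mono)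
      moreover have "(\<Sum>j\<le>J. 4 * (S n (Suc j) - S n j)\<^sup>2 / \<epsilon> ^ 4) \<le> \<delta>"
        using elim \<epsilon> unfolding sum_divide_distrib[symmetric] sum_distrib_left[symmetric] by (simp add: field_simps)
      ultimately show ?case
      proof (rule holds_except_mono)
        fix \<omega> assume oscillation: "\<forall>j\<in>{..J}. \<forall>u\<in>{t j..t (Suc j)}. \<bar>partial_sum n u \<omega> - partial_sum n (t j) \<omega>\<bar> < \<epsilon>"
        show "\<forall>u\<in>{0..T}. \<bar>partial_sum n u \<omega> - partial_sum n (grid_floor K u) \<omega>\<bar> \<le> \<epsilon>"
          using grid_cell_property[OF oscillation[unfolded J_def t_def] \<open>0 < K\<close>] by (auto intro: less_imp_le)
      qed
    qed
  qed
qed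

theorem functional_central_limit_theorem:
  assumes W: "brownian_motion P W"
    and X_measurable: "\<And>f. sk_test f \<Longrightarrow> \<forall>\<^sub>F n in sequentially. (\<lambda>\<omega>. f (X n \<omega>)) \<in> borel_measurable M"
    and X_cadlag: "\<forall>\<^sub>F n in sequentially. \<forall>\<omega>\<in>space M. cadlag (X n \<omega>)"
    and X_close: "\<And>T \<epsilon> \<delta>. T > 0 \<Longrightarrow> \<epsilon> > 0 \<Longrightarrow> \<delta> > 0 \<Longrightarrow> \<forall>\<^sub>F n in sequentially.
      holds_except M \<delta> (\<lambda>\<omega>. \<forall>t\<in>{0..T}. \<bar>X n \<omega> t - partial_sum n t \<omega>\<bar> \<le> \<epsilon>)"
  shows "sk_conv_dist M X P (\<lambda>\<omega> t. W (V t) \<omega>)"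
proof -
  interpret P: prob_space P by (rule brownian_motion_prob_space[OF W])
  interpret skorohod_limit_criterion M P X "\<lambda>n \<omega> t. partial_sum n t \<omega>" "\<lambda>\<omega> t. W (V t) \<omega>"
  proof unfold_locales
    show "(\<lambda>\<omega>. W (V t) \<omega>) \<in> borel_measurable P" if "t \<ge> 0" for t
      by (intro brownian_motion_measurable[OF W] V_nonneg that)
    show "continuous_on {0..} (\<lambda>t. W (V t) \<omega>)" if "\<omega> \<in> space P" for \<omega>
      by (rule continuous_on_compose2[OF brownian_motion_continuous[OF W that] V_continuous]) (auto intro: V_nonneg)
    show "(\<lambda>n. expectation (\<lambda>\<omega>. h (\<lambda>j. partial_sum n (real j / real K) \<omega>)))
        \<longlonglongrightarrow> (\<integral>\<omega>. h (\<lambda>j. W (V (real j / real K)) \<omega>) \<partial>P)" if "bounded_Lipschitz J h" for K J h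
      by (rule finite_dimensional_limit[OF W _ _ that]) (auto intro!: monoI divide_right_mono)
    fix T \<epsilon> \<delta> :: real assume pos: "T > 0" "\<epsilon> > 0" "\<delta> > 0"
    hence half: "\<epsilon> / 2 > 0" "\<delta> / 2 > 0" by simp_all
    show "\<forall>\<^sub>F K in sequentially. \<forall>\<^sub>F n in sequentially.
      holds_except M \<delta> (\<lambda>\<omega>. \<forall>t\<in>{0..T}. \<bar>X n \<omega> t - partial_sum n (grid_floor K t) \<omega>\<bar> \<le> \<epsilon>)"
      using grid_oscillation[OF pos(1) half]
    proof eventually_elim
      case (elim K)
      thus ?case using X_close[OF pos(1) half]
      proof eventually_elim
        case (elim n)
        show ?case by (rule holds_except_triangle[OF elim(2,1)])
      qed
    qed
  qed (use X_measurable X_cadlag in \<open>auto intro: partial_sum_measurable\<close>)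
  show ?thesis by (rule weak_convergence)
qed

end

section \<open>Perturbed contractions\<close>

lemma exp_recursion_le:
  fixes z d :: "nat \<Rightarrow> real"
  assumes "\<And>n. n \<ge> m \<Longrightarrow> z (Suc n) \<le> exp (- d n) * z n" and "n \<ge> m"
  shows "z n \<le> z m * exp (\<Sum>k<m. d k) * exp (- (\<Sum>k<n. d k))"
  using \<open>n \<ge> m\<close>
proof (induction n rule: dec_induct)
  case base
  show ?case by (simp add: mult.assoc exp_add[symmetric])
next
  case (step n)
  have "z (Suc n) \<le> exp (- d n) * (z m * exp (\<Sum>k<m. d k) * exp (- (\<Sum>k<n. d k)))"
    by (rule order_trans[OF assms(1)[OF step(1)] mult_left_mono[OF step.IH]]) simp
  thus ?case using exp_add[of "- d n" "- (\<Sum>k<n. d k)"] by (simp add: algebra_simps)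
qed

lemma contraction_tendsto_zero:
  fixes y d e :: "nat \<Rightarrow> real"
  assumes y: "\<And>n. y n \<ge> 0" and rec: "\<forall>\<^sub>F n in sequentially. y (Suc n) \<le> (1 - d n) * y n + e n"
    and d: "\<forall>\<^sub>F n in sequentially. 0 < d n \<and> d n \<le> 1" "filterlim (\<lambda>n. \<Sum>k<n. d k) at_top sequentially"
    and e: "(\<lambda>n. e n / d n) \<longlonglongrightarrow> 0"
  shows "y \<longlonglongrightarrow> 0"
proof (rule tendstoI)
  fix a :: real assume "a > 0"
  define \<epsilon> where "\<epsilon> = a / 2"
  have \<epsilon>: "\<epsilon> > 0" using \<open>a > 0\<close> unfolding \<epsilon>_def by simp
  define z where "z = (\<lambda>n. max (y n - \<epsilon>) 0)"
  have "\<forall>\<^sub>F n in sequentially. e n / d n < \<epsilon>" by (rule order_tendstoD(2)[OF e \<epsilon>])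
  with rec d(1) have "\<forall>\<^sub>F n in sequentially. z (Suc n) \<le> exp (- d n) * z n"
  proof eventually_elim
    case (elim n)
    have "e n \<le> \<epsilon> * d n" using elim by (simp add: field_simps)
    hence "y (Suc n) - \<epsilon> \<le> (1 - d n) * (y n - \<epsilon>)" using elim by (simp add: algebra_simps)
    also have "\<dots> \<le> (1 - d n) * z n" using elim unfolding z_def by (intro mult_left_mono) auto
    finally have "z (Suc n) \<le> (1 - d n) * z n" using elim unfolding z_def by (simp add: mult_nonneg_nonneg)
    also have "\<dots> \<le> exp (- d n) * z n"
      using exp_ge_add_one_self[of "- d n"] unfolding z_def by (intro mult_right_mono) auto
    finally show ?case .
  qed
  then obtain n0 where n0: "\<And>n. n \<ge> n0 \<Longrightarrow> z (Suc n) \<le> exp (- d n) * z n" by (auto simp: eventually_sequentially)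
  define C where "C = z n0 * exp (\<Sum>k<n0. d k)"
  have "(\<lambda>n. C * exp (- (\<Sum>k<n. d k))) \<longlonglongrightarrow> C * 0"
    by (intro tendsto_mult tendsto_const filterlim_compose[OF exp_at_bot]
      filterlim_compose[OF filterlim_uminus_at_bot_at_top d(2)])
  hence "\<forall>\<^sub>F n in sequentially. C * exp (- (\<Sum>k<n. d k)) < \<epsilon>" by (rule order_tendstoD) (use \<epsilon> in simp)
  thus "\<forall>\<^sub>F n in sequentially. dist (y n) 0 < a" using eventually_ge_at_top[of n0]
  proof eventually_elim
    case (elim n)
    have "z n < \<epsilon>" using exp_recursion_le[where z=z and d=d, OF n0 elim(2)] elim(1) unfolding C_def by linarith
    hence "y n < 2 * \<epsilon>" unfolding z_def by simp
    thus ?case using y[of n] unfolding \<epsilon>_def by (simp add: dist_real_def)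
  qed
qed

lemma powr_rate_tendsto_zero:
  assumes "(\<lambda>n. real n powr \<gamma> * d n) \<longlonglongrightarrow> \<theta>" "\<gamma> > 0"
  shows "d \<longlonglongrightarrow> 0"
proof -
  have "filterlim (\<lambda>n. real n powr \<gamma>) at_infinity sequentially"
    using \<open>\<gamma> > 0\<close> by real_asymp
  from tendsto_divide_0[OF assms(1) this] show ?thesis
    by (rule Lim_transform_eventually) (rule eventually_sequentiallyI[of 1], simp)
qed

lemma powr_rate_sum_at_top:
  assumes d: "(\<lambda>n. real n powr \<gamma> * d n) \<longlonglongrightarrow> \<theta>" and \<theta>: "\<theta> > 0" and \<gamma>: "\<gamma> \<le> 1"
  shows "filterlim (\<lambda>n. \<Sum>k<n. d k) at_top sequentially"
proof -
  have "\<forall>\<^sub>F n in sequentially. \<theta> / 2 < real n powr \<gamma> * d n" by (rule order_tendstoD[OF d]) (use \<theta> in simp)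
  hence "\<forall>\<^sub>F n in sequentially. \<theta> / 2 * inverse (real (Suc n)) \<le> d n" using eventually_ge_at_top[of 1]
  proof eventually_elim
    case (elim n)
    have "0 < real n powr \<gamma> * d n" using elim(1) \<theta> by linarith
    hence d_pos: "0 < d n" using elim(2) by (simp add: zero_less_mult_iff)
    have "real n powr \<gamma> \<le> real n" using powr_mono[OF \<gamma>, of "real n"] elim(2) by simp
    also have "\<dots> \<le> real (Suc n)" by simp
    finally have "real n powr \<gamma> * d n \<le> real (Suc n) * d n" using d_pos by (intro mult_right_mono) auto
    hence "\<theta> / 2 \<le> real (Suc n) * d n" using elim(1) by linarith
    thus ?case by (simp add: field_simps)
  qed
  then obtain n0 where n0: "\<And>n. n \<ge> n0 \<Longrightarrow> \<theta> / 2 * inverse (real (Suc n)) \<le> d n" by (auto simp: eventually_sequentially)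
  define C where "C = (\<Sum>k<n0. d k) - \<theta> / 2 * harm n0"
  have lower: "C + \<theta> / 2 * harm n \<le> (\<Sum>k<n. d k)" if "n \<ge> n0" for n
    using that
  proof (induction n rule: dec_induct)
    case (step n)
    thus ?case using n0[of n] by (simp add: harm_Suc distrib_left)
  qed (simp add: C_def)
  have "filterlim (\<lambda>n. C + \<theta> / 2 * harm n) at_top sequentially"
    using \<theta> by (intro filterlim_tendsto_add_at_top[OF tendsto_const]
      filterlim_tendsto_pos_mult_at_top[OF tendsto_const _ harm_at_top]) auto
  thus ?thesis
    by (rule filterlim_at_top_mono) (rule eventually_sequentiallyI[of n0], rule lower)
qed

lemma powr_rate_ratio_tendsto:
  assumes d: "(\<lambda>n. real n powr \<gamma> * d n) \<longlonglongrightarrow> \<theta>" and e: "(\<lambda>n. real n powr \<gamma> * e n) \<longlonglongrightarrow> E" and "\<theta> \<noteq> 0"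
  shows "(\<lambda>n. e n / d n) \<longlonglongrightarrow> E / \<theta>"
  using tendsto_divide[OF e d \<open>\<theta> \<noteq> 0\<close>]
  by (rule Lim_transform_eventually) (rule eventually_sequentiallyI[of 1], simp)

lemma powr_rate_eventually_unit_interval:
  assumes d: "(\<lambda>n. real n powr \<gamma> * d n) \<longlonglongrightarrow> \<theta>" and "\<theta> > 0" "\<gamma> > 0"
  shows "\<forall>\<^sub>F n in sequentially. 0 < d n \<and> d n \<le> 1"
proof -
  have "\<forall>\<^sub>F n in sequentially. 0 < real n powr \<gamma> * d n" by (rule order_tendstoD(1)[OF d \<open>\<theta> > 0\<close>])
  moreover have "\<forall>\<^sub>F n in sequentially. d n < 1"
    by (rule order_tendstoD[OF powr_rate_tendsto_zero[OF d \<open>\<gamma> > 0\<close>]]) simp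
  ultimately show ?thesis by eventually_elim (auto simp: zero_less_mult_iff)
qed

lemma powr_contraction_tendsto_zero:
  fixes y d e :: "nat \<Rightarrow> real"
  assumes \<gamma>: "0 < \<gamma>" "\<gamma> \<le> 1" and \<theta>: "\<theta> > 0" and y: "\<And>n. y n \<ge> 0"
    and rec: "\<forall>\<^sub>F n in sequentially. y (Suc n) \<le> (1 - d n) * y n + e n"
    and d: "(\<lambda>n. real n powr \<gamma> * d n) \<longlonglongrightarrow> \<theta>" and e: "(\<lambda>n. real n powr \<gamma> * e n) \<longlonglongrightarrow> 0"
  shows "y \<longlonglongrightarrow> 0"
  using powr_rate_ratio_tendsto[OF d e] \<theta>
  by (intro contraction_tendsto_zero[OF y rec powr_rate_eventually_unit_interval[OF d \<theta> \<gamma>(1)]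
        powr_rate_sum_at_top[OF d \<theta> \<gamma>(2)]]) simp

lemma powr_recursion_tendsto:
  fixes x d e :: "nat \<Rightarrow> real"
  assumes \<gamma>: "0 < \<gamma>" "\<gamma> \<le> 1" and \<theta>: "\<theta> > 0"
    and rec: "\<forall>\<^sub>F n in sequentially. x (Suc n) = (1 - d n) * x n + e n"
    and d: "(\<lambda>n. real n powr \<gamma> * d n) \<longlonglongrightarrow> \<theta>" and e: "(\<lambda>n. real n powr \<gamma> * e n) \<longlonglongrightarrow> E"
  shows "x \<longlonglongrightarrow> E / \<theta>"
proof -
  define L where "L = E / \<theta>"
  have "(\<lambda>n. \<bar>x n - L\<bar>) \<longlonglongrightarrow> 0"
  proof (rule powr_contraction_tendsto_zero[OF \<gamma> \<theta> abs_ge_zero _ d])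
    show "\<forall>\<^sub>F n in sequentially. \<bar>x (Suc n) - L\<bar> \<le> (1 - d n) * \<bar>x n - L\<bar> + \<bar>e n - d n * L\<bar>"
      using rec powr_rate_eventually_unit_interval[OF d \<theta> \<gamma>(1)]
    proof eventually_elim
      case (elim n)
      have "x (Suc n) - L = (1 - d n) * (x n - L) + (e n - d n * L)" using elim(1) by (simp add: algebra_simps)
      thus ?case using elim(2) abs_triangle_ineq[of "(1 - d n) * (x n - L)" "e n - d n * L"] by (simp add: abs_mult)
    qed
    have "(\<lambda>n. \<bar>real n powr \<gamma> * e n - (real n powr \<gamma> * d n) * L\<bar>) \<longlonglongrightarrow> \<bar>E - \<theta> * L\<bar>"
      by (intro tendsto_intros d e)
    moreover have "\<bar>real n powr \<gamma> * e n - (real n powr \<gamma> * d n) * L\<bar> = real n powr \<gamma> * \<bar>e n - d n * L\<bar>" for n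
      unfolding mult.assoc right_diff_distrib[symmetric] abs_mult by simp
    ultimately show "(\<lambda>n. real n powr \<gamma> * \<bar>e n - d n * L\<bar>) \<longlonglongrightarrow> 0" using \<theta> by (simp add: L_def)
  qed
  thus ?thesis unfolding L_def by (simp add: tendsto_rabs_zero_iff LIM_zero_iff)
qed

section \<open>The time scale\<close>

lemma proportional_increments_uniform:
  fixes x H :: "nat \<Rightarrow> real"
  assumes H: "\<forall>\<^sub>F n in sequentially. H n < H (Suc n)"
    and ratio: "(\<lambda>n. (x (Suc n) - x n) / (H (Suc n) - H n)) \<longlonglongrightarrow> L" and \<epsilon>: "\<epsilon> > 0"
  shows "\<forall>\<^sub>F n in sequentially. \<forall>k\<ge>n. \<bar>x k - x n - L * (H k - H n)\<bar> \<le> \<epsilon> * (H k - H n)"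
proof -
  have "\<forall>\<^sub>F n in sequentially. \<bar>x (Suc n) - x n - L * (H (Suc n) - H n)\<bar> \<le> \<epsilon> * (H (Suc n) - H n)"
    using H tendstoD[OF ratio \<epsilon>]
  proof eventually_elim
    case (elim n)
    define h where "h = H (Suc n) - H n"
    have h: "h > 0" using elim(1) unfolding h_def by simp
    have "x (Suc n) - x n - L * h = ((x (Suc n) - x n) / h - L) * h" using h by (simp add: field_simps)
    also have "\<bar>\<dots>\<bar> = \<bar>(x (Suc n) - x n) / h - L\<bar> * h" using h by (simp add: abs_mult)
    also have "\<dots> \<le> \<epsilon> * h" using elim(2) h unfolding dist_real_def h_def by (intro mult_right_mono) auto
    finally show ?case unfolding h_def .
  qed
  then obtain n0 where n0: "\<And>n. n \<ge> n0 \<Longrightarrow> \<bar>x (Suc n) - x n - L * (H (Suc n) - H n)\<bar> \<le> \<epsilon> * (H (Suc n) - H n)"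
    by (auto simp: eventually_sequentially)
  have "\<bar>x k - x n - L * (H k - H n)\<bar> \<le> \<epsilon> * (H k - H n)" if "n \<ge> n0" "k \<ge> n" for n k
    using that(2)
  proof (induction k rule: dec_induct)
    case (step k)
    have "L * (H (Suc k) - H n) = L * (H k - H n) + L * (H (Suc k) - H k)"
      "\<epsilon> * (H (Suc k) - H n) = \<epsilon> * (H k - H n) + \<epsilon> * (H (Suc k) - H k)" by (simp_all add: algebra_simps)
    thus ?case using step.IH n0[of k] step.hyps that(1) by linarith
  qed simp
  thus ?thesis unfolding eventually_sequentially by blast
qed

definition powr_primitive :: "real \<Rightarrow> real \<Rightarrow> real" where
  "powr_primitive \<gamma> x = (if \<gamma> = 1 then ln x else x powr (1 - \<gamma>) / (1 - \<gamma>))"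

lemma powr_primitive_derivative:
  "x > 0 \<Longrightarrow> (powr_primitive \<gamma> has_real_derivative x powr (- \<gamma>)) (at x)"
  unfolding powr_primitive_def
  by (cases "\<gamma> = 1") (auto intro!: derivative_eq_intros simp: powr_minus_divide)

lemma powr_primitive_diff_bounds:
  assumes "\<gamma> \<ge> 0" "0 < x" "x \<le> y"
  shows "(y - x) * y powr (-\<gamma>) \<le> powr_primitive \<gamma> y - powr_primitive \<gamma> x"
    and "powr_primitive \<gamma> y - powr_primitive \<gamma> x \<le> (y - x) * x powr (-\<gamma>)"
proof -
  have "(y - x) * y powr (-\<gamma>) \<le> powr_primitive \<gamma> y - powr_primitive \<gamma> x \<and>
    powr_primitive \<gamma> y - powr_primitive \<gamma> x \<le> (y - x) * x powr (-\<gamma>)"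
  proof (cases "x = y")
    case False
    hence "x < y" using assms by simp
    then obtain z where z: "x < z" "z < y" "powr_primitive \<gamma> y - powr_primitive \<gamma> x = (y - x) * z powr (-\<gamma>)"
      using MVT2[of x y "powr_primitive \<gamma>" "\<lambda>z. z powr (-\<gamma>)"] powr_primitive_derivative assms by auto
    have "y powr (-\<gamma>) \<le> z powr (-\<gamma>)" "z powr (-\<gamma>) \<le> x powr (-\<gamma>)" using z assms by (auto intro!: powr_mono2')
    thus ?thesis unfolding z(3) using assms by (auto intro!: mult_left_mono)
  qed simp
  thus "(y - x) * y powr (-\<gamma>) \<le> powr_primitive \<gamma> y - powr_primitive \<gamma> x"
    "powr_primitive \<gamma> y - powr_primitive \<gamma> x \<le> (y - x) * x powr (-\<gamma>)" by blast+
qed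

lemma powr_primitive_less_Suc:
  assumes "\<gamma> \<ge> 0" "n \<ge> 1"
  shows "powr_primitive \<gamma> (real n) < powr_primitive \<gamma> (real (Suc n))"
proof -
  have "0 < real (Suc n) powr (-\<gamma>)" by simp
  also have "\<dots> \<le> powr_primitive \<gamma> (real (Suc n)) - powr_primitive \<gamma> (real n)"
    using powr_primitive_diff_bounds(1)[of \<gamma> "real n" "real (Suc n)"] assms by simp
  finally show ?thesis by simp
qed

lemma powr_primitive_Suc_diff_tendsto:
  assumes "\<gamma> \<ge> 0"
  shows "(\<lambda>n. real n powr \<gamma> * (powr_primitive \<gamma> (real (Suc n)) - powr_primitive \<gamma> (real n))) \<longlonglongrightarrow> 1"
proof (rule tendsto_sandwich)
  show "(\<lambda>n. real n powr \<gamma> * real (Suc n) powr (-\<gamma>)) \<longlonglongrightarrow> 1" by real_asymp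
  show "(\<lambda>n. real n powr \<gamma> * real n powr (-\<gamma>)) \<longlonglongrightarrow> 1" by real_asymp
  have bounds: "real (Suc n) powr (-\<gamma>) \<le> powr_primitive \<gamma> (real (Suc n)) - powr_primitive \<gamma> (real n)"
    "powr_primitive \<gamma> (real (Suc n)) - powr_primitive \<gamma> (real n) \<le> real n powr (-\<gamma>)" if "n \<ge> 1" for n
    using powr_primitive_diff_bounds[OF assms, of "real n" "real (Suc n)"] that by simp_all
  show "\<forall>\<^sub>F n in sequentially. real n powr \<gamma> * real (Suc n) powr (-\<gamma>)
      \<le> real n powr \<gamma> * (powr_primitive \<gamma> (real (Suc n)) - powr_primitive \<gamma> (real n))"
    by (intro eventually_sequentiallyI[of 1] mult_left_mono bounds) auto
  show "\<forall>\<^sub>F n in sequentially. real n powr \<gamma> * (powr_primitive \<gamma> (real (Suc n)) - powr_primitive \<gamma> (real n))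
      \<le> real n powr \<gamma> * real n powr (-\<gamma>)"
    by (intro eventually_sequentiallyI[of 1] mult_left_mono bounds) auto
qed

definition time_index :: "real \<Rightarrow> nat \<Rightarrow> real \<Rightarrow> nat" where
  "time_index \<gamma> n t = nat \<lfloor>real n + real n powr \<gamma> * t\<rfloor>"

definition limit_clock :: "real \<Rightarrow> real \<Rightarrow> real" where
  "limit_clock \<gamma> t = (if \<gamma> = 1 then ln (1 + t) else t)"

definition limit_ratio :: "real \<Rightarrow> real \<Rightarrow> real" where
  "limit_ratio \<gamma> t = (if \<gamma> = 1 then 1 + t else 1)"

lemma time_index_mono: "s \<le> t \<Longrightarrow> time_index \<gamma> n s \<le> time_index \<gamma> n t"
  unfolding time_index_def by (intro nat_mono floor_mono add_left_mono mult_left_mono) auto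

lemma time_index_ge: "t \<ge> 0 \<Longrightarrow> n \<le> time_index \<gamma> n t"
  unfolding time_index_def by (rule le_nat_floor) simp

lemma real_time_index_bounds:
  assumes "t \<ge> 0"
  shows "real (time_index \<gamma> n t) \<le> real n + real n powr \<gamma> * t" "real n + real n powr \<gamma> * t \<le> real (time_index \<gamma> n t) + 1"
proof -
  have "real (time_index \<gamma> n t) = real_of_int \<lfloor>real n + real n powr \<gamma> * t\<rfloor>" unfolding time_index_def using assms by simp
  thus "real (time_index \<gamma> n t) \<le> real n + real n powr \<gamma> * t" "real n + real n powr \<gamma> * t \<le> real (time_index \<gamma> n t) + 1"
    by linarith+
qed

lemma time_index_at_top: "t \<ge> 0 \<Longrightarrow> filterlim (\<lambda>n. time_index \<gamma> n t) at_top sequentially"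
  by (rule filterlim_at_top_mono[OF filterlim_ident]) (simp add: time_index_ge)

lemma time_index_ratio_tendsto:
  assumes "0 < \<gamma>" "\<gamma> \<le> 1" "t \<ge> 0"
  shows "(\<lambda>n. real (time_index \<gamma> n t) / real n) \<longlonglongrightarrow> limit_ratio \<gamma> t"
proof -
  have lim: "(\<lambda>n. (real n + real n powr \<gamma> * t) / real n) \<longlonglongrightarrow> limit_ratio \<gamma> t"
  proof (cases "\<gamma> = 1")
    case True
    have "(\<lambda>n. (real n + real n powr 1 * t) / real n) \<longlonglongrightarrow> 1 + t" by real_asymp
    thus ?thesis using True by (simp add: limit_ratio_def)
  next
    case False
    hence "\<gamma> < 1" using assms by simp
    hence "(\<lambda>n. (real n + real n powr \<gamma> * t) / real n) \<longlonglongrightarrow> 1" by real_asymp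
    thus ?thesis using False by (simp add: limit_ratio_def)
  qed
  show ?thesis
  proof (rule tendsto_sandwich)
    note bounds = real_time_index_bounds[where \<gamma>=\<gamma>, OF \<open>t \<ge> 0\<close>]
    have "(real n + real n powr \<gamma> * t) / real n - 1 / real n \<le> real (time_index \<gamma> n t) / real n" for n
      unfolding diff_divide_distrib[symmetric] using bounds(2)[of n] by (intro divide_right_mono) auto
    thus "\<forall>\<^sub>F n in sequentially. (real n + real n powr \<gamma> * t) / real n - 1 / real n \<le> real (time_index \<gamma> n t) / real n"
      by simp
    show "\<forall>\<^sub>F n in sequentially. real (time_index \<gamma> n t) / real n \<le> (real n + real n powr \<gamma> * t) / real n"
      by (intro always_eventually allI divide_right_mono bounds) simp
    have "(\<lambda>n. 1 / real n) \<longlonglongrightarrow> 0" by real_asymp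
    from tendsto_diff[OF lim this]
    show "(\<lambda>n. (real n + real n powr \<gamma> * t) / real n - 1 / real n) \<longlonglongrightarrow> limit_ratio \<gamma> t" by simp
  qed (fact lim)
qed

lemma powr_primitive_step_bounds:
  assumes \<gamma>: "\<gamma> \<ge> 0" and n: "n \<ge> 1" and t: "t \<in> {0..T}"
  defines "x \<equiv> real n" and "p \<equiv> real n powr \<gamma>"
  shows "powr_primitive \<gamma> (x + p * t) - powr_primitive \<gamma> x \<le> t"
    and "t - T * (1 - p * (x + p * T) powr (-\<gamma>)) \<le> powr_primitive \<gamma> (x + p * t) - powr_primitive \<gamma> x"
proof -
  have pos: "x > 0" "p > 0" using n unfolding x_def p_def by auto
  have pt: "p * t \<ge> 0" "p * t \<le> p * T" using pos t by auto
  note bounds = powr_primitive_diff_bounds[of \<gamma> x "x + p * t"]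
  have p_inverse: "p * x powr (-\<gamma>) = 1" using pos unfolding p_def x_def by (simp add: powr_add[symmetric])
  have "powr_primitive \<gamma> (x + p * t) - powr_primitive \<gamma> x \<le> t * (p * x powr (-\<gamma>))"
    using bounds(2) \<gamma> pos pt by (simp add: mult.commute mult.left_commute)
  thus "powr_primitive \<gamma> (x + p * t) - powr_primitive \<gamma> x \<le> t" by (simp add: p_inverse)
  define q where "q = p * (x + p * T) powr (-\<gamma>)"
  have "t * q = p * t * (x + p * T) powr (-\<gamma>)" unfolding q_def by simp
  also have "\<dots> \<le> p * t * (x + p * t) powr (-\<gamma>)" using pos pt \<gamma> by (intro mult_left_mono powr_mono2') auto
  also have "\<dots> \<le> powr_primitive \<gamma> (x + p * t) - powr_primitive \<gamma> x" using bounds(1) \<gamma> pos pt by simp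
  finally have "t * q \<le> powr_primitive \<gamma> (x + p * t) - powr_primitive \<gamma> x" .
  moreover have "q \<le> 1"
    unfolding q_def p_inverse[symmetric] using pos pt \<gamma> t by (intro mult_left_mono powr_mono2') auto
  hence "t * (1 - q) \<le> T * (1 - q)" using t by (intro mult_right_mono) auto
  ultimately show "t - T * (1 - p * (x + p * T) powr (-\<gamma>)) \<le> powr_primitive \<gamma> (x + p * t) - powr_primitive \<gamma> x"
    unfolding q_def[symmetric] by (simp add: right_diff_distrib)
qed

lemma powr_primitive_clock_limit:
  assumes \<gamma>: "0 < \<gamma>" "\<gamma> \<le> 1" and T: "T \<ge> 0"
  shows "uniform_limit {0..T} (\<lambda>n t. powr_primitive \<gamma> (real n + real n powr \<gamma> * t) - powr_primitive \<gamma> (real n))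
    (limit_clock \<gamma>) sequentially"
proof (cases "\<gamma> = 1")
  case True
  have "ln (real n + real n * t) - ln (real n) = ln (1 + t)" if "n \<ge> 1" "t \<ge> 0" for n t
  proof -
    have "ln (real n * (1 + t)) = ln (real n) + ln (1 + t)" using that by (intro ln_mult_pos) auto
    thus ?thesis by (simp add: distrib_left)
  qed
  thus ?thesis
    unfolding uniform_limit_iff True powr_primitive_def limit_clock_def
    by (auto intro!: eventually_sequentiallyI[of 1])
next
  case False
  hence \<gamma>1: "\<gamma> < 1" using \<gamma> by simp
  show ?thesis
  proof (rule uniform_limitI)
    fix e :: real assume "e > 0"
    define q where "q = (\<lambda>n. real n powr \<gamma> * (real n + real n powr \<gamma> * T) powr (-\<gamma>))"
    have "(\<lambda>n. T * (1 - q n)) \<longlonglongrightarrow> 0" unfolding q_def using \<gamma>1 \<gamma>(1) by real_asymp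
    hence "\<forall>\<^sub>F n in sequentially. T * (1 - q n) < e" using \<open>e > 0\<close> by (rule order_tendstoD)
    thus "\<forall>\<^sub>F n in sequentially. \<forall>t\<in>{0..T}.
        dist (powr_primitive \<gamma> (real n + real n powr \<gamma> * t) - powr_primitive \<gamma> (real n)) (limit_clock \<gamma> t) < e"
      using eventually_ge_at_top[of 1]
    proof eventually_elim
      case (elim n)
      have "\<bar>powr_primitive \<gamma> (real n + real n powr \<gamma> * t) - powr_primitive \<gamma> (real n) - t\<bar> < e" if "t \<in> {0..T}" for t
        using powr_primitive_step_bounds[OF less_imp_le[OF \<gamma>(1)] elim(2) that] elim(1) unfolding q_def by linarith
      thus ?case using False by (simp add: dist_real_def limit_clock_def)
    qed
  qed
qed

lemma powr_primitive_time_index_close: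
  assumes "\<gamma> \<ge> 0" "n \<ge> 1" "t \<ge> 0"
  shows "\<bar>powr_primitive \<gamma> (real (time_index \<gamma> n t)) - powr_primitive \<gamma> (real n + real n powr \<gamma> * t)\<bar> \<le> real n powr (-\<gamma>)"
proof -
  define x y where "x = real (time_index \<gamma> n t)" and "y = real n + real n powr \<gamma> * t"
  have xy: "real n \<le> x" "x \<le> y" "y - x \<le> 1"
    using time_index_ge[where \<gamma>=\<gamma> and n=n, OF \<open>t \<ge> 0\<close>]
      real_time_index_bounds[where \<gamma>=\<gamma> and n=n, OF \<open>t \<ge> 0\<close>] unfolding x_def y_def by auto
  have x: "x > 0" using xy(1) \<open>n \<ge> 1\<close> by simp
  have "(y - x) * x powr (-\<gamma>) \<le> 1 * real n powr (-\<gamma>)"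
    using xy \<open>\<gamma> \<ge> 0\<close> \<open>n \<ge> 1\<close> by (intro mult_mono powr_mono2') auto
  moreover have "0 \<le> (y - x) * y powr (-\<gamma>)" using xy by simp
  ultimately show ?thesis
    using powr_primitive_diff_bounds[OF \<open>\<gamma> \<ge> 0\<close> x xy(2)] unfolding x_def[symmetric] y_def[symmetric] by linarith
qed

lemma powr_primitive_time_index_limit:
  assumes \<gamma>: "0 < \<gamma>" "\<gamma> \<le> 1" and T: "T \<ge> 0"
  shows "uniform_limit {0..T} (\<lambda>n t. powr_primitive \<gamma> (real (time_index \<gamma> n t)) - powr_primitive \<gamma> (real n))
    (limit_clock \<gamma>) sequentially"
proof -
  let ?y = "\<lambda>n t. real n + real n powr \<gamma> * t"
  have "(\<lambda>n. real n powr (-\<gamma>)) \<longlonglongrightarrow> 0" using \<gamma> by real_asymp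
  hence "uniform_limit {0..T} (\<lambda>n t. real n powr (-\<gamma>)) (\<lambda>_. 0) sequentially"
    by (intro uniform_limitI) (auto dest: tendstoD)
  hence "uniform_limit {0..T} (\<lambda>n t. powr_primitive \<gamma> (real (time_index \<gamma> n t)) - powr_primitive \<gamma> (?y n t))
      (\<lambda>_. 0) sequentially"
    by (rule uniform_limit_null_comparison[rotated])
      (rule eventually_sequentiallyI[of 1], use \<gamma> in \<open>auto intro!: powr_primitive_time_index_close\<close>)
  from uniform_limit_add[OF this powr_primitive_clock_limit[OF assms]] show ?thesis by simp
qed

section \<open>Step sizes\<close>

lemma neg_ln_one_minus_tendsto:
  fixes s x :: "nat \<Rightarrow> real"
  assumes s: "\<And>n. s n \<ge> 0" and x: "\<And>n. x n < 1" "x \<longlonglongrightarrow> 0" and sx: "(\<lambda>n. s n * x n) \<longlonglongrightarrow> L"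
  shows "(\<lambda>n. s n * - ln (1 - x n)) \<longlonglongrightarrow> L"
proof (rule tendsto_sandwich[OF always_eventually always_eventually sx])
  have "(\<lambda>n. (s n * x n) / (1 - x n)) \<longlonglongrightarrow> L / (1 - 0)" by (intro tendsto_intros sx x(2)) simp
  thus "(\<lambda>n. (s n * x n) / (1 - x n)) \<longlonglongrightarrow> L" by simp
  show "\<forall>n. s n * x n \<le> s n * - ln (1 - x n)"
  proof
    fix n
    have "x n \<le> - ln (1 - x n)" using ln_le_minus_one[of "1 - x n"] x(1)[of n] by simp
    thus "s n * x n \<le> s n * - ln (1 - x n)" using s by (rule mult_left_mono)
  qed
  show "\<forall>n. s n * - ln (1 - x n) \<le> (s n * x n) / (1 - x n)"
  proof
    fix n
    have "- ln (1 - x n) = ln (1 / (1 - x n))" using x(1)[of n] by (simp add: ln_div)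
    also have "\<dots> \<le> 1 / (1 - x n) - 1" using x(1)[of n] by (intro ln_le_minus_one) auto
    also have "\<dots> = x n / (1 - x n)" using x(1)[of n] by (simp add: field_simps)
    finally have "s n * - ln (1 - x n) \<le> s n * (x n / (1 - x n))" using s by (intro mult_left_mono)
    thus "s n * - ln (1 - x n) \<le> (s n * x n) / (1 - x n)" by simp
  qed
qed

locale step_sizes =
  fixes r :: "nat \<Rightarrow> real" and c \<gamma> \<beta> :: real
  assumes r: "\<And>n. 0 \<le> r n" "\<And>n. r n < 1" and \<gamma>: "0 < \<gamma>" "\<gamma> \<le> 1" and c: "c > 0"
    and r_rate: "(\<lambda>n. real n powr \<gamma> * r n) \<longlonglongrightarrow> c" and \<beta>: "0 < \<beta>" "\<beta> \<le> 1"
    and supercritical: "\<gamma> = 1 \<Longrightarrow> 1 < 2 * c * \<beta>"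
begin

text \<open>Dividing the deviation at time n by \<open>damping n\<close> turns it into a martingale, which \<open>scale n\<close> normalises.\<close>

definition damping :: "nat \<Rightarrow> real" where "damping n = (\<Prod>j<n. 1 - \<beta> * r j)"

definition scale :: "nat \<Rightarrow> real" where "scale n = real n powr (\<gamma>/2) * damping n"

definition scale_factor :: "nat \<Rightarrow> real" where
  "scale_factor n = (1 + 1 / real n) powr (\<gamma>/2) * (1 - \<beta> * r n)"

definition \<theta> :: real where "\<theta> = c * \<beta> - (if \<gamma> = 1 then 1/2 else 0)"

definition weight :: "real \<Rightarrow> real" where
  "weight t = (if \<gamma> = 1 then (1 + t) powr (c * \<beta>) else exp (c * \<beta> * t))"

lemma weight_eq_exp: "t \<ge> 0 \<Longrightarrow> weight t = exp (c * \<beta> * limit_clock \<gamma> t)"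
  unfolding weight_def limit_clock_def by (simp add: powr_def)

lemma weight_continuous: "continuous_on {0..} weight"
  unfolding weight_def by (cases "\<gamma> = 1") (auto intro!: continuous_intros)

lemma \<theta>_pos: "\<theta> > 0"
  unfolding \<theta>_def using c \<beta> supercritical by auto

lemma r_tendsto_zero: "r \<longlonglongrightarrow> 0"
  by (rule powr_rate_tendsto_zero[OF r_rate \<gamma>(1)])

lemma factor_pos: "1 - \<beta> * r n > 0"
  using r[of n] mult_right_mono[OF \<beta>(2), of "r n"] by linarith

lemma damping_pos: "damping n > 0"
  unfolding damping_def using factor_pos by (intro prod_pos) auto

lemma damping_Suc: "damping (Suc n) = (1 - \<beta> * r n) * damping n"
  unfolding damping_def by simp

lemma scale_nonneg: "scale n \<ge> 0"
  unfolding scale_def using damping_pos[of n] by simp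

lemma scale_pos: "n \<ge> 1 \<Longrightarrow> scale n > 0"
  unfolding scale_def using damping_pos[of n] by simp

lemma powr_Suc: "n \<ge> 1 \<Longrightarrow> real (Suc n) powr a = (1 + 1 / real n) powr a * real n powr a"
proof -
  assume n: "n \<ge> 1"
  have "(1 + 1 / real n) powr a * real n powr a = ((1 + 1 / real n) * real n) powr a"
    using n by (subst powr_mult) auto
  also have "(1 + 1 / real n) * real n = real (Suc n)" using n by (simp add: field_simps)
  finally show ?thesis ..
qed

lemma scale_Suc: "n \<ge> 1 \<Longrightarrow> scale (Suc n) = scale_factor n * scale n"
  unfolding scale_def scale_factor_def damping_Suc by (simp add: powr_Suc del: of_nat_Suc)

lemma scale_factor_rate: "(\<lambda>n. real n powr \<gamma> * (1 - scale_factor n)) \<longlonglongrightarrow> \<theta>"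
proof -
  have "(\<lambda>n. real n powr \<gamma> * (1 - (1 + 1 / real n) powr (\<gamma>/2))) \<longlonglongrightarrow> - (if \<gamma> = 1 then 1/2 else 0)"
  proof (cases "\<gamma> = 1")
    case True
    have "(\<lambda>n. real n powr 1 * (1 - (1 + 1 / real n) powr (1/2))) \<longlonglongrightarrow> - 1/2" by real_asymp
    thus ?thesis using True by simp
  next
    case False
    hence "\<gamma> < 1" using \<gamma> by simp
    hence "(\<lambda>n. real n powr \<gamma> * (1 - (1 + 1 / real n) powr (\<gamma>/2))) \<longlonglongrightarrow> 0" using \<gamma>(1) by real_asymp
    thus ?thesis using False by simp
  qed
  moreover have "(\<lambda>n. (1 + 1 / real n) powr (\<gamma>/2)) \<longlonglongrightarrow> 1" by real_asymp
  ultimately have "(\<lambda>n. real n powr \<gamma> * (1 - (1 + 1 / real n) powr (\<gamma>/2))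
      + (1 + 1 / real n) powr (\<gamma>/2) * (\<beta> * (real n powr \<gamma> * r n)))
      \<longlonglongrightarrow> - (if \<gamma> = 1 then 1/2 else 0) + 1 * (\<beta> * c)"
    by (intro tendsto_add tendsto_mult tendsto_const r_rate)
  thus ?thesis by (simp add: scale_factor_def \<theta>_def algebra_simps)
qed

lemma scale_tendsto_zero: "scale \<longlonglongrightarrow> 0"
proof -
  have "scale \<longlonglongrightarrow> 0 / \<theta>"
    by (rule powr_recursion_tendsto[OF \<gamma> \<theta>_pos _ scale_factor_rate, where e="\<lambda>_. 0"])
      (auto simp: scale_Suc intro: eventually_sequentiallyI[of 1])
  thus ?thesis by simp
qed

lemma scale_factor_power_rate:
  assumes "p \<ge> 1" shows "(\<lambda>n. real n powr \<gamma> * (1 - scale_factor n ^ p)) \<longlonglongrightarrow> real p * \<theta>"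
proof -
  from tendsto_diff[OF tendsto_const[of 1] powr_rate_tendsto_zero[OF scale_factor_rate \<gamma>(1)]]
  have "scale_factor \<longlonglongrightarrow> 1" by simp
  hence "(\<lambda>n. (real n powr \<gamma> * (1 - scale_factor n)) * (\<Sum>i<p. scale_factor n ^ i)) \<longlonglongrightarrow> \<theta> * (\<Sum>i<p. 1 ^ i)"
    by (intro tendsto_mult scale_factor_rate tendsto_sum tendsto_power)
  thus ?thesis by (simp add: one_diff_power_eq mult.commute mult.left_commute)
qed

lemma scale_power_sum_tendsto:
  assumes p: "p \<ge> 1" and g: "(\<lambda>n. real n powr (\<gamma> * (1 - real p / 2)) * g n) \<longlonglongrightarrow> E"
  shows "(\<lambda>n. scale n ^ p * (\<Sum>k<n. (r k / damping (Suc k)) ^ p * g k)) \<longlonglongrightarrow> c ^ p * E / (real p * \<theta>)"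
proof (rule powr_recursion_tendsto[OF \<gamma> _ _ scale_factor_power_rate[OF p],
    where e="\<lambda>n. (real (Suc n) powr (\<gamma>/2) * r n) ^ p * g n"])
  show "real p * \<theta> > 0" using p \<theta>_pos by simp
  show "\<forall>\<^sub>F n in sequentially. scale (Suc n) ^ p * (\<Sum>k<Suc n. (r k / damping (Suc k)) ^ p * g k)
      = (1 - (1 - scale_factor n ^ p)) * (scale n ^ p * (\<Sum>k<n. (r k / damping (Suc k)) ^ p * g k))
        + (real (Suc n) powr (\<gamma>/2) * r n) ^ p * g n"
  proof (rule eventually_sequentiallyI[of 1])
    fix n :: nat assume n: "n \<ge> 1"
    have "scale (Suc n) ^ p * ((r n / damping (Suc n)) ^ p * g n) = (real (Suc n) powr (\<gamma>/2) * r n) ^ p * g n"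
      using damping_pos[of "Suc n"] unfolding scale_def by (simp add: power_mult_distrib[symmetric] flip: mult.assoc)
    thus "scale (Suc n) ^ p * (\<Sum>k<Suc n. (r k / damping (Suc k)) ^ p * g k)
      = (1 - (1 - scale_factor n ^ p)) * (scale n ^ p * (\<Sum>k<n. (r k / damping (Suc k)) ^ p * g k))
        + (real (Suc n) powr (\<gamma>/2) * r n) ^ p * g n"
      using scale_Suc[OF n] by (simp add: power_mult_distrib algebra_simps)
  qed
  have "(\<lambda>n. ((1 + 1 / real n) powr (\<gamma>/2)) ^ p * (real n powr \<gamma> * r n) ^ p * (real n powr (\<gamma> * (1 - real p / 2)) * g n))
      \<longlonglongrightarrow> 1 ^ p * c ^ p * E"
    by (intro tendsto_mult tendsto_power r_rate g) real_asymp
  moreover have "((1 + 1 / real n) powr (\<gamma>/2)) ^ p * (real n powr \<gamma> * r n) ^ p * (real n powr (\<gamma> * (1 - real p / 2)) * g n)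
      = real n powr \<gamma> * ((real (Suc n) powr (\<gamma>/2) * r n) ^ p * g n)" if "n \<ge> 1" for n
  proof -
    have "(real n powr \<gamma>) ^ p * real n powr (\<gamma> * (1 - real p / 2)) = real n powr \<gamma> * (real n powr (\<gamma>/2)) ^ p"
      using that by (simp add: powr_power powr_add[symmetric] algebra_simps)
    thus ?thesis using that by (simp add: powr_Suc power_mult_distrib del: of_nat_Suc)
  qed
  ultimately show "(\<lambda>n. real n powr \<gamma> * ((real (Suc n) powr (\<gamma>/2) * r n) ^ p * g n)) \<longlonglongrightarrow> c ^ p * E"
    by (simp add: Lim_transform_eventually[OF _ eventually_sequentiallyI[of 1]])
qed

lemma ln_damping_increments:
  assumes "\<epsilon> > 0"
  shows "\<forall>\<^sub>F n in sequentially. \<forall>k\<ge>n.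
      \<bar>ln (damping n) - ln (damping k) - c * \<beta> * (powr_primitive \<gamma> (real k) - powr_primitive \<gamma> (real n))\<bar>
    \<le> \<epsilon> * (powr_primitive \<gamma> (real k) - powr_primitive \<gamma> (real n))"
proof -
  let ?H = "\<lambda>n. powr_primitive \<gamma> (real n)"
  have H: "(\<lambda>n. real n powr \<gamma> * (?H (Suc n) - ?H n)) \<longlonglongrightarrow> 1" by (rule powr_primitive_Suc_diff_tendsto) (use \<gamma> in simp)
  have "(\<lambda>n. real n powr \<gamma> * - ln (1 - \<beta> * r n)) \<longlonglongrightarrow> \<beta> * c"
  proof (rule neg_ln_one_minus_tendsto)
    show "\<beta> * r n < 1" for n using factor_pos[of n] by simp
    show "(\<lambda>n. \<beta> * r n) \<longlonglongrightarrow> 0" using tendsto_mult_left[OF r_tendsto_zero, of \<beta>] by simp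
    show "(\<lambda>n. real n powr \<gamma> * (\<beta> * r n)) \<longlonglongrightarrow> \<beta> * c"
      using tendsto_mult_left[OF r_rate, of \<beta>] by (simp add: mult.left_commute)
  qed simp
  moreover have "- ln (1 - \<beta> * r n) = - ln (damping (Suc n)) - - ln (damping n)" for n
    using damping_pos[of n] factor_pos[of n] unfolding damping_Suc by (simp add: ln_mult_pos)
  ultimately have "(\<lambda>n. real n powr \<gamma> * (- ln (damping (Suc n)) - - ln (damping n))) \<longlonglongrightarrow> \<beta> * c" by simp
  from powr_rate_ratio_tendsto[OF H this]
  have "(\<lambda>n. (- ln (damping (Suc n)) - - ln (damping n)) / (?H (Suc n) - ?H n)) \<longlonglongrightarrow> c * \<beta>"
    by (simp add: mult.commute)
  moreover have "\<forall>\<^sub>F n in sequentially. ?H n < ?H (Suc n)"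
    using powr_primitive_less_Suc[of \<gamma>] \<gamma> by (intro eventually_sequentiallyI[of 1]) simp
  ultimately show ?thesis
    using proportional_increments_uniform[of ?H "\<lambda>n. - ln (damping n)" "c * \<beta>" \<epsilon>] assms by simp
qed

lemma limit_clock_bounded: "T \<ge> 0 \<Longrightarrow> t \<in> {0..T} \<Longrightarrow> \<bar>limit_clock \<gamma> t\<bar> \<le> T"
  using ln_add_one_self_le_self[of t] by (auto simp: limit_clock_def)

lemma ln_damping_ratio_limit:
  assumes T: "T \<ge> 0"
  shows "uniform_limit {0..T} (\<lambda>n t. c * \<beta> * limit_clock \<gamma> t - (ln (damping n) - ln (damping (time_index \<gamma> n t))))
      (\<lambda>_. 0) sequentially"
proof (rule uniform_limitI)
  fix e :: real assume e: "e > 0"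
  define K where "K = c * \<beta> + T + 1"
  have K: "K > 0" unfolding K_def using c \<beta> T by (simp add: add_nonneg_pos)
  define \<eta> where "\<eta> = min 1 (e / (2 * K))"
  have \<eta>: "\<eta> > 0" "\<eta> \<le> 1" "\<eta> * K < e"
  proof -
    show "\<eta> > 0" "\<eta> \<le> 1" using e K unfolding \<eta>_def by auto
    have "\<eta> * K \<le> e / (2 * K) * K" using K unfolding \<eta>_def by (intro mult_right_mono) auto
    thus "\<eta> * K < e" using K e by simp
  qed
  show "\<forall>\<^sub>F n in sequentially. \<forall>t\<in>{0..T}.
      dist (c * \<beta> * limit_clock \<gamma> t - (ln (damping n) - ln (damping (time_index \<gamma> n t)))) 0 < e"
    using uniform_limitD[OF powr_primitive_time_index_limit[OF \<gamma> T] \<eta>(1)] ln_damping_increments[OF \<eta>(1)]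
  proof eventually_elim
    case (elim n)
    show ?case
    proof
      fix t assume t: "t \<in> {0..T}"
      define h where "h = powr_primitive \<gamma> (real (time_index \<gamma> n t)) - powr_primitive \<gamma> (real n)"
      have clock: "\<bar>h - limit_clock \<gamma> t\<bar> \<le> \<eta>"
        using bspec[OF elim(1) t] unfolding h_def dist_real_def by (rule less_imp_le)
      have log: "\<bar>ln (damping n) - ln (damping (time_index \<gamma> n t)) - c * \<beta> * h\<bar> \<le> \<eta> * h"
        using elim(2) t time_index_ge[of t n \<gamma>] unfolding h_def by auto
      have "h \<le> T + 1" using clock limit_clock_bounded[OF T t] \<eta>(2) by linarith
      hence "\<eta> * h \<le> \<eta> * (T + 1)" using \<eta>(1) by (intro mult_left_mono) auto
      moreover have "\<bar>c * \<beta> * h - c * \<beta> * limit_clock \<gamma> t\<bar> \<le> c * \<beta> * \<eta>"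
        using clock c \<beta> unfolding right_diff_distrib[symmetric] abs_mult by (auto intro!: mult_left_mono)
      ultimately have "\<bar>c * \<beta> * limit_clock \<gamma> t - (ln (damping n) - ln (damping (time_index \<gamma> n t)))\<bar> \<le> \<eta> * K"
        using log unfolding K_def by (simp add: algebra_simps)
      thus "dist (c * \<beta> * limit_clock \<gamma> t - (ln (damping n) - ln (damping (time_index \<gamma> n t)))) 0 < e"
        using \<eta>(3) by (simp add: dist_real_def)
    qed
  qed
qed

lemma damping_ratio_limit:
  assumes T: "T \<ge> 0"
  shows "uniform_limit {0..T} (\<lambda>n t. weight t * damping (time_index \<gamma> n t) / damping n) (\<lambda>_. 1) sequentially"
proof -
  let ?g = "\<lambda>n t. c * \<beta> * limit_clock \<gamma> t - (ln (damping n) - ln (damping (time_index \<gamma> n t)))"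
  note lim = ln_damping_ratio_limit[OF T]
  have "uniformly_continuous_on {-1..1::real} exp"
    by (intro compact_uniformly_continuous continuous_intros) auto
  moreover have "\<forall>\<^sub>F n in sequentially. \<forall>t\<in>{0..T}. ?g n t \<in> {-1..1}"
    using uniform_limitD[OF lim zero_less_one] by eventually_elim (auto simp: dist_real_def abs_less_iff intro: less_imp_le)
  ultimately have "uniform_limit {0..T} (\<lambda>n t. exp (?g n t)) (\<lambda>t. exp 0) sequentially"
    by (intro uniform_limit_compose_uniformly_continuous_on[OF lim]) auto
  moreover have "exp (?g n t) = weight t * damping (time_index \<gamma> n t) / damping n" if "t \<in> {0..T}" for n t
    using that damping_pos[of n] damping_pos[of "time_index \<gamma> n t"] by (simp add: weight_eq_exp exp_diff)
  ultimately show ?thesis by (subst (asm) uniform_limit_cong') auto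
qed

lemma scale_ratio_tendsto:
  assumes t: "t \<ge> 0"
  shows "(\<lambda>n. scale n / scale (time_index \<gamma> n t)) \<longlonglongrightarrow> limit_ratio \<gamma> t powr (-(\<gamma>/2)) * weight t"
proof -
  let ?k = "\<lambda>n. time_index \<gamma> n t"
  have "weight t > 0" using t by (simp add: weight_eq_exp)
  have "(\<lambda>n. weight t * damping (?k n) / damping n) \<longlonglongrightarrow> 1"
    by (rule tendsto_uniform_limitI[OF damping_ratio_limit[OF t]]) (use t in simp)
  from tendsto_divide[OF tendsto_const[of "weight t"] this]
  have damping: "(\<lambda>n. weight t / (weight t * damping (?k n) / damping n)) \<longlonglongrightarrow> weight t" by simp
  have ratio_pos: "limit_ratio \<gamma> t > 0" using t by (simp add: limit_ratio_def)
  have "(\<lambda>n. (real (?k n) / real n) powr (-(\<gamma>/2)) * (weight t / (weight t * damping (?k n) / damping n)))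
      \<longlonglongrightarrow> limit_ratio \<gamma> t powr (-(\<gamma>/2)) * weight t"
    using ratio_pos by (intro tendsto_mult tendsto_powr time_index_ratio_tendsto[OF \<gamma> t] damping tendsto_const) auto
  moreover have "(real (?k n) / real n) powr (-(\<gamma>/2)) * (weight t / (weight t * damping (?k n) / damping n))
      = scale n / scale (?k n)" for n
    using damping_pos[of n] damping_pos[of "?k n"] \<open>weight t > 0\<close> unfolding scale_def
    by (simp add: powr_divide powr_minus field_simps)
  ultimately show ?thesis by simp
qed

end

section \<open>The reinforced process\<close>

lemma (in prob_space) expectation_abs_le_sqrt:
  fixes X :: "'a \<Rightarrow> real"
  assumes "integrable M X" "integrable M (\<lambda>\<omega>. (X \<omega>)\<^sup>2)"
  shows "expectation (\<lambda>\<omega>. \<bar>X \<omega>\<bar>) \<le> sqrt (expectation (\<lambda>\<omega>. (X \<omega>)\<^sup>2))"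
proof (rule real_le_rsqrt)
  have "0 \<le> variance (\<lambda>\<omega>. \<bar>X \<omega>\<bar>)" by (rule variance_positive)
  thus "(expectation (\<lambda>\<omega>. \<bar>X \<omega>\<bar>))\<^sup>2 \<le> expectation (\<lambda>\<omega>. (X \<omega>)\<^sup>2)"
    using assms by (subst (asm) variance_eq) auto
qed

lemma convex_combination_square_le:
  fixes a x y :: real
  assumes "0 \<le> a" "a \<le> 1" shows "((1 - a) * x + a * y)\<^sup>2 \<le> (1 - a) * x\<^sup>2 + a * y\<^sup>2"
  using convex_onD[OF convex_power2, of a x y] assms by simp

lemma sum_mix_mean_square_le:
  fixes x :: "'b \<Rightarrow> real"
  assumes "0 \<le> a" "a \<le> 1"
  shows "(\<Sum>j\<in>S. ((1 - a) * x j + a * ((\<Sum>k\<in>S. x k) / real (card S)))\<^sup>2) \<le> (\<Sum>j\<in>S. (x j)\<^sup>2)"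
proof (cases "card S = 0")
  case False
  define m where "m = (\<Sum>k\<in>S. x k) / real (card S)"
  have "real (card S) * m\<^sup>2 \<le> (\<Sum>j\<in>S. (x j)\<^sup>2)"
    using sum_squared_le_sum_of_squares[of x S] False unfolding m_def
    by (simp add: power_divide power2_eq_square[of "real (card S)"] divide_le_eq)
  hence "(1 - a) * (\<Sum>j\<in>S. (x j)\<^sup>2) + a * (real (card S) * m\<^sup>2) \<le> (1 - a) * (\<Sum>j\<in>S. (x j)\<^sup>2) + a * (\<Sum>j\<in>S. (x j)\<^sup>2)"
    using assms by (intro add_left_mono mult_left_mono)
  moreover have "(\<Sum>j\<in>S. ((1 - a) * x j + a * m)\<^sup>2) \<le> (\<Sum>j\<in>S. (1 - a) * (x j)\<^sup>2 + a * m\<^sup>2)"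
    by (intro sum_mono convex_combination_square_le assms)
  moreover have "(\<Sum>j\<in>S. (1 - a) * (x j)\<^sup>2 + a * m\<^sup>2) = (1 - a) * (\<Sum>j\<in>S. (x j)\<^sup>2) + a * (real (card S) * m\<^sup>2)"
    by (simp add: sum.distrib sum_distrib_left)
  ultimately show ?thesis unfolding m_def[symmetric] by (simp add: left_diff_distrib)
qed (auto simp: card_eq_0_iff)

lemma bernoulli_variance_Lipschitz:
  fixes x y :: real
  assumes "0 \<le> x" "x \<le> 1" "0 \<le> y" "y \<le> 1"
  shows "\<bar>x * (1 - x) - y * (1 - y)\<bar> \<le> \<bar>x - y\<bar>"
proof -
  have "x * (1 - x) - y * (1 - y) = (x - y) * (1 - x - y)" by (simp add: algebra_simps)
  hence "\<bar>x * (1 - x) - y * (1 - y)\<bar> = \<bar>x - y\<bar> * \<bar>1 - x - y\<bar>" by (simp only: abs_mult)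
  also have "\<dots> \<le> \<bar>x - y\<bar> * 1" using assms by (intro mult_left_mono) auto
  finally show ?thesis by simp
qed

locale reinforcement = prob_space M for M :: "'a measure" +
  fixes Z I :: "nat \<Rightarrow> nat \<Rightarrow> 'a \<Rightarrow> real" and N :: nat and \<rho> \<alpha> q :: real and r :: "nat \<Rightarrow> real" and i :: nat
  assumes N: "N \<ge> 1" and rho: "0 \<le> \<rho>" "\<rho> < 1" and alpha: "0 \<le> \<alpha>" "\<alpha> \<le> 1" and q: "0 < q" "q < 1"
    and r: "\<And>n. 0 \<le> r n \<and> r n < 1"
    and Zmeas: "\<And>n j. j \<in> {1..N} \<Longrightarrow> Z n j \<in> borel_measurable M"
    and Zrange: "\<And>n j \<omega>. j \<in> {1..N} \<Longrightarrow> \<omega> \<in> space M \<Longrightarrow> 0 \<le> Z n j \<omega> \<and> Z n j \<omega> \<le> 1"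
    and Imeas: "\<And>n j. j \<in> {1..N} \<Longrightarrow> I (Suc n) j \<in> borel_measurable M"
    and Irange: "\<And>n j \<omega>. j \<in> {1..N} \<Longrightarrow> \<omega> \<in> space M \<Longrightarrow> I (Suc n) j \<omega> \<in> {0, 1}"
    and recur: "\<And>n j \<omega>. j \<in> {1..N} \<Longrightarrow> \<omega> \<in> space M \<Longrightarrow>
        Z (Suc n) j \<omega> = (1 - r n) * Z n j \<omega> + r n * (\<rho> * I (Suc n) j \<omega> + (1 - \<rho>) * q)"
    and condindep: "\<And>n S (a :: nat \<Rightarrow> real). S \<subseteq> {1..N} \<Longrightarrow>
        AE \<omega> in M. real_cond_exp M (Filt M N Z n)
            (\<lambda>\<omega>. \<Prod>j\<in>S. indicator {\<omega>. I (Suc n) j \<omega> = a j} \<omega>) \<omega>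
          = (\<Prod>j\<in>S. real_cond_exp M (Filt M N Z n) (indicator {\<omega>. I (Suc n) j \<omega> = a j}) \<omega>)"
    and condprob: "\<And>n j. j \<in> {1..N} \<Longrightarrow>
        AE \<omega> in M. real_cond_exp M (Filt M N Z n) (indicator {\<omega>. I (Suc n) j \<omega> = 1}) \<omega>
          = (1 - \<alpha>) * Z n j \<omega> + \<alpha> * Zbar N Z n \<omega>"
    and i: "i \<in> {1..N}"
begin

abbreviation F :: "nat \<Rightarrow> 'a measure" where "F \<equiv> Filt M N Z"

definition success_prob :: "nat \<Rightarrow> nat \<Rightarrow> 'a \<Rightarrow> real" where
  "success_prob n j \<omega> = (1 - \<alpha>) * Z n j \<omega> + \<alpha> * Zbar N Z n \<omega>"

lemma subalgebra_F: "subalgebra M (F n)"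
proof -
  have sub: "{Z k j -` B \<inter> space M | k j B. k \<le> n \<and> j \<in> {1..N} \<and> B \<in> sets borel} \<subseteq> sets M"
    using Zmeas by (auto intro: measurable_sets)
  hence "{Z k j -` B \<inter> space M | k j B. k \<le> n \<and> j \<in> {1..N} \<and> B \<in> sets borel} \<subseteq> Pow (space M)"
    using sets.sets_into_space by blast
  thus ?thesis unfolding subalgebra_def Filt_def
    using sets.sigma_sets_subset[OF sub] by (simp add: sets_measure_of space_measure_of)
qed

lemma space_F [simp]: "space (F n) = space M"
  using subalgebra_F[of n] by (simp add: subalgebra_def)

lemma bounded_measurable_F_M: "bounded_measurable M (F n) f \<Longrightarrow> bounded_measurable M M f"
  by (rule bounded_measurable_subalgebra[OF subalgebra_F])

lemma bounded_measurable_Z: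
  assumes "k \<le> n" "j \<in> {1..N}" shows "bounded_measurable M (F n) (Z k j)"
proof (rule bounded_measurableI[where B=1])
  have generators: "{Z k j -` B \<inter> space M | k j B. k \<le> n \<and> j \<in> {1..N} \<and> B \<in> sets borel} \<subseteq> Pow (space M)" by auto
  show "Z k j \<in> borel_measurable (F n)"
  proof (rule measurableI)
    fix B :: "real set" assume "B \<in> sets borel"
    hence "Z k j -` B \<inter> space M \<in> {Z k j -` B \<inter> space M | k j B. k \<le> n \<and> j \<in> {1..N} \<and> B \<in> sets borel}"
      using assms by blast
    thus "Z k j -` B \<inter> space (F n) \<in> sets (F n)"
      unfolding space_F unfolding Filt_def sets_measure_of[OF generators] by (rule sigma_sets.Basic)
  qed simp
  show "\<bar>Z k j \<omega>\<bar> \<le> 1" if "\<omega> \<in> space M" for \<omega> using Zrange[OF assms(2) that, of k] by simp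
qed

lemma bounded_measurable_Zbar: "k \<le> n \<Longrightarrow> bounded_measurable M (F n) (Zbar N Z k)"
  using bounded_measurable_cmult[OF bounded_measurable_sum[of "{1..N}" M "F n" "Z k"], of "1 / real N"] bounded_measurable_Z
  unfolding Zbar_def by simp

lemma bounded_measurable_success_prob: "k \<le> n \<Longrightarrow> j \<in> {1..N} \<Longrightarrow> bounded_measurable M (F n) (success_prob k j)"
  unfolding success_prob_def by (intro bounded_measurable_intros bounded_measurable_Z bounded_measurable_Zbar)

lemma bounded_measurable_I: "j \<in> {1..N} \<Longrightarrow> bounded_measurable M M (I (Suc n) j)"
proof (rule bounded_measurableI[where B=1, OF Imeas])
  fix \<omega> assume "j \<in> {1..N}" "\<omega> \<in> space M"
  from Irange[OF this, of n] show "\<bar>I (Suc n) j \<omega>\<bar> \<le> 1" by auto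
qed

lemmas bounded_measurable_Z_M = bounded_measurable_F_M[OF bounded_measurable_Z[OF order_refl]]

lemmas bounded_measurable_success_prob_M = bounded_measurable_F_M[OF bounded_measurable_success_prob[OF order_refl]]

lemma Zbar_range:
  assumes "\<omega> \<in> space M" shows "0 \<le> Zbar N Z n \<omega> \<and> Zbar N Z n \<omega> \<le> 1"
proof -
  have "(\<Sum>j=1..N. Z n j \<omega>) \<le> (\<Sum>j=1..N. 1)" by (intro sum_mono) (use Zrange assms in auto)
  moreover have "(\<Sum>j=1..N. Z n j \<omega>) \<ge> 0" by (intro sum_nonneg) (use Zrange assms in auto)
  ultimately show ?thesis using N unfolding Zbar_def by (simp add: field_simps)
qed

lemma success_prob_range:
  assumes "j \<in> {1..N}" "\<omega> \<in> space M" shows "0 \<le> success_prob n j \<omega>" "success_prob n j \<omega> \<le> 1"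
proof -
  note range = Zrange[OF assms, of n] Zbar_range[OF assms(2), of n]
  show "0 \<le> success_prob n j \<omega>" unfolding success_prob_def using range alpha by simp
  show "success_prob n j \<omega> \<le> 1"
    unfolding success_prob_def using range alpha by (intro convex_bound_le) auto
qed

lemma expectation_mult_prod_I:
  assumes g: "bounded_measurable M (F n) g" and S: "S \<subseteq> {1..N}"
  shows "expectation (\<lambda>\<omega>. g \<omega> * (\<Prod>j\<in>S. I (Suc n) j \<omega>)) = expectation (\<lambda>\<omega>. g \<omega> * (\<Prod>j\<in>S. success_prob n j \<omega>))"
proof -
  interpret finite_measure_subalgebra M "F n" by unfold_locales (rule subalgebra_F)
  have fin: "finite S" using S by (rule finite_subset) simp
  define f where "f = (\<lambda>\<omega>. \<Prod>j\<in>S. indicator {\<omega>. I (Suc n) j \<omega> = 1} \<omega> :: real)"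
  have "indicator {\<omega>. I (Suc n) j \<omega> = 1} \<omega> = I (Suc n) j \<omega>" if "\<omega> \<in> space M" "j \<in> {1..N}" for \<omega> j
    using Irange[OF that(2,1), of n] by (auto simp: indicator_def)
  hence f_eq: "f \<omega> = (\<Prod>j\<in>S. I (Suc n) j \<omega>)" if "\<omega> \<in> space M" for \<omega>
    unfolding f_def using that S by (intro prod.cong) auto
  have "bounded_measurable M M (\<lambda>\<omega>. \<Prod>j\<in>S. I (Suc n) j \<omega>)"
    by (rule bounded_measurable_prod) (use S in \<open>auto intro!: bounded_measurable_I\<close>)
  hence f: "bounded_measurable M M f" unfolding bounded_measurable_def using f_eq by (auto cong: measurable_cong)
  have prod_p: "bounded_measurable M M (\<lambda>\<omega>. \<Prod>j\<in>S. success_prob n j \<omega>)"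
    by (rule bounded_measurable_prod) (use S in \<open>auto intro!: bounded_measurable_success_prob_M\<close>)
  note gM = bounded_measurable_F_M[OF g]
  have "expectation (\<lambda>\<omega>. g \<omega> * (\<Prod>j\<in>S. I (Suc n) j \<omega>)) = expectation (\<lambda>\<omega>. g \<omega> * f \<omega>)"
    by (rule Bochner_Integration.integral_cong) (auto simp: f_eq)
  also have "\<dots> = expectation (\<lambda>\<omega>. g \<omega> * real_cond_exp M (F n) f \<omega>)"
    by (intro real_cond_exp_intg(2)[symmetric] bounded_measurable_integrable bounded_measurable_mult gM f
        bounded_measurable_measurable[OF g] bounded_measurable_measurable[OF f])
  also have "\<dots> = expectation (\<lambda>\<omega>. g \<omega> * (\<Prod>j\<in>S. success_prob n j \<omega>))"
  proof (rule integral_cong_AE)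
    have "AE \<omega> in M. \<forall>j\<in>S. real_cond_exp M (F n) (indicator {\<omega>. I (Suc n) j \<omega> = 1}) \<omega> = success_prob n j \<omega>"
      using fin S condprob unfolding success_prob_def by (intro AE_finite_allI) auto
    moreover have "AE \<omega> in M. real_cond_exp M (F n) f \<omega>
        = (\<Prod>j\<in>S. real_cond_exp M (F n) (indicator {\<omega>. I (Suc n) j \<omega> = 1}) \<omega>)"
      unfolding f_def by (rule condindep[OF S])
    ultimately show "AE \<omega> in M. g \<omega> * real_cond_exp M (F n) f \<omega> = g \<omega> * (\<Prod>j\<in>S. success_prob n j \<omega>)"
      by eventually_elim simp
    show "(\<lambda>\<omega>. g \<omega> * real_cond_exp M (F n) f \<omega>) \<in> borel_measurable M"
      using bounded_measurable_measurable[OF gM] by simp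
    show "(\<lambda>\<omega>. g \<omega> * (\<Prod>j\<in>S. success_prob n j \<omega>)) \<in> borel_measurable M"
      by (rule bounded_measurable_measurable[OF bounded_measurable_mult[OF gM prod_p]])
  qed
  finally show ?thesis .
qed

corollary expectation_mult_I:
  "bounded_measurable M (F n) g \<Longrightarrow> j \<in> {1..N} \<Longrightarrow>
    expectation (\<lambda>\<omega>. g \<omega> * I (Suc n) j \<omega>) = expectation (\<lambda>\<omega>. g \<omega> * success_prob n j \<omega>)"
  using expectation_mult_prod_I[of n g "{j}"] by simp

definition noise :: "nat \<Rightarrow> nat \<Rightarrow> 'a \<Rightarrow> real" where
  "noise n j \<omega> = I (Suc n) j \<omega> - success_prob n j \<omega>"

lemma bounded_measurable_noise: "j \<in> {1..N} \<Longrightarrow> bounded_measurable M M (noise n j)"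
  unfolding noise_def by (intro bounded_measurable_diff bounded_measurable_I bounded_measurable_success_prob_M)

lemma abs_noise_le: "j \<in> {1..N} \<Longrightarrow> \<omega> \<in> space M \<Longrightarrow> \<bar>noise n j \<omega>\<bar> \<le> 1"
  unfolding noise_def using Irange[of j \<omega> n] success_prob_range[of j \<omega> n] by auto

lemma noise_centred:
  assumes g: "bounded_measurable M (F n) g" and j: "j \<in> {1..N}"
  shows "expectation (\<lambda>\<omega>. g \<omega> * noise n j \<omega>) = 0"
proof -
  have "integrable M (\<lambda>\<omega>. g \<omega> * I (Suc n) j \<omega>)" "integrable M (\<lambda>\<omega>. g \<omega> * success_prob n j \<omega>)"
    by (intro bounded_measurable_integrable bounded_measurable_mult bounded_measurable_F_M[OF g]
        bounded_measurable_I bounded_measurable_success_prob_M j)+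
  thus ?thesis unfolding noise_def using expectation_mult_I[OF g j] by (simp add: right_diff_distrib)
qed

lemma noise_product:
  assumes g: "bounded_measurable M (F n) g" and j: "j \<in> {1..N}" "k \<in> {1..N}"
  shows "expectation (\<lambda>\<omega>. g \<omega> * (noise n j \<omega> * noise n k \<omega>))
    = expectation (\<lambda>\<omega>. g \<omega> * (I (Suc n) j \<omega> * I (Suc n) k \<omega>))
        - expectation (\<lambda>\<omega>. g \<omega> * (success_prob n j \<omega> * success_prob n k \<omega>))"
proof -
  let ?p = "success_prob n"
  note gM = bounded_measurable_F_M[OF g]
  have gp: "bounded_measurable M (F n) (\<lambda>\<omega>. g \<omega> * ?p l \<omega>)" if "l \<in> {1..N}" for l
    using that by (intro bounded_measurable_mult g bounded_measurable_success_prob order_refl)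
  have int: "integrable M (\<lambda>\<omega>. g \<omega> * (I (Suc n) j \<omega> * I (Suc n) k \<omega>))" "integrable M (\<lambda>\<omega>. g \<omega> * ?p k \<omega> * I (Suc n) j \<omega>)"
    "integrable M (\<lambda>\<omega>. g \<omega> * ?p j \<omega> * noise n k \<omega>)"
    by (intro bounded_measurable_integrable bounded_measurable_mult gM bounded_measurable_I bounded_measurable_noise
        bounded_measurable_success_prob_M j)+
  have "expectation (\<lambda>\<omega>. g \<omega> * (noise n j \<omega> * noise n k \<omega>))
      = expectation (\<lambda>\<omega>. g \<omega> * (I (Suc n) j \<omega> * I (Suc n) k \<omega>) - g \<omega> * ?p k \<omega> * I (Suc n) j \<omega> - g \<omega> * ?p j \<omega> * noise n k \<omega>)"
    by (simp add: noise_def algebra_simps)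
  also have "\<dots> = expectation (\<lambda>\<omega>. g \<omega> * (I (Suc n) j \<omega> * I (Suc n) k \<omega>)) - expectation (\<lambda>\<omega>. g \<omega> * ?p k \<omega> * I (Suc n) j \<omega>)"
    using int noise_centred[OF gp[OF j(1)] j(2)] by simp
  also have "expectation (\<lambda>\<omega>. g \<omega> * ?p k \<omega> * I (Suc n) j \<omega>) = expectation (\<lambda>\<omega>. g \<omega> * (?p j \<omega> * ?p k \<omega>))"
    using expectation_mult_I[OF gp[OF j(2)] j(1)] by (simp add: mult.assoc mult.commute mult.left_commute)
  finally show ?thesis .
qed

lemma noise_variance:
  assumes g: "bounded_measurable M (F n) g" and j: "j \<in> {1..N}"
  shows "expectation (\<lambda>\<omega>. g \<omega> * (noise n j \<omega> * noise n j \<omega>))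
    = expectation (\<lambda>\<omega>. g \<omega> * (success_prob n j \<omega> * (1 - success_prob n j \<omega>)))"
proof -
  have "expectation (\<lambda>\<omega>. g \<omega> * (I (Suc n) j \<omega> * I (Suc n) j \<omega>)) = expectation (\<lambda>\<omega>. g \<omega> * I (Suc n) j \<omega>)"
    by (rule Bochner_Integration.integral_cong) (use Irange[OF j] in auto)
  moreover have "integrable M (\<lambda>\<omega>. g \<omega> * success_prob n j \<omega>)"
    "integrable M (\<lambda>\<omega>. g \<omega> * (success_prob n j \<omega> * success_prob n j \<omega>))"
    by (intro bounded_measurable_integrable bounded_measurable_mult bounded_measurable_F_M[OF g]
      bounded_measurable_success_prob_M j)+
  ultimately show ?thesis
    using noise_product[OF g j j] expectation_mult_I[OF g j] by (simp add: right_diff_distrib)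
qed

lemma noise_uncorrelated:
  assumes g: "bounded_measurable M (F n) g" and j: "j \<in> {1..N}" "k \<in> {1..N}" "j \<noteq> k"
  shows "expectation (\<lambda>\<omega>. g \<omega> * (noise n j \<omega> * noise n k \<omega>)) = 0"
  using noise_product[OF g j(1,2)] expectation_mult_prod_I[OF g, of "{j, k}"] j by simp

definition mean_square_error :: "nat \<Rightarrow> real" where
  "mean_square_error n = (\<Sum>j=1..N. expectation (\<lambda>\<omega>. (Z n j \<omega> - q)\<^sup>2))"

lemma integrable_square_errors:
  assumes "j \<in> {1..N}"
  shows "integrable M (\<lambda>\<omega>. (Z n j \<omega> - q)\<^sup>2)" "integrable M (\<lambda>\<omega>. (success_prob n j \<omega> - q)\<^sup>2)"
  using assms by (auto intro!: bounded_measurable_integrable bounded_measurable_intros bounded_measurable_Z_M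
      bounded_measurable_success_prob_M)

lemma sum_success_prob_square_error_le:
  "(\<Sum>j=1..N. expectation (\<lambda>\<omega>. (success_prob n j \<omega> - q)\<^sup>2)) \<le> mean_square_error n"
proof -
  have mean: "(\<Sum>k=1..N. Z n k \<omega> - q) / real (card {1..N}) = Zbar N Z n \<omega> - q" for \<omega>
    using N unfolding Zbar_def by (simp add: sum_subtractf field_simps)
  have mix: "success_prob n j \<omega> - q = (1 - \<alpha>) * (Z n j \<omega> - q) + \<alpha> * (Zbar N Z n \<omega> - q)" for j \<omega>
    unfolding success_prob_def by (simp add: algebra_simps)
  have "(\<Sum>j=1..N. expectation (\<lambda>\<omega>. (success_prob n j \<omega> - q)\<^sup>2)) = expectation (\<lambda>\<omega>. \<Sum>j=1..N. (success_prob n j \<omega> - q)\<^sup>2)"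
    by (intro Bochner_Integration.integral_sum[symmetric] integrable_square_errors)
  also have "\<dots> \<le> expectation (\<lambda>\<omega>. \<Sum>j=1..N. (Z n j \<omega> - q)\<^sup>2)"
  proof (intro integral_mono Bochner_Integration.integrable_sum integrable_square_errors)
    show "(\<Sum>j=1..N. (success_prob n j \<omega> - q)\<^sup>2) \<le> (\<Sum>j=1..N. (Z n j \<omega> - q)\<^sup>2)" for \<omega>
      using sum_mix_mean_square_le[OF alpha, where S="{1..N}" and x="\<lambda>j. Z n j \<omega> - q"] unfolding mean mix .
  qed
  also have "\<dots> = mean_square_error n"
    unfolding mean_square_error_def by (intro Bochner_Integration.integral_sum integrable_square_errors)
  finally show ?thesis .
qed

lemma square_error_Suc:
  assumes j: "j \<in> {1..N}"
  shows "expectation (\<lambda>\<omega>. (Z (Suc n) j \<omega> - q)\<^sup>2)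
    \<le> (1 - r n) * expectation (\<lambda>\<omega>. (Z n j \<omega> - q)\<^sup>2) + r n * \<rho>\<^sup>2 * expectation (\<lambda>\<omega>. (success_prob n j \<omega> - q)\<^sup>2) + (r n)\<^sup>2"
proof -
  define drift where "drift = (\<lambda>\<omega>. (1 - r n) * (Z n j \<omega> - q) + r n * (\<rho> * (success_prob n j \<omega> - q)))"
  have drift: "bounded_measurable M (F n) (\<lambda>\<omega>. 2 * (r n * \<rho>) * drift \<omega>)"
    unfolding drift_def using j by (intro bounded_measurable_intros bounded_measurable_Z bounded_measurable_success_prob) auto
  note int = integrable_square_errors[OF j]
    bounded_measurable_integrable[OF bounded_measurable_mult[OF bounded_measurable_F_M[OF drift]
      bounded_measurable_noise[OF j]]]
  have pointwise: "(Z (Suc n) j \<omega> - q)\<^sup>2 \<le> (1 - r n) * (Z n j \<omega> - q)\<^sup>2 + r n * \<rho>\<^sup>2 * (success_prob n j \<omega> - q)\<^sup>2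
      + 2 * (r n * \<rho>) * drift \<omega> * noise n j \<omega> + (r n)\<^sup>2" if \<omega>: "\<omega> \<in> space M" for \<omega>
  proof -
    have "Z (Suc n) j \<omega> - q = drift \<omega> + r n * \<rho> * noise n j \<omega>"
      unfolding recur[OF j \<omega>] drift_def noise_def by (simp add: algebra_simps)
    moreover have "(drift \<omega>)\<^sup>2 \<le> (1 - r n) * (Z n j \<omega> - q)\<^sup>2 + r n * \<rho>\<^sup>2 * (success_prob n j \<omega> - q)\<^sup>2"
      using convex_combination_square_le[where a="r n" and x="Z n j \<omega> - q" and y="\<rho> * (success_prob n j \<omega> - q)"] r[of n]
      unfolding drift_def by (simp add: power_mult_distrib mult.assoc)
    moreover have "(r n * \<rho> * noise n j \<omega>)\<^sup>2 \<le> (r n)\<^sup>2"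
    proof -
      have "\<bar>\<rho> * noise n j \<omega>\<bar> \<le> 1" using abs_noise_le[OF j \<omega>, of n] rho by (simp add: abs_mult mult_le_one)
      hence "\<bar>r n * (\<rho> * noise n j \<omega>)\<bar> \<le> \<bar>r n\<bar>" using r[of n] by (simp add: abs_mult mult_left_le)
      thus ?thesis by (simp add: abs_le_square_iff mult.assoc)
    qed
    ultimately show ?thesis by (simp add: power2_sum mult.assoc mult.left_commute)
  qed
  have "expectation (\<lambda>\<omega>. (Z (Suc n) j \<omega> - q)\<^sup>2) \<le> expectation (\<lambda>\<omega>. (1 - r n) * (Z n j \<omega> - q)\<^sup>2
      + r n * \<rho>\<^sup>2 * (success_prob n j \<omega> - q)\<^sup>2 + 2 * (r n * \<rho>) * drift \<omega> * noise n j \<omega> + (r n)\<^sup>2)"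
    by (rule integral_mono[OF _ _ pointwise]) (use int integrable_square_errors[OF j, of "Suc n"] in simp_all)
  also have "\<dots> = (1 - r n) * expectation (\<lambda>\<omega>. (Z n j \<omega> - q)\<^sup>2)
      + r n * \<rho>\<^sup>2 * expectation (\<lambda>\<omega>. (success_prob n j \<omega> - q)\<^sup>2) + (r n)\<^sup>2"
    using int noise_centred[OF drift j] by (simp add: prob_space)
  finally show ?thesis .
qed

lemma mean_square_error_Suc:
  "mean_square_error (Suc n) \<le> (1 - (1 - \<rho>\<^sup>2) * r n) * mean_square_error n + real N * (r n)\<^sup>2"
proof -
  have "mean_square_error (Suc n) \<le> (\<Sum>j=1..N. (1 - r n) * expectation (\<lambda>\<omega>. (Z n j \<omega> - q)\<^sup>2)
      + r n * \<rho>\<^sup>2 * expectation (\<lambda>\<omega>. (success_prob n j \<omega> - q)\<^sup>2) + (r n)\<^sup>2)"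
    unfolding mean_square_error_def by (intro sum_mono square_error_Suc)
  also have "\<dots> = (1 - r n) * mean_square_error n
      + r n * \<rho>\<^sup>2 * (\<Sum>j=1..N. expectation (\<lambda>\<omega>. (success_prob n j \<omega> - q)\<^sup>2)) + real N * (r n)\<^sup>2"
    unfolding mean_square_error_def by (simp add: sum.distrib sum_distrib_left)
  also have "\<dots> \<le> (1 - r n) * mean_square_error n + r n * \<rho>\<^sup>2 * mean_square_error n + real N * (r n)\<^sup>2"
    using r[of n] by (intro add_right_mono add_left_mono mult_left_mono sum_success_prob_square_error_le) auto
  finally show ?thesis by (simp add: algebra_simps)
qed

lemma mean_square_error_tendsto_zero:
  assumes \<gamma>: "0 < \<gamma>" "\<gamma> \<le> 1" and c: "c > 0" and rate: "(\<lambda>n. real n powr \<gamma> * r n) \<longlonglongrightarrow> c"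
  shows "mean_square_error \<longlonglongrightarrow> 0"
proof (rule powr_contraction_tendsto_zero[OF \<gamma>, where d="\<lambda>n. (1 - \<rho>\<^sup>2) * r n" and e="\<lambda>n. real N * (r n)\<^sup>2"])
  have "\<rho>\<^sup>2 < 1" using rho by (simp add: power_less_one_iff abs_square_less_1)
  thus "(1 - \<rho>\<^sup>2) * c > 0" using c by simp
  show "0 \<le> mean_square_error n" for n unfolding mean_square_error_def by (intro sum_nonneg integral_nonneg_AE) auto
  show "\<forall>\<^sub>F n in sequentially. mean_square_error (Suc n) \<le> (1 - (1 - \<rho>\<^sup>2) * r n) * mean_square_error n + real N * (r n)\<^sup>2"
    using mean_square_error_Suc by simp
  show "(\<lambda>n. real n powr \<gamma> * ((1 - \<rho>\<^sup>2) * r n)) \<longlonglongrightarrow> (1 - \<rho>\<^sup>2) * c"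
    using tendsto_mult_left[OF rate, of "1 - \<rho>\<^sup>2"] by (simp add: mult.left_commute)
  have "(\<lambda>n. real N * ((real n powr \<gamma> * r n) * r n)) \<longlonglongrightarrow> real N * (c * 0)"
    by (intro tendsto_intros rate powr_rate_tendsto_zero[OF rate \<gamma>(1)])
  thus "(\<lambda>n. real n powr \<gamma> * (real N * (r n)\<^sup>2)) \<longlonglongrightarrow> 0" by (simp add: power2_eq_square algebra_simps)
qed

definition mean_abs_error :: "nat \<Rightarrow> real" where
  "mean_abs_error n = (\<Sum>j=1..N. expectation (\<lambda>\<omega>. \<bar>success_prob n j \<omega> - q\<bar>))"

lemma integrable_success_prob_error: "j \<in> {1..N} \<Longrightarrow> integrable M (\<lambda>\<omega>. success_prob n j \<omega> - q)"
  by (intro bounded_measurable_integrable bounded_measurable_intros bounded_measurable_success_prob_M)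

lemma mean_abs_error_nonneg: "0 \<le> mean_abs_error n"
  unfolding mean_abs_error_def by (intro sum_nonneg integral_nonneg_AE) auto

lemma mean_abs_error_le: "mean_abs_error n \<le> real N * sqrt (mean_square_error n)"
proof -
  have "expectation (\<lambda>\<omega>. \<bar>success_prob n j \<omega> - q\<bar>) \<le> sqrt (mean_square_error n)" if j: "j \<in> {1..N}" for j
  proof -
    have "expectation (\<lambda>\<omega>. (success_prob n j \<omega> - q)\<^sup>2) \<le> (\<Sum>j=1..N. expectation (\<lambda>\<omega>. (success_prob n j \<omega> - q)\<^sup>2))"
      by (rule member_le_sum[OF j]) (auto intro!: integral_nonneg_AE)
    also note sum_success_prob_square_error_le
    finally show ?thesis
      using expectation_abs_le_sqrt[OF integrable_success_prob_error[OF j] integrable_square_errors(2)[OF j]]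
      by (meson order_trans real_sqrt_le_mono)
  qed
  hence "mean_abs_error n \<le> (\<Sum>j=1..N. sqrt (mean_square_error n))" unfolding mean_abs_error_def by (rule sum_mono)
  thus ?thesis by simp
qed

lemma mean_abs_error_tendsto_zero:
  assumes \<gamma>: "0 < \<gamma>" "\<gamma> \<le> 1" and c: "c > 0" and rate: "(\<lambda>n. real n powr \<gamma> * r n) \<longlonglongrightarrow> c"
  shows "mean_abs_error \<longlonglongrightarrow> 0"
proof (rule tendsto_sandwich[OF always_eventually always_eventually tendsto_const])
  have "(\<lambda>n. real N * sqrt (mean_square_error n)) \<longlonglongrightarrow> real N * sqrt 0"
    by (intro tendsto_intros mean_square_error_tendsto_zero[OF assms])
  thus "(\<lambda>n. real N * sqrt (mean_square_error n)) \<longlonglongrightarrow> 0" by simp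
qed (use mean_abs_error_nonneg mean_abs_error_le in auto)

definition centre :: "(nat \<Rightarrow> real) \<Rightarrow> real" where
  "centre x = x i - (\<Sum>j=1..N. x j) / real N"

definition centring_coeff :: "nat \<Rightarrow> real" where
  "centring_coeff j = of_bool (j = i) - 1 / real N"

lemma centre_add: "centre (\<lambda>j. x j + y j) = centre x + centre y"
  unfolding centre_def by (simp add: sum.distrib add_divide_distrib)

lemma centre_cmult: "centre (\<lambda>j. a * x j) = a * centre x"
  unfolding centre_def by (simp add: sum_distrib_left[symmetric] right_diff_distrib)

lemma centre_const: "centre (\<lambda>_. a) = 0"
  unfolding centre_def using N by simp

lemma centre_eq_sum: "centre x = (\<Sum>j=1..N. centring_coeff j * x j)"
proof -
  have "(\<Sum>j=1..N. centring_coeff j * x j) = (\<Sum>j=1..N. (if j = i then x j else 0) - x j / real N)"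
    unfolding centring_coeff_def by (intro sum.cong) (auto simp: algebra_simps)
  thus ?thesis using i by (simp add: centre_def sum_subtractf sum_divide_distrib)
qed

lemma sum_centring_coeff_square: "(\<Sum>j=1..N. (centring_coeff j)\<^sup>2) = 1 - 1 / real N"
proof -
  have "(\<Sum>j=1..N. (centring_coeff j)\<^sup>2) = centre (\<lambda>j. of_bool (j = i) + (- 1 / real N))"
    unfolding centre_eq_sum by (simp add: centring_coeff_def power2_eq_square)
  also have "\<dots> = centre (\<lambda>j. of_bool (j = i))" unfolding centre_add centre_const by simp
  also have "\<dots> = 1 - 1 / real N" unfolding centre_def using i by (simp add: of_bool_def)
  finally show ?thesis .
qed

lemma centring_coeff_square_le_one: "j \<in> {1..N} \<Longrightarrow> (centring_coeff j)\<^sup>2 \<le> 1"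
proof -
  assume "j \<in> {1..N}"
  hence "(centring_coeff j)\<^sup>2 \<le> (\<Sum>j=1..N. (centring_coeff j)\<^sup>2)" by (intro member_le_sum) auto
  also have "\<dots> \<le> 1" unfolding sum_centring_coeff_square by simp
  finally show ?thesis .
qed

definition deviation :: "nat \<Rightarrow> 'a \<Rightarrow> real" where "deviation n \<omega> = centre (\<lambda>j. Z n j \<omega>)"

definition centred_noise :: "nat \<Rightarrow> 'a \<Rightarrow> real" where "centred_noise n \<omega> = centre (\<lambda>j. noise n j \<omega>)"

lemma deviation_eq: "deviation n \<omega> = Z n i \<omega> - Zbar N Z n \<omega>"
  unfolding deviation_def centre_def Zbar_def ..

lemma bounded_measurable_deviation: "k \<le> n \<Longrightarrow> bounded_measurable M (F n) (deviation k)"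
  unfolding deviation_eq[abs_def] using i by (intro bounded_measurable_diff bounded_measurable_Z bounded_measurable_Zbar)

lemma deviation_measurable: "deviation n \<in> borel_measurable M"
  by (rule bounded_measurable_measurable[OF bounded_measurable_F_M[OF bounded_measurable_deviation[OF order_refl]]])

lemma abs_deviation_le: "\<omega> \<in> space M \<Longrightarrow> \<bar>deviation n \<omega>\<bar> \<le> 1"
  unfolding deviation_eq using Zrange[OF i, of \<omega> n] Zbar_range[of \<omega> n] by auto

lemma abs_centred_noise_le:
  assumes \<omega>: "\<omega> \<in> space M" shows "\<bar>centred_noise n \<omega>\<bar> \<le> 2"
proof -
  have "\<bar>\<Sum>j=1..N. noise n j \<omega>\<bar> \<le> (\<Sum>j=1..N. 1)"
    by (rule order_trans[OF sum_abs]) (intro sum_mono abs_noise_le \<omega>)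
  hence "\<bar>(\<Sum>j=1..N. noise n j \<omega>) / real N\<bar> \<le> 1" using N by (simp add: field_simps)
  thus ?thesis unfolding centred_noise_def centre_def using abs_noise_le[OF i \<omega>, of n] by linarith
qed

lemma deviation_Suc:
  assumes \<omega>: "\<omega> \<in> space M"
  shows "deviation (Suc n) \<omega> = (1 - (1 - \<rho> * (1 - \<alpha>)) * r n) * deviation n \<omega> + r n * \<rho> * centred_noise n \<omega>"
proof -
  have "deviation (Suc n) \<omega> = centre (\<lambda>j. (1 - r n) * Z n j \<omega> + (r n * \<rho> * I (Suc n) j \<omega> + r n * (1 - \<rho>) * q))"
    unfolding deviation_def centre_def using i
    by (intro arg_cong2[where f=minus] arg_cong2[where f=divide] sum.cong refl)
      (simp_all add: recur[OF _ \<omega>] distrib_left mult.assoc)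
  also have "\<dots> = (1 - r n) * deviation n \<omega> + r n * \<rho> * centre (\<lambda>j. I (Suc n) j \<omega>)"
    unfolding centre_add centre_cmult centre_const deviation_def by simp
  also have "centre (\<lambda>j. I (Suc n) j \<omega>) = centre (\<lambda>j. noise n j \<omega> + ((1 - \<alpha>) * Z n j \<omega> + \<alpha> * Zbar N Z n \<omega>))"
    unfolding noise_def success_prob_def by simp
  also have "\<dots> = centred_noise n \<omega> + (1 - \<alpha>) * deviation n \<omega>"
    unfolding centre_add centre_cmult centre_const deviation_def centred_noise_def by simp
  finally show ?thesis by (simp add: algebra_simps)
qed

lemma bounded_measurable_centred_noise: "bounded_measurable M M (centred_noise n)"
  unfolding centred_noise_def[abs_def] centre_eq_sum
  by (intro bounded_measurable_sum bounded_measurable_cmult bounded_measurable_noise)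

lemma centred_noise_centred:
  assumes g: "bounded_measurable M (F n) g" shows "expectation (\<lambda>\<omega>. g \<omega> * centred_noise n \<omega>) = 0"
proof -
  have "expectation (\<lambda>\<omega>. g \<omega> * centred_noise n \<omega>) = expectation (\<lambda>\<omega>. \<Sum>j=1..N. centring_coeff j * (g \<omega> * noise n j \<omega>))"
    unfolding centred_noise_def centre_eq_sum by (simp add: sum_distrib_left mult.left_commute)
  also have "\<dots> = (\<Sum>j=1..N. expectation (\<lambda>\<omega>. centring_coeff j * (g \<omega> * noise n j \<omega>)))"
    by (intro Bochner_Integration.integral_sum bounded_measurable_integrable bounded_measurable_cmult
        bounded_measurable_mult bounded_measurable_F_M[OF g] bounded_measurable_noise)
  also have "\<dots> = 0" using noise_centred[OF g] by (intro sum.neutral) auto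
  finally show ?thesis .
qed

definition noise_variance_sum :: "nat \<Rightarrow> 'a \<Rightarrow> real" where
  "noise_variance_sum n \<omega> = (\<Sum>j=1..N. (centring_coeff j)\<^sup>2 * (success_prob n j \<omega> * (1 - success_prob n j \<omega>)))"

lemma centred_noise_second_moment:
  assumes g: "bounded_measurable M (F n) g"
  shows "expectation (\<lambda>\<omega>. g \<omega> * (centred_noise n \<omega>)\<^sup>2) = expectation (\<lambda>\<omega>. g \<omega> * noise_variance_sum n \<omega>)"
proof -
  let ?w = centring_coeff and ?e = "noise n" and ?v = "\<lambda>j \<omega>. success_prob n j \<omega> * (1 - success_prob n j \<omega>)"
  note gM = bounded_measurable_F_M[OF g]
  have int: "integrable M (\<lambda>\<omega>. ?w j * ?w k * (g \<omega> * (?e j \<omega> * ?e k \<omega>)))" if "j \<in> {1..N}" "k \<in> {1..N}" for j k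
    using that
    by (intro bounded_measurable_integrable bounded_measurable_cmult bounded_measurable_mult gM bounded_measurable_noise)
  have int_v: "integrable M (\<lambda>\<omega>. (?w j)\<^sup>2 * (g \<omega> * ?v j \<omega>))" if "j \<in> {1..N}" for j
    using that by (intro bounded_measurable_integrable bounded_measurable_intros gM bounded_measurable_success_prob_M)
  have "expectation (\<lambda>\<omega>. g \<omega> * (centred_noise n \<omega>)\<^sup>2)
      = expectation (\<lambda>\<omega>. \<Sum>j=1..N. \<Sum>k=1..N. ?w j * ?w k * (g \<omega> * (?e j \<omega> * ?e k \<omega>)))"
    unfolding centred_noise_def centre_eq_sum power2_eq_square sum_product
    by (simp add: sum_distrib_left mult.assoc mult.left_commute)
  also have "\<dots> = (\<Sum>j=1..N. expectation (\<lambda>\<omega>. \<Sum>k=1..N. ?w j * ?w k * (g \<omega> * (?e j \<omega> * ?e k \<omega>))))"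
    by (intro Bochner_Integration.integral_sum Bochner_Integration.integrable_sum int)
  also have "\<dots> = (\<Sum>j=1..N. \<Sum>k=1..N. expectation (\<lambda>\<omega>. ?w j * ?w k * (g \<omega> * (?e j \<omega> * ?e k \<omega>))))"
    by (intro sum.cong refl Bochner_Integration.integral_sum int)
  also have "\<dots> = (\<Sum>j=1..N. \<Sum>k=1..N. if k = j then (?w j)\<^sup>2 * expectation (\<lambda>\<omega>. g \<omega> * ?v j \<omega>) else 0)"
    by (intro sum.cong refl) (use noise_variance[OF g] noise_uncorrelated[OF g] in \<open>auto simp: power2_eq_square\<close>)
  also have "\<dots> = (\<Sum>j=1..N. expectation (\<lambda>\<omega>. (?w j)\<^sup>2 * (g \<omega> * ?v j \<omega>)))" by simp
  also have "\<dots> = expectation (\<lambda>\<omega>. \<Sum>j=1..N. (?w j)\<^sup>2 * (g \<omega> * ?v j \<omega>))"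
    by (intro Bochner_Integration.integral_sum[symmetric] int_v)
  also have "\<dots> = expectation (\<lambda>\<omega>. g \<omega> * noise_variance_sum n \<omega>)"
    unfolding noise_variance_sum_def by (simp add: sum_distrib_left mult.left_commute)
  finally show ?thesis .
qed

definition limit_variance :: real where "limit_variance = (1 - 1 / real N) * (q * (1 - q))"

lemma limit_variance_range: "0 \<le> limit_variance" "limit_variance \<le> 1"
proof -
  have "0 \<le> 1 - 1 / real N" "1 - 1 / real N \<le> 1" using N by auto
  moreover have "0 \<le> q * (1 - q)" "q * (1 - q) \<le> 1" using q by (auto intro: mult_le_one)
  ultimately show "0 \<le> limit_variance" "limit_variance \<le> 1" unfolding limit_variance_def by (auto intro: mult_le_one)
qed

lemma noise_variance_sum_error:
  assumes \<omega>: "\<omega> \<in> space M"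
  shows "\<bar>noise_variance_sum n \<omega> - limit_variance\<bar> \<le> (\<Sum>j=1..N. \<bar>success_prob n j \<omega> - q\<bar>)"
proof -
  let ?p = "\<lambda>j. success_prob n j \<omega>"
  have difference: "noise_variance_sum n \<omega> - limit_variance
      = (\<Sum>j=1..N. (centring_coeff j)\<^sup>2 * (?p j * (1 - ?p j) - q * (1 - q)))"
    unfolding noise_variance_sum_def limit_variance_def sum_centring_coeff_square[symmetric]
    by (simp only: right_diff_distrib sum_subtractf sum_distrib_right)
  have "\<bar>noise_variance_sum n \<omega> - limit_variance\<bar> \<le> (\<Sum>j=1..N. \<bar>(centring_coeff j)\<^sup>2 * (?p j * (1 - ?p j) - q * (1 - q))\<bar>)"
    unfolding difference by (rule sum_abs)
  also have "\<dots> \<le> (\<Sum>j=1..N. \<bar>?p j - q\<bar>)"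
  proof (rule sum_mono)
    fix j assume j: "j \<in> {1..N}"
    have "\<bar>?p j * (1 - ?p j) - q * (1 - q)\<bar> \<le> \<bar>?p j - q\<bar>"
      by (rule bernoulli_variance_Lipschitz) (use success_prob_range[OF j \<omega>] q in auto)
    with centring_coeff_square_le_one[OF j]
    have "(centring_coeff j)\<^sup>2 * \<bar>?p j * (1 - ?p j) - q * (1 - q)\<bar> \<le> 1 * \<bar>?p j - q\<bar>" by (rule mult_mono) auto
    thus "\<bar>(centring_coeff j)\<^sup>2 * (?p j * (1 - ?p j) - q * (1 - q))\<bar> \<le> \<bar>?p j - q\<bar>"
      by (simp only: abs_mult abs_power2 mult_1)
  qed
  finally show ?thesis .
qed

lemma centred_noise_variance_error:
  assumes g: "bounded_measurable M (F n) g" and B: "\<And>\<omega>. \<omega> \<in> space M \<Longrightarrow> \<bar>g \<omega>\<bar> \<le> B"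
  shows "\<bar>expectation (\<lambda>\<omega>. g \<omega> * ((centred_noise n \<omega>)\<^sup>2 - limit_variance))\<bar> \<le> B * mean_abs_error n"
proof -
  let ?\<sigma> = "noise_variance_sum n"
  note gM = bounded_measurable_F_M[OF g]
  have \<sigma>: "bounded_measurable M M ?\<sigma>"
    unfolding noise_variance_sum_def by (intro bounded_measurable_intros bounded_measurable_success_prob_M)
  have int: "integrable M (\<lambda>\<omega>. g \<omega> * (centred_noise n \<omega>)\<^sup>2)" "integrable M (\<lambda>\<omega>. g \<omega> * limit_variance)"
      "integrable M (\<lambda>\<omega>. g \<omega> * ?\<sigma> \<omega>)"
    by (intro bounded_measurable_integrable bounded_measurable_intros gM bounded_measurable_centred_noise \<sigma>)+
  have "expectation (\<lambda>\<omega>. g \<omega> * ((centred_noise n \<omega>)\<^sup>2 - limit_variance)) = expectation (\<lambda>\<omega>. g \<omega> * (?\<sigma> \<omega> - limit_variance))"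
    unfolding right_diff_distrib using int centred_noise_second_moment[OF g] by simp
  also have "\<bar>\<dots>\<bar> \<le> expectation (\<lambda>\<omega>. \<bar>g \<omega> * (?\<sigma> \<omega> - limit_variance)\<bar>)" by (rule integral_abs_bound)
  also have "\<dots> \<le> expectation (\<lambda>\<omega>. B * (\<Sum>j=1..N. \<bar>success_prob n j \<omega> - q\<bar>))"
  proof (rule integral_mono)
    show "integrable M (\<lambda>\<omega>. \<bar>g \<omega> * (?\<sigma> \<omega> - limit_variance)\<bar>)"
      by (intro integrable_abs bounded_measurable_integrable bounded_measurable_intros gM \<sigma>)
    show "integrable M (\<lambda>\<omega>. B * (\<Sum>j=1..N. \<bar>success_prob n j \<omega> - q\<bar>))"
      by (intro integrable_mult_right Bochner_Integration.integrable_sum integrable_abs integrable_success_prob_error)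
    fix \<omega> assume \<omega>: "\<omega> \<in> space M"
    show "\<bar>g \<omega> * (?\<sigma> \<omega> - limit_variance)\<bar> \<le> B * (\<Sum>j=1..N. \<bar>success_prob n j \<omega> - q\<bar>)"
      unfolding abs_mult using B[OF \<omega>] by (intro mult_mono noise_variance_sum_error \<omega>) auto
  qed
  also have "\<dots> = B * mean_abs_error n"
    unfolding mean_abs_error_def using integrable_success_prob_error by (simp add: Bochner_Integration.integral_sum)
  finally show ?thesis .
qed

end

section \<open>Convergence of the rescaled martingale\<close>

context step_sizes
begin

definition step_coeff :: "nat \<Rightarrow> nat \<Rightarrow> real" where
  "step_coeff n k = scale n * (r k / damping (Suc k))"

definition growth :: "real \<Rightarrow> real" where
  "growth t = limit_ratio \<gamma> t powr (-(\<gamma>/2)) * weight t"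

definition variance_clock :: "real \<Rightarrow> real" where
  "variance_clock t = (growth t)\<^sup>2 * (c\<^sup>2 / (2 * \<theta>))"

lemma step_coeff_nonneg: "step_coeff n k \<ge> 0"
  unfolding step_coeff_def using scale_nonneg[of n] r(1)[of k] damping_pos[of "Suc k"] by simp

lemma variance_clock_continuous: "continuous_on {0..} variance_clock"
  unfolding variance_clock_def growth_def limit_ratio_def
  by (intro continuous_intros weight_continuous; cases "\<gamma> = 1"; use \<theta>_pos in \<open>auto intro!: continuous_intros\<close>)

lemma step_coeff_power_sum_tendsto:
  assumes p: "p \<ge> 1" and g: "(\<lambda>n. real n powr (\<gamma> * (1 - real p / 2)) * g n) \<longlonglongrightarrow> E" and t: "t \<ge> 0"
  shows "(\<lambda>n. \<Sum>k<time_index \<gamma> n t. step_coeff n k ^ p * g k) \<longlonglongrightarrow> growth t ^ p * (c ^ p * E / (real p * \<theta>))"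
proof (rule Lim_transform_eventually)
  let ?S = "\<lambda>n. scale n ^ p * (\<Sum>k<n. (r k / damping (Suc k)) ^ p * g k)" and ?i = "\<lambda>n. time_index \<gamma> n t"
  show "(\<lambda>n. (scale n / scale (?i n)) ^ p * ?S (?i n)) \<longlonglongrightarrow> growth t ^ p * (c ^ p * E / (real p * \<theta>))"
    unfolding growth_def
    by (intro tendsto_mult tendsto_power scale_ratio_tendsto[OF t]
        filterlim_compose[OF scale_power_sum_tendsto[OF p g] time_index_at_top[OF t]])
  show "\<forall>\<^sub>F n in sequentially. (scale n / scale (?i n)) ^ p * ?S (?i n) = (\<Sum>k<?i n. step_coeff n k ^ p * g k)"
  proof (rule eventually_sequentiallyI[of 1])
    fix n :: nat assume "n \<ge> 1"
    hence "scale (?i n) > 0" using time_index_ge[OF t, of n \<gamma>] by (intro scale_pos) simp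
    thus "(scale n / scale (?i n)) ^ p * ?S (?i n) = (\<Sum>k<?i n. step_coeff n k ^ p * g k)"
      by (simp add: step_coeff_def power_mult_distrib power_divide sum_distrib_left mult.assoc)
  qed
qed

lemma step_coeff_square_sum_tendsto:
  assumes "t \<ge> 0" and g: "g \<longlonglongrightarrow> E"
  shows "(\<lambda>n. \<Sum>k<time_index \<gamma> n t. (step_coeff n k)\<^sup>2 * g k) \<longlonglongrightarrow> variance_clock t * E"
proof -
  have "(\<lambda>n. real n powr (\<gamma> * (1 - real 2 / 2)) * g n) \<longlonglongrightarrow> E"
    by (rule Lim_transform_eventually[OF g]) (rule eventually_sequentiallyI[of 1], simp)
  from step_coeff_power_sum_tendsto[OF _ this assms(1)] show ?thesis
    by (simp add: variance_clock_def mult.assoc)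
qed

lemma step_coeff_cube_sum_tendsto_zero:
  assumes t: "t \<ge> 0" shows "(\<lambda>n. \<Sum>k<time_index \<gamma> n t. step_coeff n k ^ 3) \<longlonglongrightarrow> 0"
proof -
  have "(\<lambda>n. real n powr (\<gamma> * (1 - real 3 / 2)) * 1) \<longlonglongrightarrow> 0" using \<gamma>(1) by real_asymp
  from step_coeff_power_sum_tendsto[OF _ this t] show ?thesis by simp
qed

lemma recursion_increment:
  assumes "x (Suc k) = (1 - \<beta> * r k) * x k + r k * y"
  shows "step_coeff n k * y = scale n * (x (Suc k) / damping (Suc k) - x k / damping k)"
  unfolding assms step_coeff_def damping_Suc using factor_pos[of k] damping_pos[of k] by (simp add: field_simps)

lemma rescaled_recursion_close:
  fixes x y :: "nat \<Rightarrow> real"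
  assumes recursion: "\<And>k. x (Suc k) = (1 - \<beta> * r k) * x k + r k * y k" and initial: "\<bar>x 0\<bar> \<le> 1"
  defines "\<And>k. S n k \<equiv> \<Sum>l<k. step_coeff n l * y l"
  shows "\<bar>real n powr (\<gamma>/2) * weight t * x k - S n k\<bar>
    \<le> \<bar>weight t * damping k / damping n - 1\<bar> * (scale n + \<bar>S n k\<bar>) + scale n"
proof -
  let ?R = "weight t * damping k / damping n"
  have "S n k = scale n * (x k / damping k - x 0 / damping 0)"
    unfolding S_def recursion_increment[where x=x, OF recursion] sum_distrib_left[symmetric]
      sum_lessThan_telescope[where f="\<lambda>l. x l / damping l"] ..
  hence solution: "scale n * (x k / damping k) = scale n * x 0 + S n k" by (simp add: damping_def right_diff_distrib)
  have "real n powr (\<gamma>/2) * weight t * x k = ?R * (scale n * (x k / damping k))"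
    unfolding scale_def using damping_pos[of n] damping_pos[of k] by simp
  hence "real n powr (\<gamma>/2) * weight t * x k - S n k = (?R - 1) * (scale n * x 0 + S n k) + scale n * x 0"
    unfolding solution by (simp add: algebra_simps)
  hence "\<bar>real n powr (\<gamma>/2) * weight t * x k - S n k\<bar> \<le> \<bar>?R - 1\<bar> * \<bar>scale n * x 0 + S n k\<bar> + \<bar>scale n * x 0\<bar>"
    using abs_triangle_ineq[of "(?R - 1) * (scale n * x 0 + S n k)" "scale n * x 0"] by (simp only: abs_mult)
  moreover have x0: "\<bar>scale n * x 0\<bar> \<le> scale n"
    using initial scale_nonneg[of n] by (simp add: abs_mult mult_left_le)
  moreover have "\<bar>?R - 1\<bar> * \<bar>scale n * x 0 + S n k\<bar> \<le> \<bar>?R - 1\<bar> * (scale n + \<bar>S n k\<bar>)"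
    using x0 by (intro mult_left_mono) auto
  ultimately show ?thesis by linarith
qed

lemma variance_clock_subcritical: "\<gamma> < 1 \<Longrightarrow> variance_clock t = c / (2 * \<beta>) * exp (2 * c * \<beta> * t)"
proof -
  have "(exp (c * \<beta> * t))\<^sup>2 = exp (2 * c * \<beta> * t)" by (simp add: power2_eq_square mult_exp_exp)
  moreover assume "\<gamma> < 1"
  ultimately show ?thesis
    using c \<beta> unfolding variance_clock_def growth_def weight_def \<theta>_def limit_ratio_def by (simp add: power2_eq_square)
qed

lemma variance_clock_critical: "\<gamma> = 1 \<Longrightarrow> variance_clock t = c\<^sup>2 / (2 * c * \<beta> - 1) * (1 + t) powr (2 * c * \<beta> - 1)"
proof -
  have "((1 + t) powr (-(1/2)) * (1 + t) powr (c * \<beta>))\<^sup>2 = (1 + t) powr (2 * c * \<beta> - 1)"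
    by (simp add: powr_def power2_eq_square mult_exp_exp algebra_simps)
  moreover assume "\<gamma> = 1"
  ultimately show ?thesis
    unfolding variance_clock_def growth_def weight_def \<theta>_def limit_ratio_def by (simp add: right_diff_distrib mult.assoc)
qed

end

lemma (in reinforcement) beta_range: "0 < 1 - \<rho> * (1 - \<alpha>)" "1 - \<rho> * (1 - \<alpha>) \<le> 1"
proof -
  have "\<rho> * (1 - \<alpha>) \<le> \<rho> * 1" using rho alpha by (intro mult_left_mono) auto
  thus "0 < 1 - \<rho> * (1 - \<alpha>)" using rho by simp
  show "1 - \<rho> * (1 - \<alpha>) \<le> 1" using rho alpha by simp
qed

locale fluctuation = reinforcement M Z I N \<rho> \<alpha> q r i + steps: step_sizes r c \<gamma> "1 - \<rho> * (1 - \<alpha>)"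
  for M :: "'a measure" and Z I N \<rho> \<alpha> q r i c \<gamma>
begin

definition martingale_increment :: "nat \<Rightarrow> nat \<Rightarrow> 'a \<Rightarrow> real" where
  "martingale_increment n k \<omega> = steps.step_coeff n k * (\<rho> * centred_noise k \<omega>)"

lemma deviation_recursion:
  "\<omega> \<in> space M \<Longrightarrow> deviation (Suc k) \<omega> = (1 - (1 - \<rho> * (1 - \<alpha>)) * r k) * deviation k \<omega> + r k * (\<rho> * centred_noise k \<omega>)"
  using deviation_Suc[of \<omega> k] by (simp add: mult.assoc)

lemma martingale_increment_differences:
  "bounded_martingale_differences M F (martingale_increment n) (\<lambda>k. 2 * steps.step_coeff n k)"
proof unfold_locales
  fix k l :: nat assume "l < k"
  hence "bounded_measurable M (F k) (\<lambda>\<omega>. steps.scale n *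
      (1 / steps.damping (Suc l) * deviation (Suc l) \<omega> - 1 / steps.damping l * deviation l \<omega>))"
    by (intro bounded_measurable_cmult bounded_measurable_diff bounded_measurable_deviation) auto
  moreover have "martingale_increment n l \<omega> = steps.scale n *
      (1 / steps.damping (Suc l) * deviation (Suc l) \<omega> - 1 / steps.damping l * deviation l \<omega>)" if "\<omega> \<in> space (F k)" for \<omega>
    unfolding martingale_increment_def
    using steps.recursion_increment[where x="\<lambda>k. deviation k \<omega>", OF deviation_recursion] that by simp
  ultimately show "martingale_increment n l \<in> borel_measurable (F k)"
    using bounded_measurable_measurable by (subst measurable_cong) auto
next
  fix l \<omega> assume "\<omega> \<in> space M"
  hence "\<bar>\<rho> * centred_noise l \<omega>\<bar> \<le> 1 * 2"
    unfolding abs_mult using rho by (intro mult_mono abs_centred_noise_le) auto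
  from mult_left_mono[OF this steps.step_coeff_nonneg] show "\<bar>martingale_increment n l \<omega>\<bar> \<le> 2 * steps.step_coeff n l"
    unfolding martingale_increment_def abs_mult[of "steps.step_coeff n l"] by (simp add: steps.step_coeff_nonneg mult.commute)
next
  fix k g assume "bounded_measurable M (F k) g"
  from centred_noise_centred[OF bounded_measurable_cmult[OF this, of "steps.step_coeff n k * \<rho>"]]
  show "expectation (\<lambda>\<omega>. g \<omega> * martingale_increment n k \<omega>) = 0"
    unfolding martingale_increment_def by (simp add: mult.assoc mult.left_commute)
qed (rule subalgebra_F)

lemma martingale_increment_variance_error:
  assumes g: "bounded_measurable M (F k) g" and B: "\<And>\<omega>. \<omega> \<in> space M \<Longrightarrow> \<bar>g \<omega>\<bar> \<le> B"
  shows "\<bar>expectation (\<lambda>\<omega>. g \<omega> * ((martingale_increment n k \<omega>)\<^sup>2 - (steps.step_coeff n k)\<^sup>2 * (\<rho>\<^sup>2 * limit_variance)))\<bar>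
    \<le> B * ((steps.step_coeff n k)\<^sup>2 * mean_abs_error k)"
proof -
  let ?a = "(steps.step_coeff n k)\<^sup>2"
  have "\<rho>\<^sup>2 \<le> 1" using rho by (simp add: abs_square_le_1)
  hence "\<bar>?a * \<rho>\<^sup>2 * g \<omega>\<bar> \<le> ?a * B" if "\<omega> \<in> space M" for \<omega>
    using mult_mono[OF _ B[OF that], of "\<rho>\<^sup>2" 1] by (simp add: abs_mult mult.assoc mult_left_mono)
  from centred_noise_variance_error[OF bounded_measurable_cmult[OF g] this]
  have "\<bar>expectation (\<lambda>\<omega>. ?a * \<rho>\<^sup>2 * g \<omega> * ((centred_noise k \<omega>)\<^sup>2 - limit_variance))\<bar> \<le> ?a * B * mean_abs_error k" .
  moreover have "g \<omega> * ((martingale_increment n k \<omega>)\<^sup>2 - ?a * (\<rho>\<^sup>2 * limit_variance))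
      = ?a * \<rho>\<^sup>2 * g \<omega> * ((centred_noise k \<omega>)\<^sup>2 - limit_variance)" for \<omega>
    unfolding martingale_increment_def by (simp add: power_mult_distrib algebra_simps)
  ultimately show ?thesis by (simp only: mult_ac)
qed

sublocale array: martingale_array M "\<lambda>_. F" martingale_increment "\<lambda>n k. 2 * steps.step_coeff n k"
  "\<lambda>n k. (steps.step_coeff n k)\<^sup>2 * (\<rho>\<^sup>2 * limit_variance)" "\<lambda>n k. (steps.step_coeff n k)\<^sup>2 * mean_abs_error k"
  "time_index \<gamma>" "\<lambda>t. steps.variance_clock t * (\<rho>\<^sup>2 * limit_variance)" "\<lambda>t. steps.variance_clock t * 4"
proof (intro martingale_array.intro martingale_array_axioms.intro)
  show "bounded_martingale_differences M F (martingale_increment n) (\<lambda>k. 2 * steps.step_coeff n k)" for n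
    by (rule martingale_increment_differences)
  fix n k
  show "0 \<le> (steps.step_coeff n k)\<^sup>2 * (\<rho>\<^sup>2 * limit_variance)" using limit_variance_range by simp
  have "\<rho>\<^sup>2 * limit_variance \<le> 1" using limit_variance_range rho by (intro mult_le_one) (auto simp: abs_square_le_1)
  thus "(steps.step_coeff n k)\<^sup>2 * (\<rho>\<^sup>2 * limit_variance) \<le> (2 * steps.step_coeff n k)\<^sup>2"
    unfolding power_mult_distrib by (subst mult.commute) (intro mult_right_mono, auto)
next
  fix t :: real assume t: "t \<ge> 0"
  show "(\<lambda>n. \<Sum>l<time_index \<gamma> n t. (steps.step_coeff n l)\<^sup>2 * (\<rho>\<^sup>2 * limit_variance))
      \<longlonglongrightarrow> steps.variance_clock t * (\<rho>\<^sup>2 * limit_variance)"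
    by (intro steps.step_coeff_square_sum_tendsto t tendsto_const)
  from steps.step_coeff_square_sum_tendsto[OF t tendsto_const[of 4]]
  show "(\<lambda>n. \<Sum>l<time_index \<gamma> n t. (2 * steps.step_coeff n l)\<^sup>2) \<longlonglongrightarrow> steps.variance_clock t * 4"
    by (simp add: power_mult_distrib mult.commute)
  from steps.step_coeff_square_sum_tendsto[OF t mean_abs_error_tendsto_zero[OF steps.\<gamma> steps.c steps.r_rate]]
  show "(\<lambda>n. \<Sum>l<time_index \<gamma> n t. (steps.step_coeff n l)\<^sup>2 * mean_abs_error l) \<longlonglongrightarrow> 0" by simp
  from tendsto_mult_left[OF steps.step_coeff_cube_sum_tendsto_zero[OF t], of "2 ^ 3"]
  show "(\<lambda>n. \<Sum>l<time_index \<gamma> n t. (2 * steps.step_coeff n l) ^ 3) \<longlonglongrightarrow> 0"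
    by (simp add: power_mult_distrib sum_distrib_left)
qed (auto intro!: prob_space_axioms martingale_increment_variance_error time_index_mono
    continuous_intros steps.variance_clock_continuous)

lemma rescaled_deviation_close:
  assumes T: "T > 0" and \<epsilon>: "\<epsilon> > 0" and \<delta>: "\<delta> > 0"
  shows "\<forall>\<^sub>F n in sequentially. holds_except M \<delta> (\<lambda>\<omega>. \<forall>t\<in>{0..T}.
    \<bar>real n powr (\<gamma>/2) * steps.weight t * deviation (time_index \<gamma> n t) \<omega> - array.partial_sum n t \<omega>\<bar> \<le> \<epsilon>)"
proof -
  obtain \<Lambda> where \<Lambda>: "\<Lambda> > 0"
    and tight: "\<forall>\<^sub>F n in sequentially. holds_except M \<delta> (\<lambda>\<omega>. \<forall>t\<in>{0..T}. \<bar>array.partial_sum n t \<omega>\<bar> \<le> \<Lambda>)"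
    using array.partial_sums_tight[OF T \<delta>] by blast
  define \<eta> where "\<eta> = \<epsilon> / (2 * (1 + \<Lambda>))"
  have \<eta>: "\<eta> > 0" "\<eta> * (1 + \<Lambda>) = \<epsilon> / 2" using \<epsilon> \<Lambda> unfolding \<eta>_def by (auto simp: field_simps)
  have "T \<ge> 0" using T by simp
  note ratio = uniform_limitD[OF steps.damping_ratio_limit[OF this] \<eta>(1)]
  have "min 1 (\<epsilon> / 2) > 0" using \<epsilon> by simp
  note scale = order_tendstoD(2)[OF steps.scale_tendsto_zero this]
  show ?thesis
    using tight ratio scale
  proof eventually_elim
    case (elim n)
    show ?case
    proof (rule holds_except_mono[OF elim(1) order_refl], intro ballI)
      fix \<omega> t assume \<omega>: "\<omega> \<in> space M" and bound: "\<forall>t\<in>{0..T}. \<bar>array.partial_sum n t \<omega>\<bar> \<le> \<Lambda>" and t: "t \<in> {0..T}"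
      let ?k = "time_index \<gamma> n t"
      have "\<bar>real n powr (\<gamma>/2) * steps.weight t * deviation ?k \<omega> - array.partial_sum n t \<omega>\<bar>
          \<le> \<bar>steps.weight t * steps.damping ?k / steps.damping n - 1\<bar> * (steps.scale n + \<bar>array.partial_sum n t \<omega>\<bar>)
              + steps.scale n"
        unfolding array.partial_sum_def martingale_increment_def
        by (rule steps.rescaled_recursion_close) (intro deviation_recursion abs_deviation_le \<omega>)+
      also have "\<dots> \<le> \<eta> * (1 + \<Lambda>) + \<epsilon> / 2"
        using bspec[OF elim(2) t] elim(3) bspec[OF bound t] \<eta>(1) steps.scale_nonneg[of n]
        by (intro add_mono mult_mono) (auto simp: dist_real_def)
      finally show "\<bar>real n powr (\<gamma>/2) * steps.weight t * deviation ?k \<omega> - array.partial_sum n t \<omega>\<bar> \<le> \<epsilon>"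
        using \<eta>(2) by simp
    qed
  qed
qed

theorem fluctuation_limit:
  assumes W: "brownian_motion P W"
  shows "sk_conv_dist M (\<lambda>n \<omega> t. real n powr (\<gamma>/2) * steps.weight t * deviation (time_index \<gamma> n t) \<omega>) P
    (\<lambda>\<omega> t. W (steps.variance_clock t * (\<rho>\<^sup>2 * limit_variance)) \<omega>)"
proof (rule array.functional_central_limit_theorem[OF W _ _ rescaled_deviation_close])
  have weight: "continuous_on {0..} (\<lambda>t. real n powr (\<gamma>/2) * steps.weight t)" for n
    by (intro continuous_intros steps.weight_continuous)
  show "\<forall>\<^sub>F n in sequentially.
      (\<lambda>\<omega>. f (\<lambda>t. real n powr (\<gamma>/2) * steps.weight t * deviation (time_index \<gamma> n t) \<omega>)) \<in> borel_measurable M"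
    if "sk_test f" for f
    unfolding time_index_def
    by (rule eventually_sequentiallyI[of 1], rule sk_test_step_path_measurable[OF that _ weight deviation_measurable]) simp
  show "\<forall>\<^sub>F n in sequentially. \<forall>\<omega>\<in>space M. cadlag (\<lambda>t. real n powr (\<gamma>/2) * steps.weight t * deviation (time_index \<gamma> n t) \<omega>)"
    unfolding time_index_def
    by (rule eventually_sequentiallyI[of 1], intro ballI, rule cadlag_step_path[OF _ weight]) simp
qed

corollary subcritical_limit:
  assumes "\<gamma> < 1" "brownian_motion P W"
  shows "sk_conv_dist M
    (\<lambda>n \<omega> t. real n powr (\<gamma>/2) * exp (c * (1 - \<rho> * (1 - \<alpha>)) * t) *
       (Z (nat \<lfloor>real n + real n powr \<gamma> * t\<rfloor>) i \<omega> - Zbar N Z (nat \<lfloor>real n + real n powr \<gamma> * t\<rfloor>) \<omega>))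
    P
    (\<lambda>\<omega> t. W ((1 - 1 / real N) * (c * \<rho>^2 * q * (1 - q)) / (2 * (1 - \<rho> * (1 - \<alpha>)))
       * exp (2 * c * (1 - \<rho> * (1 - \<alpha>)) * t)) \<omega>)"
proof -
  have variance: "steps.variance_clock t * (\<rho>\<^sup>2 * limit_variance)
      = (1 - 1 / real N) * (c * \<rho>^2 * q * (1 - q)) / (2 * (1 - \<rho> * (1 - \<alpha>))) * exp (2 * c * (1 - \<rho> * (1 - \<alpha>)) * t)" for t
    unfolding steps.variance_clock_subcritical[OF assms(1)] limit_variance_def by simp
  show ?thesis
    using fluctuation_limit[OF assms(2)] unfolding variance steps.weight_def time_index_def deviation_eq
    by (simp add: less_imp_neq[OF assms(1)])
qed

corollary critical_limit:
  assumes "\<gamma> = 1" "brownian_motion P W"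
  shows "sk_conv_dist M
    (\<lambda>n \<omega> t. sqrt (real n) * (1 + t) powr (c * (1 - \<rho> * (1 - \<alpha>))) *
       (Z (nat \<lfloor>real n + real n * t\<rfloor>) i \<omega> - Zbar N Z (nat \<lfloor>real n + real n * t\<rfloor>) \<omega>))
    P
    (\<lambda>\<omega> t. W ((1 - 1 / real N) * (c^2 * \<rho>^2 * q * (1 - q)) / (2 * c * (1 - \<rho> * (1 - \<alpha>)) - 1)
       * (1 + t) powr (2 * c * (1 - \<rho> * (1 - \<alpha>)) - 1)) \<omega>)"
proof -
  have variance: "steps.variance_clock t * (\<rho>\<^sup>2 * limit_variance)
      = (1 - 1 / real N) * (c^2 * \<rho>^2 * q * (1 - q)) / (2 * c * (1 - \<rho> * (1 - \<alpha>)) - 1)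
        * (1 + t) powr (2 * c * (1 - \<rho> * (1 - \<alpha>)) - 1)" for t
    unfolding steps.variance_clock_critical[OF assms(1)] limit_variance_def by simp
  show ?thesis
    using fluctuation_limit[OF assms(2)] unfolding variance steps.weight_def time_index_def deviation_eq
    by (simp add: assms(1) powr_half_sqrt)
qed

end

theorem theorem2p9:
  fixes M :: "'a measure" and Z I :: "nat \<Rightarrow> nat \<Rightarrow> 'a \<Rightarrow> real"
    and N :: nat and \<rho> \<alpha> q c \<gamma> :: real and r :: "nat \<Rightarrow> real" and i :: nat
  assumes N: "N \<ge> 1"
    and rho: "0 \<le> \<rho>" "\<rho> < 1" and alpha: "0 \<le> \<alpha>" "\<alpha> \<le> 1" and q: "0 < q" "q < 1"
    and r: "\<And>n. 0 \<le> r n \<and> r n < 1"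
    and gamma: "1/2 < \<gamma>" "\<gamma> \<le> 1" and c: "c > 0"
    and rlim: "(\<lambda>n. real n powr \<gamma> * r n) \<longlonglongrightarrow> c"
    and M: "prob_space M"
    and Zmeas: "\<And>n j. j \<in> {1..N} \<Longrightarrow> Z n j \<in> borel_measurable M"
    and Zrange: "\<And>n j \<omega>. j \<in> {1..N} \<Longrightarrow> \<omega> \<in> space M \<Longrightarrow> 0 \<le> Z n j \<omega> \<and> Z n j \<omega> \<le> 1"
    and Imeas: "\<And>n j. j \<in> {1..N} \<Longrightarrow> I (Suc n) j \<in> borel_measurable M"
    and Irange: "\<And>n j \<omega>. j \<in> {1..N} \<Longrightarrow> \<omega> \<in> space M \<Longrightarrow> I (Suc n) j \<omega> \<in> {0, 1}"
    and recur: "\<And>n j \<omega>. j \<in> {1..N} \<Longrightarrow> \<omega> \<in> space M \<Longrightarrow>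
        Z (Suc n) j \<omega> = (1 - r n) * Z n j \<omega> + r n * (\<rho> * I (Suc n) j \<omega> + (1 - \<rho>) * q)"
    and condindep: "\<And>n S (a :: nat \<Rightarrow> real). S \<subseteq> {1..N} \<Longrightarrow>
        AE \<omega> in M. real_cond_exp M (Filt M N Z n)
            (\<lambda>\<omega>. \<Prod>j\<in>S. indicator {\<omega>. I (Suc n) j \<omega> = a j} \<omega>) \<omega>
          = (\<Prod>j\<in>S. real_cond_exp M (Filt M N Z n) (indicator {\<omega>. I (Suc n) j \<omega> = a j}) \<omega>)"
    and condprob: "\<And>n j. j \<in> {1..N} \<Longrightarrow>
        AE \<omega> in M. real_cond_exp M (Filt M N Z n) (indicator {\<omega>. I (Suc n) j \<omega> = 1}) \<omega>
          = (1 - \<alpha>) * Z n j \<omega> + \<alpha> * Zbar N Z n \<omega>"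
    and exch: "\<And>\<sigma>. \<sigma> permutes {1..N} \<Longrightarrow>
        distr M (PiM {1..N} (\<lambda>_. borel)) (\<lambda>\<omega>. \<lambda>j\<in>{1..N}. Z 0 (\<sigma> j) \<omega>)
          = distr M (PiM {1..N} (\<lambda>_. borel)) (\<lambda>\<omega>. \<lambda>j\<in>{1..N}. Z 0 j \<omega>)"
    and mean: "\<And>j. j \<in> {1..N} \<Longrightarrow> (\<integral>\<omega>. Z 0 j \<omega> \<partial>M) = 1/2"
    and var: "(\<integral>\<omega>. Zbar N Z 0 \<omega> * (1 - Zbar N Z 0 \<omega>) \<partial>M) > 0"
    and i: "i \<in> {1..N}"
  shows
   "(\<gamma> < 1 \<longrightarrow>
      (\<forall>(P :: 'b measure) W. brownian_motion P W \<longrightarrow>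
        sk_conv_dist M
          (\<lambda>n \<omega> t. real n powr (\<gamma>/2) * exp (c * (1 - \<rho> * (1 - \<alpha>)) * t) *
             (Z (nat \<lfloor>real n + real n powr \<gamma> * t\<rfloor>) i \<omega> - Zbar N Z (nat \<lfloor>real n + real n powr \<gamma> * t\<rfloor>) \<omega>))
          P
          (\<lambda>\<omega> t. W ((1 - 1 / real N) * (c * \<rho>^2 * q * (1 - q)) / (2 * (1 - \<rho> * (1 - \<alpha>)))
                       * exp (2 * c * (1 - \<rho> * (1 - \<alpha>)) * t)) \<omega>)))
    \<and>
    (\<gamma> = 1 \<and> 2 * c * (1 - \<rho> * (1 - \<alpha>)) > 1 \<longrightarrow>
      (\<forall>(P :: 'b measure) W. brownian_motion P W \<longrightarrow>
        sk_conv_dist M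
          (\<lambda>n \<omega> t. sqrt (real n) * (1 + t) powr (c * (1 - \<rho> * (1 - \<alpha>))) *
             (Z (nat \<lfloor>real n + real n * t\<rfloor>) i \<omega> - Zbar N Z (nat \<lfloor>real n + real n * t\<rfloor>) \<omega>))
          P
          (\<lambda>\<omega> t. W ((1 - 1 / real N) * (c^2 * \<rho>^2 * q * (1 - q)) / (2 * c * (1 - \<rho> * (1 - \<alpha>)) - 1)
                       * (1 + t) powr (2 * c * (1 - \<rho> * (1 - \<alpha>)) - 1)) \<omega>)))"
proof -
  interpret prob_space M by (rule M)
  interpret reinforcement M Z I N \<rho> \<alpha> q r i
    using assms by unfold_locales auto
  have fluctuation: "fluctuation M Z I N \<rho> \<alpha> q r i c \<gamma>" if "\<gamma> = 1 \<Longrightarrow> 1 < 2 * c * (1 - \<rho> * (1 - \<alpha>))"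
    using r gamma c rlim beta_range that by unfold_locales auto
  let "(_ \<longrightarrow> (\<forall>P W. _ \<longrightarrow> ?subcritical P W)) \<and> (_ \<longrightarrow> (\<forall>P W. _ \<longrightarrow> ?critical P W))" = ?thesis
  show ?thesis
  proof (intro conjI impI allI)
    fix P :: "'b measure" and W assume "\<gamma> < 1" and W: "brownian_motion P W"
    then interpret fluctuation M Z I N \<rho> \<alpha> q r i c \<gamma> by (intro fluctuation) simp
    show "?subcritical P W" by (rule subcritical_limit[OF \<open>\<gamma> < 1\<close> W])
  next
    fix P :: "'b measure" and W assume critical: "\<gamma> = 1 \<and> 2 * c * (1 - \<rho> * (1 - \<alpha>)) > 1" and W: "brownian_motion P W"
    from critical interpret fluctuation M Z I N \<rho> \<alpha> q r i c \<gamma> by (intro fluctuation) simp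
    show "?critical P W" by (rule critical_limit[OF conjunct1[OF critical] W])
  qed
qed

end
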